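(* Let $F$ be a field of characteristic $p\neq 2$ and let $\lambda$ be a partition of $n-1$. Then the blocks of the algebra $\operatorname{End}_{F\Sigma_n}(S^\lambda{\uparrow^{\Sigma_n}})$ are parametrized by the $p$-residues of the addable nodes of $[\lambda]$: the algebra is a direct product of blocks $E_r$, one for each element $r$ of the set of $p$-residues of addable nodes of $[\lambda]$. For each such $r$, the block $E_r$ has the structure of a truncated polynomial ring over $F$, and its dimension equals the number $m_r$ of addable nodes of $[\lambda]$ of $p$-residue $r$; that is, $E_r\cong F[x]/(x^{m_r})$ as $F$-algebras.
   Context: $S^\lambda$ is the Specht module of James for $F\Sigma_{n-1}$ and $\uparrow^{\Sigma_n}$ denotes induction from $\Sigma_{n-1}$ to $\Sigma_n$. The residue of the node in row $i$, column $j$ is $j-i$, and its $p$-residue is $j-i$ taken modulo $p$ (i.e. the image of $j-i$ in $F$). A node not in $[\lambda]$ is addable if adjoining it to $[\lambda]$ gives the Young diagram of a partition. The blocks of a finite-dimensional algebra are its indecomposable two-sided ideal direct summands. *)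

theory Defs
  imports
    "Jordan_Normal_Form.VS_Connect"
    "HOL-Algebra.Sym_Groups"
    "HOL-Algebra.QuotRing"
    "HOL-Combinatorics.Permutations"
    "HOL-Computational_Algebra.Polynomial"
begin

definition is_partition :: "nat list \<Rightarrow> nat \<Rightarrow> bool" where
  "is_partition lam m \<longleftrightarrow> sorted_wrt (\<ge>) lam \<and> (\<forall>k\<in>set lam. 0 < k) \<and> sum_list lam = m"

definition young :: "nat list \<Rightarrow> (nat \<times> nat) set" where
  "young lam = {(i, j). 1 \<le> i \<and> i \<le> length lam \<and> 1 \<le> j \<and> j \<le> lam ! (i - 1)}"

definition addable :: "nat list \<Rightarrow> (nat \<times> nat) set" where
  "addable lam = {x. x \<notin> young lam \<and> (\<exists>mu m. is_partition mu m \<and> young mu = insert x (young lam))}"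

text \<open>The \<open>p\<close>-residue is the image of \<open>j - i\<close> in the field, so that characteristic \<open>0\<close> needs no
  separate treatment.\<close>

definition residue :: "nat \<times> nat \<Rightarrow> 'a :: field" where
  "residue x = of_int (int (snd x) - int (fst x))"

definition addable_residues :: "nat list \<Rightarrow> 'a :: field set" where
  "addable_residues lam = residue ` addable lam"

definition addable_mult :: "nat list \<Rightarrow> 'a :: field \<Rightarrow> nat" where
  "addable_mult lam r = card {x \<in> addable lam. residue x = r}"

type_synonym tableau = "nat \<times> nat \<Rightarrow> nat"
type_synonym tabloid = "tableau set"

text \<open>Only the values of a tableau on the diagram matter. Those outside are left unconstrained;
  passing to row equivalence classes makes them irrelevant.\<close>

definition tableaux :: "nat list \<Rightarrow> tableau set" where
  "tableaux lam = {t. bij_betw t (young lam) {1..sum_list lam}}"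

definition row :: "nat list \<Rightarrow> tableau \<Rightarrow> nat \<Rightarrow> nat set" where
  "row lam t i = {t (i, j) |j. (i, j) \<in> young lam}"

definition column :: "nat list \<Rightarrow> tableau \<Rightarrow> nat \<Rightarrow> nat set" where
  "column lam t j = {t (i, j) |i. (i, j) \<in> young lam}"

definition tabloid_of :: "nat list \<Rightarrow> tableau \<Rightarrow> tabloid" where
  "tabloid_of lam t = {s \<in> tableaux lam. \<forall>i. row lam s i = row lam t i}"

definition tabloids :: "nat list \<Rightarrow> tabloid set" where
  "tabloids lam = tabloid_of lam ` tableaux lam"

definition column_stabilizer :: "nat list \<Rightarrow> tableau \<Rightarrow> (nat \<Rightarrow> nat) set" where
  "column_stabilizer lam t =
    {p \<in> carrier (sym_group (sum_list lam)). \<forall>j. p ` column lam t j = column lam t j}"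

text \<open>The permutation module \<open>M\<^sup>\<lambda>\<close> with basis the (finitely many) tabloids; an element is given by
  its coefficients. The multiplicative part of a \<^type>\<open>module\<close> record is irrelevant for modules.\<close>

definition perm_module :: "nat list \<Rightarrow> ('a :: field, tabloid \<Rightarrow> 'a) module" where
  "perm_module lam =
    \<lparr>carrier = {f. \<forall>T. T \<notin> tabloids lam \<longrightarrow> f T = 0},
     monoid.mult = undefined, one = undefined,
     zero = (\<lambda>T. 0), add = (\<lambda>f g T. f T + g T), smult = (\<lambda>c f T. c * f T)\<rparr>"

text \<open>James acts on the right; as usual this is turned into a left action, \<open>p {t} = {p \<circ> t}\<close>
  on tabloids, hence \<open>(p f) T = f (p\<inverse> T)\<close> on coefficients.\<close>

definition tabloid_act :: "(nat \<Rightarrow> nat) \<Rightarrow> tabloid \<Rightarrow> tabloid" where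
  "tabloid_act p T = (\<lambda>t. p \<circ> t) ` T"

definition perm_act :: "(nat \<Rightarrow> nat) \<Rightarrow> (tabloid \<Rightarrow> 'a) \<Rightarrow> (tabloid \<Rightarrow> 'a :: field)" where
  "perm_act p f = (\<lambda>T. f (tabloid_act (Hilbert_Choice.inv p) T))"

definition polytabloid :: "nat list \<Rightarrow> tableau \<Rightarrow> tabloid \<Rightarrow> 'a :: field" where
  "polytabloid lam t = (\<lambda>T. \<Sum>p\<in>column_stabilizer lam t.
     if T = tabloid_act p (tabloid_of lam t) then of_int (sign p) else 0)"

definition specht :: "nat list \<Rightarrow> ('a :: field, tabloid \<Rightarrow> 'a) module" where
  "specht lam = (perm_module lam)
    \<lparr>carrier := LinearCombinations.module.span class_ring (perm_module lam)
                  (polytabloid lam ` tableaux lam)\<rparr>"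

text \<open>A module over \<open>FG\<close> is given by an \<open>F\<close>-space together with a linear action of \<open>G\<close>. The
  following quotient is used for vector spaces (modulo a subspace) and for algebras (modulo an
  ideal).\<close>

definition quotient :: "('a, 'b) module \<Rightarrow> 'b set \<Rightarrow> ('a, 'b set) module" where
  "quotient A I = ring.extend (A Quot I)
    \<lparr>smult = (\<lambda>c X. \<Union>x\<in>X. I +>\<^bsub>A\<^esub> (c \<odot>\<^bsub>A\<^esub> x))\<rparr>"

text \<open>\<open>FG \<otimes>\<^sub>F V\<close> for finite \<open>G\<close>: the function \<open>f\<close> stands for the sum of all \<open>g \<otimes> f g\<close>.\<close>

definition tensor_space :: "'g monoid \<Rightarrow> ('a, 'b) module \<Rightarrow> ('a, 'g \<Rightarrow> 'b) module" where
  "tensor_space G V =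
    \<lparr>carrier = carrier G \<rightarrow>\<^sub>E carrier V,
     monoid.mult = undefined, one = undefined,
     zero = (\<lambda>g\<in>carrier G. \<zero>\<^bsub>V\<^esub>),
     add = (\<lambda>f f'. \<lambda>g\<in>carrier G. f g \<oplus>\<^bsub>V\<^esub> f' g),
     smult = (\<lambda>c f. \<lambda>g\<in>carrier G. c \<odot>\<^bsub>V\<^esub> f g)\<rparr>"

definition pure_tensor :: "'g monoid \<Rightarrow> ('a, 'b) module \<Rightarrow> 'g \<Rightarrow> 'b \<Rightarrow> 'g \<Rightarrow> 'b" where
  "pure_tensor G V g v = (\<lambda>x\<in>carrier G. if x = g then v else \<zero>\<^bsub>V\<^esub>)"

text \<open>The induced module \<open>FG \<otimes>\<^sub>F\<^sub>H V\<close>, as the quotient of \<open>FG \<otimes>\<^sub>F V\<close> by the relations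
  \<open>gh \<otimes> v = g \<otimes> hv\<close>, where \<open>H\<close> acts on \<open>V\<close> by \<open>act\<close>.\<close>

definition tensor_relations ::
  "'g monoid \<Rightarrow> 'g set \<Rightarrow> ('a :: field, 'b) module \<Rightarrow> ('g \<Rightarrow> 'b \<Rightarrow> 'b) \<Rightarrow> ('g \<Rightarrow> 'b) set" where
  "tensor_relations G H V act = LinearCombinations.module.span class_ring (tensor_space G V)
     {pure_tensor G V (g \<otimes>\<^bsub>G\<^esub> h) v \<ominus>\<^bsub>tensor_space G V\<^esub> pure_tensor G V g (act h v)
      |g h v. g \<in> carrier G \<and> h \<in> H \<and> v \<in> carrier V}"

definition induced ::
  "'g monoid \<Rightarrow> 'g set \<Rightarrow> ('a :: field, 'b) module \<Rightarrow> ('g \<Rightarrow> 'b \<Rightarrow> 'b)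
     \<Rightarrow> ('a, ('g \<Rightarrow> 'b) set) module" where
  "induced G H V act = quotient (tensor_space G V) (tensor_relations G H V act)"

text \<open>The action \<open>k (g \<otimes> v) = kg \<otimes> v\<close>.\<close>

definition induced_act ::
  "'g monoid \<Rightarrow> 'g set \<Rightarrow> ('a :: field, 'b) module \<Rightarrow> ('g \<Rightarrow> 'b \<Rightarrow> 'b)
     \<Rightarrow> 'g \<Rightarrow> ('g \<Rightarrow> 'b) set \<Rightarrow> ('g \<Rightarrow> 'b) set" where
  "induced_act G H V act k X = (\<Union>f\<in>X. tensor_relations G H V act
     +>\<^bsub>tensor_space G V\<^esub> (\<lambda>g\<in>carrier G. f (inv\<^bsub>G\<^esub> k \<otimes>\<^bsub>G\<^esub> g)))"

definition End_algebra ::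
  "'g monoid \<Rightarrow> ('a :: field, 'b) module \<Rightarrow> ('g \<Rightarrow> 'b \<Rightarrow> 'b) \<Rightarrow> ('a, 'b \<Rightarrow> 'b) module" where
  "End_algebra G V act =
    \<lparr>carrier = {\<phi> \<in> LinearCombinations.module_hom class_ring V V \<inter> extensional (carrier V).
                 \<forall>g\<in>carrier G. \<forall>v\<in>carrier V. \<phi> (act g v) = act g (\<phi> v)},
     monoid.mult = (\<lambda>\<phi> \<psi>. \<lambda>v\<in>carrier V. \<phi> (\<psi> v)),
     one = (\<lambda>v\<in>carrier V. v),
     zero = (\<lambda>v\<in>carrier V. \<zero>\<^bsub>V\<^esub>),
     add = (\<lambda>\<phi> \<psi>. \<lambda>v\<in>carrier V. \<phi> v \<oplus>\<^bsub>V\<^esub> \<psi> v),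
     smult = (\<lambda>c \<phi>. \<lambda>v\<in>carrier V. c \<odot>\<^bsub>V\<^esub> \<phi> v)\<rparr>"

definition End_induced_specht ::
  "nat \<Rightarrow> nat list
     \<Rightarrow> ('a :: field, ((nat \<Rightarrow> nat) \<Rightarrow> tabloid \<Rightarrow> 'a) set
                        \<Rightarrow> ((nat \<Rightarrow> nat) \<Rightarrow> tabloid \<Rightarrow> 'a) set) module" where
  "End_induced_specht n lam = End_algebra (sym_group n)
     (induced (sym_group n) (carrier (sym_group (n - 1))) (specht lam) perm_act)
     (induced_act (sym_group n) (carrier (sym_group (n - 1))) (specht lam) perm_act)"

definition alg_iso :: "('a, 'b) module \<Rightarrow> ('a, 'c) module \<Rightarrow> ('b \<Rightarrow> 'c) set" where
  "alg_iso A B = {h \<in> ring_iso A B. \<forall>c. \<forall>x\<in>carrier A. h (c \<odot>\<^bsub>A\<^esub> x) = c \<odot>\<^bsub>B\<^esub> h x}"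

definition alg_isomorphic :: "('a, 'b) module \<Rightarrow> ('a, 'c) module \<Rightarrow> bool" where
  "alg_isomorphic A B \<longleftrightarrow> alg_iso A B \<noteq> {}"

definition ideal_direct_sum :: "('a, 'b) module \<Rightarrow> 'b set \<Rightarrow> 'b set \<Rightarrow> 'b set \<Rightarrow> bool" where
  "ideal_direct_sum A I J K \<longleftrightarrow>
     ideal J A \<and> ideal K A \<and> J \<inter> K = {\<zero>\<^bsub>A\<^esub>} \<and> J <+>\<^bsub>A\<^esub> K = I"

text \<open>\<^const>\<open>ideal\<close> means two-sided ideal; in a unital algebra such an ideal is automatically a
  subspace.\<close>

definition blocks :: "('a, 'b) module \<Rightarrow> 'b set set" where
  "blocks A = {B. ideal B A \<and> B \<noteq> {\<zero>\<^bsub>A\<^esub>}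
     \<and> (\<exists>C. ideal_direct_sum A (carrier A) B C)
     \<and> (\<forall>J K. ideal_direct_sum A B J K \<longrightarrow> J = {\<zero>\<^bsub>A\<^esub>} \<or> K = {\<zero>\<^bsub>A\<^esub>})}"

text \<open>A direct summand regarded as an algebra in its own right; its identity element is in general
  not that of \<open>A\<close>.\<close>

definition block_algebra :: "('a, 'b) module \<Rightarrow> 'b set \<Rightarrow> ('a, 'b) module" where
  "block_algebra A B = A
    \<lparr>carrier := B, one := (THE e. e \<in> B \<and> (\<forall>x\<in>B. e \<otimes>\<^bsub>A\<^esub> x = x \<and> x \<otimes>\<^bsub>A\<^esub> e = x))\<rparr>"

definition prod_algebra :: "'i set \<Rightarrow> ('i \<Rightarrow> ('a, 'b) module) \<Rightarrow> ('a, 'i \<Rightarrow> 'b) module" where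
  "prod_algebra I A =
    \<lparr>carrier = (\<Pi>\<^sub>E i\<in>I. carrier (A i)),
     monoid.mult = (\<lambda>x y. \<lambda>i\<in>I. x i \<otimes>\<^bsub>A i\<^esub> y i),
     one = (\<lambda>i\<in>I. \<one>\<^bsub>A i\<^esub>),
     zero = (\<lambda>i\<in>I. \<zero>\<^bsub>A i\<^esub>),
     add = (\<lambda>x y. \<lambda>i\<in>I. x i \<oplus>\<^bsub>A i\<^esub> y i),
     smult = (\<lambda>c x. \<lambda>i\<in>I. c \<odot>\<^bsub>A i\<^esub> x i)\<rparr>"

definition poly_algebra :: "('a :: field, 'a poly) module" where
  "poly_algebra =
    \<lparr>carrier = UNIV, monoid.mult = (*), one = 1, zero = 0, add = (+),
     smult = Polynomial.smult\<rparr>"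

definition trunc_poly_algebra :: "nat \<Rightarrow> ('a :: field, 'a poly set) module" where
  "trunc_poly_algebra m =
    quotient poly_algebra (PIdl\<^bsub>poly_algebra\<^esub> (Polynomial.monom 1 m))"

end

theory Submission
  imports Defs
begin

text \<open>
  The induced module is realised as a space of functions on assignments of rows to the letters
  \<open>1, \<dots>, n\<close>, generated by one function \<open>e\<close> on which \<open>n\<close> carries a row label of its own below the
  diagram. The Jucys--Murphy element of the letter \<open>n\<close> acts on it by a centralising operator \<open>L\<close>.
  For an endomorphism \<open>\<Phi>\<close> the function \<open>\<Phi> e\<close> satisfies the Garnir relations, which (as \<open>2 \<noteq> 0\<close>)
  determine it by its values at one test assignment for each addable node; the functions
  \<open>e, L e, L\<^sup>2 e, \<dots>\<close> are unitriangular on these assignments, so every endomorphism is a polynomial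
  in \<open>L\<close>, of degree less than the number of addable nodes. Over the rationals, \<open>L\<close> acts on the
  constituent belonging to an addable node by its residue, so the product of all \<open>L - r\<close>, with
  one factor for each addable node, kills \<open>e\<close>; this identity has integral coefficients and hence
  holds over every field. The endomorphism algebra is therefore the quotient of the polynomial ring
  by this product, and the Chinese remainder theorem gives the blocks.
\<close>


section \<open>Polytabloids as functions on row assignments\<close>

text \<open>The generator \<open>e\<close> offers two kinds of constraints: relations between its
  translates, which every endomorphism must respect, and James's kernel relations, which every
  element of the module satisfies. In positive characteristic the module need not be semisimple and
  distinct addable nodes may share a residue, so eigenvalues cannot count endomorphisms. The count
  rests instead on bookkeeping of labels, valid wherever 2 is nonzero: labels are pushed through the
  columns from left to right, and the process can stop short only at an addable column, which is the
  origin of the test assignments. Over the rationals the residues of the addable nodes are pairwise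
  distinct integers, so there they can all be found as roots of one monic relation whose degree is
  their number. Roots that become equal in F keep their multiplicities, which is the origin of the
  exponents \<open>addable_mult lam r\<close>. The additional row label \<open>H 0\<close> plays a
  double part: it marks the letter n, and it serves as the height of a fictitious column 0, so that
  the first column is addable by the same inequality \<open>H c < H (c - 1)\<close> as all
  others.\<close>

definition col_group :: "'l set \<Rightarrow> ('l \<Rightarrow> nat) \<Rightarrow> ('l \<Rightarrow> 'l) set" where
  "col_group X cl = {s. s permutes X \<and> (\<forall>y. cl (s y) = cl y)}"

text \<open>The coefficient of a polytabloid at the tabloid in which the letter \<open>y\<close>
  lies in row \<open>\<tau> y\<close>; the terms that count are those with
  \<open>\<tau> = rw \<circ> inv s\<close>. The action of \<open>g\<close> becomes composition of
  \<open>\<tau>\<close> with \<open>g\<close> from the right. Values lie in an arbitrary commutative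
  ring, so that rational, integral and modular functions can be compared.\<close>

definition polytab :: "'l set \<Rightarrow> ('l \<Rightarrow> nat) \<Rightarrow> ('l \<Rightarrow> nat) \<Rightarrow> ('l \<Rightarrow> nat) \<Rightarrow> 'a :: comm_ring_1" where
  "polytab X cl rw \<tau> = (\<Sum>s\<in>col_group X cl. if \<tau> \<circ> s = rw then of_int (sign s) else 0)"

text \<open>The assumption on the characteristic acts through this fact: alternating functions
  vanish on assignments with a repeated label.\<close>

lemma eq_neg_zero: "(x :: 'a :: idom) = - x \<Longrightarrow> (2 :: 'a) \<noteq> 0 \<Longrightarrow> x = 0"
proof -
  assume "x = - x" "(2 :: 'a) \<noteq> 0"
  moreover from this have "2 * x = 0" by (metis add.right_inverse mult_2)
  ultimately show ?thesis by simp
qed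

lemma finite_col_group: "finite X \<Longrightarrow> finite (col_group X cl)"
  by (rule finite_subset[OF _ finite_permutations]) (auto simp: col_group_def)

lemma id_col_group: "id \<in> col_group X cl"
  by (simp add: col_group_def permutes_id)

lemma col_group_comp: "s \<in> col_group X cl \<Longrightarrow> s' \<in> col_group X cl \<Longrightarrow> s \<circ> s' \<in> col_group X cl"
  by (simp add: col_group_def permutes_compose)

lemma col_group_inv: "s \<in> col_group X cl \<Longrightarrow> Hilbert_Choice.inv s \<in> col_group X cl"
  unfolding col_group_def
proof (safe, simp add: permutes_inv)
  fix y
  assume s: "s permutes X" "\<forall>y. cl (s y) = cl y"
  then have "cl (s (Hilbert_Choice.inv s y)) = cl (Hilbert_Choice.inv s y)" by blast
  then show "cl (Hilbert_Choice.inv s y) = cl y" using s(1) by (simp add: permutes_inverses)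
qed

lemma col_group_transpose:
  "y \<in> X \<Longrightarrow> z \<in> X \<Longrightarrow> cl y = cl z \<Longrightarrow> Transposition.transpose y z \<in> col_group X cl"
  by (auto simp: col_group_def permutes_swap_id Transposition.transpose_def)

lemma sign_comp_permutes:
  "finite X \<Longrightarrow> s permutes X \<Longrightarrow> s' permutes X \<Longrightarrow> sign (s \<circ> s') = sign s * sign s'"
  by (meson permutation_permutes sign_compose)

lemma polytab_sign:
  assumes "finite X" "s \<in> col_group X cl"
  shows "polytab X cl rw (\<tau> \<circ> s) = (of_int (sign s) * polytab X cl rw \<tau> :: 'a :: comm_ring_1)"
proof -
  have s: "s permutes X" using assms by (simp add: col_group_def)
  have "polytab X cl rw (\<tau> \<circ> s) = (\<Sum>r\<in>col_group X cl. if \<tau> \<circ> s \<circ> r = rw then of_int (sign r) else (0::'a))"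
    by (simp add: polytab_def)
  also have "\<dots> = (\<Sum>r\<in>col_group X cl. of_int (sign s) * (if \<tau> \<circ> r = rw then of_int (sign r) else 0))"
  proof (rule sum.reindex_bij_witness[where i = "\<lambda>r. Hilbert_Choice.inv s \<circ> r" and j = "\<lambda>r. s \<circ> r"])
    fix r assume r: "r \<in> col_group X cl"
    show "Hilbert_Choice.inv s \<circ> (s \<circ> r) = r"
      by (simp add: comp_assoc[symmetric] permutes_inv_o[OF s])
    show "s \<circ> r \<in> col_group X cl" using r assms by (simp add: col_group_comp)
    show "s \<circ> (Hilbert_Choice.inv s \<circ> r) = r"
      by (simp add: comp_assoc[symmetric] permutes_inv_o[OF s])
    show "Hilbert_Choice.inv s \<circ> r \<in> col_group X cl" using r assms by (simp add: col_group_comp col_group_inv)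
    have "sign (s \<circ> r) = sign s * sign r" 
      using r s assms(1) by (auto simp: col_group_def intro: sign_comp_permutes)
    then have "sign r = sign s * sign (s \<circ> r)" by (simp only: sign_idempotent mult.assoc[symmetric] mult_1)
    then show "of_int (sign s) * (if \<tau> \<circ> (s \<circ> r) = rw then of_int (sign (s \<circ> r)) else 0) =
         (if \<tau> \<circ> s \<circ> r = rw then of_int (sign r) else (0::'a))"
      by (simp add: comp_assoc flip: of_int_mult)
  qed
  also have "\<dots> = of_int (sign s) * polytab X cl rw \<tau>"
    by (simp add: polytab_def sum_distrib_left)
  finally show ?thesis .
qed

lemma polytab_transpose:
  assumes "finite X" "y \<in> X" "z \<in> X" "cl y = cl z" "y \<noteq> z"
  shows "polytab X cl rw (\<tau> \<circ> Transposition.transpose y z) = - polytab X cl rw \<tau>"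
  using polytab_sign[OF assms(1) col_group_transpose[OF assms(2-4)], of rw \<tau>] assms(5)
  by (simp add: sign_swap_id)

lemma polytab_support:
  assumes "polytab X cl rw \<tau> \<noteq> (0 :: 'a :: comm_ring_1)"
  obtains s where "s \<in> col_group X cl" "\<tau> = rw \<circ> s"
proof -
  from assms have "\<exists>s\<in>col_group X cl. (if \<tau> \<circ> s = rw then of_int (sign s) else 0 :: 'a) \<noteq> 0"
    unfolding polytab_def by (rule sum.not_neutral_contains_not_neutral) blast
  then obtain s where s: "s \<in> col_group X cl" "\<tau> \<circ> s = rw"
    by (auto split: if_splits)
  have "s permutes X" using s by (simp add: col_group_def)
  then have "\<tau> = \<tau> \<circ> s \<circ> Hilbert_Choice.inv s"
    by (simp add: comp_assoc permutes_inv_o)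
  then show ?thesis using that[OF col_group_inv[OF s(1)]] s(2) by simp
qed

lemma col_group_image:
  assumes "s \<in> col_group X cl"
  shows "s ` {y \<in> X. cl y = c} = {y \<in> X. cl y = c}"
proof -
  have s: "s permutes X" "\<And>y. cl (s y) = cl y" using assms by (auto simp: col_group_def)
  have "y \<in> s ` {y \<in> X. cl y = c}" if "y \<in> X" "cl y = c" for y
  proof (rule image_eqI[of _ _ "Hilbert_Choice.inv s y"])
    show "y = s (Hilbert_Choice.inv s y)" using s by (simp add: permutes_inverses)
    then have "cl (Hilbert_Choice.inv s y) = c" using s that by metis
    then show "Hilbert_Choice.inv s y \<in> {y \<in> X. cl y = c}"
      using that s(1) by (simp add: permutes_in_image[OF permutes_inv])
  qed
  then show ?thesis using s by (auto simp: permutes_in_image)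
qed

lemma polytab_support_image:
  assumes "polytab X cl rw \<tau> \<noteq> (0 :: 'a :: comm_ring_1)"
  shows "\<tau> ` {y \<in> X. cl y = c} = rw ` {y \<in> X. cl y = c}"
proof -
  from polytab_support[OF assms] obtain s where s: "s \<in> col_group X cl" "\<tau> = rw \<circ> s" by blast
  show ?thesis unfolding s(2) image_comp[symmetric] by (simp add: col_group_image[OF s(1)])
qed

text \<open>A permutation that preserves both columns and rows fixes every cell, so only the
  identity contributes. This value is the source of the diagonal ones at the test
  assignments.\<close>

lemma polytab_row:
  assumes "finite X" and inj: "\<And>y z. y \<in> X \<Longrightarrow> z \<in> X \<Longrightarrow> cl y = cl z \<Longrightarrow> rw y = rw z \<Longrightarrow> y = z"
  shows "polytab X cl rw rw = (1 :: 'a :: comm_ring_1)"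
proof -
  have "s = id" if "s \<in> col_group X cl" "rw \<circ> s = rw" for s
  proof
    fix y
    have s: "s permutes X" "cl (s y) = cl y" using that(1) by (auto simp: col_group_def)
    show "s y = id y"
    proof (cases "y \<in> X")
      case True
      then have "s y \<in> X" using s by (simp add: permutes_in_image)
      then show ?thesis using inj[OF _ True, of "s y"] s that(2) by (metis comp_apply id_apply)
    next
      case False then show ?thesis using s by (simp add: permutes_not_in)
    qed
  qed
  then have "polytab X cl rw rw = (\<Sum>s\<in>{id}. if rw \<circ> s = rw then of_int (sign s) else 0 :: 'a)"
    unfolding polytab_def using assms id_col_group
    by (intro sum.mono_neutral_right finite_col_group) (auto, blast)
  then show ?thesis by simp
qed

section \<open>Garnir relations and kernel relations of polytabloids\<close>

lemma transpose_conj: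
  assumes "y \<noteq> u" "y \<noteq> z" "u \<noteq> z"
  shows "Transposition.transpose y u \<circ> Transposition.transpose y z
    = Transposition.transpose y z \<circ> Transposition.transpose z u"
  using assms by (auto simp: fun_eq_iff Transposition.transpose_def)

lemma transpose_conj':
  assumes "y \<noteq> u" "y \<noteq> v" "u \<noteq> v"
  shows "Transposition.transpose u v \<circ> Transposition.transpose y z
    = Transposition.transpose y (Transposition.transpose u v z) \<circ> Transposition.transpose u v"
  using assms by (auto simp: fun_eq_iff Transposition.transpose_def)

text \<open>The difference \<open>D\<close> of the two sides alternates under all transpositions of
  the letters of column \<open>c\<close> together with \<open>y\<close>. Wherever it could be
  nonzero two of these letters share a label, because the rows of the column of \<open>y\<close> all
  occur in column \<open>c\<close>; so it vanishes everywhere.\<close>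

lemma polytab_garnir:
  fixes cl rw :: "'l \<Rightarrow> nat"
  assumes two: "(2 :: 'a :: idom) \<noteq> 0" and X: "finite X"
    and inj: "\<And>y z. y \<in> X \<Longrightarrow> z \<in> X \<Longrightarrow> cl y = cl z \<Longrightarrow> rw y = rw z \<Longrightarrow> y = z"
    and cd: "c \<noteq> cl y" "y \<in> X" "rw ` {z \<in> X. cl z = cl y} \<subseteq> rw ` {z \<in> X. cl z = c}"
  shows "polytab X cl rw \<tau> =
    (\<Sum>z | z \<in> X \<and> cl z = c. polytab X cl rw (\<tau> \<circ> Transposition.transpose y z) :: 'a)"
proof -
  let ?C = "{z \<in> X. cl z = c}" and ?e = "polytab X cl rw :: _ \<Rightarrow> 'a"
  let ?t = "Transposition.transpose :: 'l \<Rightarrow> 'l \<Rightarrow> 'l \<Rightarrow> 'l"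
  define D where "D \<tau> = ?e \<tau> - (\<Sum>z\<in>?C. ?e (\<tau> \<circ> ?t y z))" for \<tau>
  have finC: "finite ?C" using X by simp
  have yC: "y \<notin> ?C" using cd by auto
  \<comment> \<open>A transposition inside column \<open>c\<close> permutes the summands of the sum
    and negates each of them.\<close>
  have anti1: "D (\<tau> \<circ> ?t u v) = - D \<tau>" if "u \<in> ?C" "v \<in> ?C" "u \<noteq> v" for u v \<tau>
  proof -
    have bij: "bij_betw (?t u v) ?C ?C" using that
      by (intro bij_betwI[of _ _ _ "?t u v"]) (auto simp: Transposition.transpose_def)
    have "(\<Sum>z\<in>?C. ?e (\<tau> \<circ> ?t u v \<circ> ?t y z)) = (\<Sum>z\<in>?C. ?e (\<tau> \<circ> ?t y (?t u v z) \<circ> ?t u v))"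
    proof (rule sum.cong[OF refl])
      fix z
      have "?t u v \<circ> ?t y z = ?t y (?t u v z) \<circ> ?t u v"
        using that yC by (intro transpose_conj') auto
      then show "?e (\<tau> \<circ> ?t u v \<circ> ?t y z) = ?e (\<tau> \<circ> ?t y (?t u v z) \<circ> ?t u v)"
        by (simp only: comp_assoc)
    qed
    also have "\<dots> = (\<Sum>z\<in>?C. - ?e (\<tau> \<circ> ?t y (?t u v z)))"
      using that X by (intro sum.cong refl polytab_transpose) auto
    also have "\<dots> = (\<Sum>z\<in>?C. - ?e (\<tau> \<circ> ?t y z))"
      by (rule sum.reindex_bij_betw[OF bij])
    finally have "(\<Sum>z\<in>?C. ?e (\<tau> \<circ> ?t u v \<circ> ?t y z)) = - (\<Sum>z\<in>?C. ?e (\<tau> \<circ> ?t y z))"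
      by (simp add: sum_negf)
    moreover have "?e (\<tau> \<circ> ?t u v) = - ?e \<tau>" using that X by (intro polytab_transpose) auto
    ultimately show ?thesis by (simp add: D_def)
  qed
  \<comment> \<open>Here the summand for \<open>z = u\<close> and the isolated term of
    \<open>D\<close> trade places, while the other summands are negated.\<close>
  have anti2: "D (\<tau> \<circ> ?t y u) = - D \<tau>" if u: "u \<in> ?C" for u \<tau>
  proof -
    have "(\<Sum>z\<in>?C. ?e (\<tau> \<circ> ?t y u \<circ> ?t y z)) =
        ?e (\<tau> \<circ> ?t y u \<circ> ?t y u) + (\<Sum>z\<in>?C - {u}. ?e (\<tau> \<circ> ?t y u \<circ> ?t y z))"
      by (rule sum.remove[OF finC u])
    also have "(\<Sum>z\<in>?C - {u}. ?e (\<tau> \<circ> ?t y u \<circ> ?t y z)) = (\<Sum>z\<in>?C - {u}. - ?e (\<tau> \<circ> ?t y z))"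
    proof (rule sum.cong[OF refl])
      fix z assume z: "z \<in> ?C - {u}"
      have "\<tau> \<circ> ?t y u \<circ> ?t y z = \<tau> \<circ> ?t y z \<circ> ?t z u"
      proof -
        have "?t y u \<circ> ?t y z = ?t y z \<circ> ?t z u"
          using z u yC by (intro transpose_conj) auto
        then show ?thesis by (simp only: comp_assoc)
      qed
      then show "?e (\<tau> \<circ> ?t y u \<circ> ?t y z) = - ?e (\<tau> \<circ> ?t y z)"
        using z u X by (auto intro: polytab_transpose)
    qed
    also have "?e (\<tau> \<circ> ?t y u \<circ> ?t y u) = ?e \<tau>" by (simp add: comp_assoc)
    finally have "(\<Sum>z\<in>?C. ?e (\<tau> \<circ> ?t y u \<circ> ?t y z)) = ?e \<tau> - (\<Sum>z\<in>?C - {u}. ?e (\<tau> \<circ> ?t y z))"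
      by (simp only: sum_negf add_uminus_conv_diff)
    moreover have "(\<Sum>z\<in>?C. ?e (\<tau> \<circ> ?t y z)) = ?e (\<tau> \<circ> ?t y u) + (\<Sum>z\<in>?C - {u}. ?e (\<tau> \<circ> ?t y z))"
      by (rule sum.remove[OF finC u])
    ultimately show ?thesis by (simp add: D_def)
  qed
  have anti: "D (\<tau> \<circ> ?t u v) = - D \<tau>" if "u \<in> insert y ?C" "v \<in> insert y ?C" "u \<noteq> v" for u v \<tau>
  proof (cases "v = y")
    case True
    then have "D (\<tau> \<circ> ?t v u) = - D \<tau>" using that anti2[of u] by simp
    then show ?thesis by (subst transpose_commute)
  next
    case False
    then show ?thesis using that anti1[of u v] anti2[of v] by (cases "u = y") simp_all
  qed
  have sup0: "\<exists>z\<in>?C. \<tau> z = \<tau> y" if "?e \<tau> \<noteq> 0" for \<tau>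
  proof -
    have "\<tau> y \<in> \<tau> ` {z \<in> X. cl z = cl y}" using cd by auto
    then have "\<tau> y \<in> \<tau> ` ?C"
      using polytab_support_image[OF that, of c] polytab_support_image[OF that, of "cl y"] cd by auto
    then show ?thesis by (auto simp: image_iff eq_commute)
  qed
  have sup: "\<exists>u\<in>insert y ?C. \<exists>v\<in>insert y ?C. u \<noteq> v \<and> \<tau> u = \<tau> v" if D: "D \<tau> \<noteq> 0" for \<tau>
  proof -
    consider "?e \<tau> \<noteq> 0" | z where "z \<in> ?C" "?e (\<tau> \<circ> ?t y z) \<noteq> 0"
      using D sum.neutral[of ?C "\<lambda>z. ?e (\<tau> \<circ> ?t y z)"] unfolding D_def by fastforce
    then show ?thesis
    proof cases
      case 1
      from sup0[OF this] obtain z where "z \<in> ?C" "\<tau> z = \<tau> y" by blast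
      then show ?thesis using yC by (intro bexI[of _ z] bexI[of _ y]) auto
    next
      case 2
      from sup0[OF 2(2)] obtain w where w: "w \<in> ?C" "(\<tau> \<circ> ?t y z) w = (\<tau> \<circ> ?t y z) y" by blast
      have "?t y z w \<noteq> ?t y z y" using w yC by (auto simp: Transposition.transpose_def)
      moreover have "?t y z w \<in> insert y ?C" "?t y z y \<in> insert y ?C"
        using w 2 by (auto simp: Transposition.transpose_def)
      ultimately show ?thesis using w(2) by (intro bexI[of _ "?t y z w"] bexI[of _ "?t y z y"]) auto
    qed
  qed
  have "D \<tau> = 0"
  proof (rule ccontr)
    assume "D \<tau> \<noteq> 0"
    from sup[OF this] obtain u v where uv: "u \<in> insert y ?C" "v \<in> insert y ?C" "u \<noteq> v" "\<tau> u = \<tau> v" by blast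
    have "\<tau> \<circ> ?t u v = \<tau>" using uv by (auto simp: fun_eq_iff Transposition.transpose_def)
    then have "D \<tau> = - D \<tau>" using anti[OF uv(1-3), of \<tau>] by simp
    then show False using two \<open>D \<tau> \<noteq> 0\<close> eq_neg_zero by blast
  qed
  then show ?thesis by (simp add: D_def)
qed

text \<open>This expresses that polytabloids lie in the kernels of James's maps between permutation
  modules. Within one column the nonzero terms are either absent or exactly two: the letter moved in
  from row \<open>j\<close> can be replaced by the one moved in from row \<open>i\<close>. A
  transposition of these two letters shows that their terms cancel.\<close>

lemma polytab_kernel:
  fixes cl rw :: "'l \<Rightarrow> nat"
  assumes X: "finite X"
    and inj: "\<And>y z. y \<in> X \<Longrightarrow> z \<in> X \<Longrightarrow> cl y = cl z \<Longrightarrow> rw y = rw z \<Longrightarrow> y = z"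
    and above: "\<And>y. y \<in> X \<Longrightarrow> rw y = j \<Longrightarrow> \<exists>z\<in>X. cl z = cl y \<and> rw z = i"
    and ij: "i \<noteq> j"
  shows "(\<Sum>y | y \<in> X \<and> \<tau> y = i. polytab X cl rw (\<tau>(y := j))) = (0 :: 'a :: comm_ring_1)"
proof -
  let ?e = "polytab X cl rw :: _ \<Rightarrow> 'a"
  define N where "N = {y \<in> X. \<tau> y = i \<and> ?e (\<tau>(y := j)) \<noteq> 0}"
  have ex: "\<exists>z\<in>N. z \<noteq> y \<and> cl z = cl y \<and> ?e (\<tau>(z := j)) = - ?e (\<tau>(y := j)) \<and>
      (\<forall>w\<in>N. cl w = cl y \<longrightarrow> w = y \<or> w = z)" if y: "y \<in> N" for y
  proof -
    have yX: "y \<in> X" "\<tau> y = i" and nz: "?e (\<tau>(y := j)) \<noteq> 0" using y by (auto simp: N_def)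
    from polytab_support[OF nz] obtain s where s: "s \<in> col_group X cl" "\<tau>(y := j) = rw \<circ> s" by blast
    have sp: "s permutes X" "\<And>y. cl (s y) = cl y" using s by (auto simp: col_group_def)
    have "rw (s y) = j" using fun_cong[OF s(2), of y] by simp
    moreover have "s y \<in> X" using sp yX by (simp add: permutes_in_image)
    ultimately obtain z' where z': "z' \<in> X" "cl z' = cl y" "rw z' = i" using above sp by metis
    define z where "z = Hilbert_Choice.inv s z'"
    have sz: "s z = z'" "z \<in> X" using sp(1) z'(1)
      by (simp_all add: z_def permutes_inverses permutes_in_image[OF permutes_inv])
    then have clz: "cl z = cl y" using sp z' by metis
    have tz: "(\<tau>(y := j)) z = i" using s(2) sz z' by simp
    then have zy: "z \<noteq> y" "\<tau> z = i" using ij by (auto split: if_splits)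
    have "\<tau>(z := j) = \<tau>(y := j) \<circ> Transposition.transpose y z"
      using zy yX by (auto simp: fun_eq_iff Transposition.transpose_def)
    then have neg: "?e (\<tau>(z := j)) = - ?e (\<tau>(y := j))"
      using polytab_transpose[OF X yX(1) sz(2) clz[symmetric] zy(1)[symmetric], of rw "\<tau>(y := j)"] by simp
    have "z \<in> N" using sz zy neg nz by (auto simp: N_def)
    moreover have "w = y \<or> w = z" if w: "w \<in> N" "cl w = cl y" for w
    proof (rule ccontr)
      assume c: "\<not> (w = y \<or> w = z)"
      have wX: "w \<in> X" "\<tau> w = i" using w by (auto simp: N_def)
      then have "rw (s w) = i" using c fun_cong[OF s(2), of w] by simp
      moreover have "s w \<in> X" "cl (s w) = cl z'" using wX sp w z' by (auto simp: permutes_in_image)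
      ultimately have "s w = s z" using inj z' sz by metis
      then show False using c sp by (metis permutes_inverses(2))
    qed
    ultimately show ?thesis using zy clz neg by blast
  qed
  then obtain p where p: "\<And>y. y \<in> N \<Longrightarrow> p y \<in> N \<and> p y \<noteq> y \<and> cl (p y) = cl y \<and> ?e (\<tau>(p y := j)) = - ?e (\<tau>(y := j)) \<and>
      (\<forall>w\<in>N. cl w = cl y \<longrightarrow> w = y \<or> w = p y)" by metis
  have pp: "p (p y) = y" if "y \<in> N" for y
    using p[OF that] p[of "p y"] that by auto
  have finN: "finite N" using X by (simp add: N_def)
  have one: "(\<Sum>y\<in>N \<inter> {y. cl y = c}. ?e (\<tau>(y := j))) = 0" for c
  proof (cases "N \<inter> {y. cl y = c} = {}")
    case False
    then obtain y where y: "y \<in> N" "cl y = c" by blast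
    then have "N \<inter> {y. cl y = c} = {y, p y}" using p[OF y(1)] by auto
    then show ?thesis using p[OF y(1)] by auto
  qed simp
  have "(\<Sum>y | y \<in> X \<and> \<tau> y = i. ?e (\<tau>(y := j))) = (\<Sum>y\<in>N. ?e (\<tau>(y := j)))"
    using X by (intro sum.mono_neutral_right) (auto simp: N_def)
  also have "\<dots> = (\<Sum>c\<in>cl ` N. \<Sum>y | y \<in> N \<and> cl y = c. ?e (\<tau>(y := j)))"
    using finN by (rule sum.image_gen)
  also have "\<dots> = 0" using one by (intro sum.neutral) (auto simp: Int_def)
  finally show ?thesis .
qed

section \<open>Vanishing of functions satisfying the Garnir relations\<close>

text \<open>\<open>H c\<close> is the height of column \<open>c\<close> and \<open>q\<close> the
  number of columns. The letter \<open>x0\<close> is alone in a fictitious column 0 and carries the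
  label \<open>H 0\<close>, one below the last row, so column permutations fix it. Labels off
  \<open>X\<close> are 0 so that equality of assignments is equality of functions.\<close>

locale labelled_diagram =
  fixes H :: "nat \<Rightarrow> nat" and q :: nat and X :: "'l set" and x0 :: 'l and rw cl :: "'l \<Rightarrow> nat"
  assumes fin: "finite X" and x0: "x0 \<in> X"
    and H_anti: "\<And>c d. c \<le> d \<Longrightarrow> H d \<le> H c"
    and H_0: "H 0 = Suc (H 1)"
    and H_zero: "\<And>c. H c = 0 \<longleftrightarrow> q < c"
    and cells: "bij_betw (\<lambda>y. (rw y, cl y)) (X - {x0}) {(i, c). 1 \<le> c \<and> 1 \<le> i \<and> i \<le> H c}"
    and cl_x0: "cl x0 = 0" and rw_x0: "rw x0 = H 0"
    and rw_out: "\<And>y. y \<notin> X \<Longrightarrow> rw y = 0"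
begin

definition Col :: "nat \<Rightarrow> 'l set" where "Col c = {y \<in> X. cl y = c}"

lemma Col_subset: "Col c \<subseteq> X" and finite_Col: "finite (Col c)"
  using fin by (auto simp: Col_def)

lemma cell_bounds:
  assumes "y \<in> X" "y \<noteq> x0"
  shows "1 \<le> cl y" "1 \<le> rw y" "rw y \<le> H (cl y)" "cl y \<le> q"
proof -
  have "(rw y, cl y) \<in> {(i, c). 1 \<le> c \<and> 1 \<le> i \<and> i \<le> H c}"
    using cells assms by (auto simp: bij_betw_def)
  then show "1 \<le> cl y" "1 \<le> rw y" "rw y \<le> H (cl y)" by auto
  then show "cl y \<le> q" using H_zero[of "cl y"] by auto
qed

lemma cl_eq_0: "y \<in> X \<Longrightarrow> cl y = 0 \<longleftrightarrow> y = x0"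
  using cell_bounds(1)[of y] cl_x0 by (cases "y = x0") auto

lemma cell_inj: "y \<in> X \<Longrightarrow> z \<in> X \<Longrightarrow> cl y = cl z \<Longrightarrow> rw y = rw z \<Longrightarrow> y = z"
proof -
  assume yz: "y \<in> X" "z \<in> X" "cl y = cl z" "rw y = rw z"
  show "y = z"
  proof (cases "y = x0 \<or> z = x0")
    case True
    then show ?thesis using cl_eq_0 cl_x0 yz by metis
  next
    case False
    then show ?thesis using yz cells by (auto simp: bij_betw_def inj_on_def)
  qed
qed

lemma cell_ex:
  assumes "1 \<le> c" "1 \<le> i" "i \<le> H c"
  obtains y where "y \<in> Col c" "rw y = i" "y \<noteq> x0"
proof -
  have "(i, c) \<in> (\<lambda>y. (rw y, cl y)) ` (X - {x0})" using cells assms by (auto simp: bij_betw_def)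
  then show ?thesis using that by (auto simp: Col_def)
qed

lemma Col_rw: "1 \<le> c \<Longrightarrow> bij_betw rw (Col c) {1..H c}"
proof (rule bij_betw_imageI)
  show "inj_on rw (Col c)" using cell_inj by (auto simp: inj_on_def Col_def)
  assume c: "1 \<le> c"
  show "rw ` Col c = {1..H c}"
  proof
    show "rw ` Col c \<subseteq> {1..H c}"
    proof
      fix i assume "i \<in> rw ` Col c"
      then obtain y where y: "y \<in> X" "cl y = c" "i = rw y" by (auto simp: Col_def)
      then have "y \<noteq> x0" using c cl_x0 by auto
      then show "i \<in> {1..H c}" using cell_bounds[of y] y by simp
    qed
    show "{1..H c} \<subseteq> rw ` Col c"
    proof
      fix i assume "i \<in> {1..H c}"
      then obtain y where "y \<in> Col c" "rw y = i" using cell_ex[of c i] c by auto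
      then show "i \<in> rw ` Col c" by blast
    qed
  qed
qed

lemma card_Col: "1 \<le> c \<Longrightarrow> card (Col c) = H c"
  using bij_betw_same_card[OF Col_rw] by simp

text \<open>Once the columns before \<open>c\<close> are normalised, what has to be known about the
  others is which labels are left for them.\<close>

definition ms :: "nat \<Rightarrow> ('l \<Rightarrow> nat) \<Rightarrow> nat multiset" where
  "ms c \<tau> = image_mset \<tau> (mset_set {y \<in> X. c \<le> cl y})"

lemma ms_Suc: "ms c \<tau> = image_mset \<tau> (mset_set (Col c)) + ms (Suc c) \<tau>"
proof -
  have "{y \<in> X. c \<le> cl y} = Col c \<union> {y \<in> X. Suc c \<le> cl y}" by (auto simp: Col_def)
  moreover have "Col c \<inter> {y \<in> X. Suc c \<le> cl y} = {}" by (auto simp: Col_def)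
  ultimately show ?thesis using fin by (simp add: ms_def mset_set_Union finite_Col)
qed

lemma ms_cong: "(\<And>y. y \<in> X \<Longrightarrow> c \<le> cl y \<Longrightarrow> \<tau> y = \<tau>' y) \<Longrightarrow> ms c \<tau> = ms c \<tau>'"
  unfolding ms_def using fin by (intro image_mset_cong) auto

lemma in_ms: "a \<in># ms c \<tau> \<longleftrightarrow> (\<exists>y\<in>X. c \<le> cl y \<and> \<tau> y = a)"
  unfolding ms_def using fin by auto

lemma ms_empty: "q < c \<Longrightarrow> ms c \<tau> = {#}"
proof -
  assume "q < c"
  then have "\<not> c \<le> cl y" if "y \<in> X" for y
    using cell_bounds(4)[OF that] cl_x0 by (cases "y = x0") auto
  then have "{y \<in> X. c \<le> cl y} = {}" by blast
  then show ?thesis by (simp only: ms_def) simp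
qed

lemma ms_transpose:
  assumes "y \<in> X" "z \<in> X" "c \<le> cl y" "c \<le> cl z"
  shows "ms c (\<tau> \<circ> Transposition.transpose y z) = ms c \<tau>"
proof -
  let ?S = "{y \<in> X. c \<le> cl y}"
  have "Transposition.transpose y z permutes ?S" using assms by (intro permutes_swap_id) auto
  then have "image_mset (Transposition.transpose y z) (mset_set ?S) = mset_set ?S"
    by (simp add: image_mset_mset_set permutes_inj_on permutes_image)
  then show ?thesis by (simp add: ms_def flip: multiset.map_comp)
qed

lemma image_mset_Col: "inj_on \<tau> (Col c) \<Longrightarrow> image_mset \<tau> (mset_set (Col c)) = mset_set (\<tau> ` Col c)"
  by (rule image_mset_mset_set)

lemma image_mset_Col_rw: "1 \<le> c \<Longrightarrow> image_mset rw (mset_set (Col c)) = mset_set {1..H c}"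
  using Col_rw[of c] by (simp add: bij_betw_def image_mset_Col)

text \<open>Moving the labels of the bottom cells of the columns one step to the right, where \<open>H 0\<close> is the
  label of the letter \<open>x0\<close>; the other labels are row numbers.\<close>

definition shift :: "'l \<Rightarrow> nat" where
  "shift y = (if rw y = H (cl y) then H (cl y - 1) else rw y)"

text \<open>For columns \<open>u \<le> w\<close> this is the assignment obtained from \<^term>\<open>rw\<close> by a cyclic permutation moving \<open>x0\<close>
  into column \<open>u\<close>, the bottom letters of the columns \<open>u, \<dots>, w - 1\<close> successively into the next
  shorter column, and the top letter of column \<open>w\<close> to the place of \<open>x0\<close>.\<close>

definition chain :: "nat \<Rightarrow> nat \<Rightarrow> 'l \<Rightarrow> nat" where
  "chain u w y = (if y \<notin> X then 0 else if y = x0 then 1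
     else if u \<le> cl y \<and> cl y \<le> w \<and> rw y = (if cl y = w then 1 else H (cl y))
       then (if cl y = u then H 0 else H (cl y - 1)) else rw y)"

end

text \<open>The properties of the image \<open>f\<close> of \<open>e\<close> under an endomorphism:
  \<open>col_sign\<close> and \<open>garnir\<close> come from relations between translates of
  \<open>e\<close>, whereas \<open>kernel\<close> and \<open>content\<close> hold for every element
  of the module.\<close>

locale garnir_function = labelled_diagram H q X x0 rw cl
  for H q X and x0 :: 'l and rw cl +
  fixes f :: "('l \<Rightarrow> nat) \<Rightarrow> 'a :: idom"
  assumes two: "(2 :: 'a) \<noteq> 0"
    and col_sign: "\<And>s \<tau>. s \<in> col_group X cl \<Longrightarrow> f (\<tau> \<circ> s) = of_int (sign s) * f \<tau>"
    and garnir: "\<And>y c \<tau>. y \<in> X \<Longrightarrow> 1 \<le> c \<Longrightarrow> c < cl y \<Longrightarrow>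
      f \<tau> = (\<Sum>z\<in>Col c. f (\<tau> \<circ> Transposition.transpose y z))"
    and kernel: "\<And>i j \<tau>. 1 \<le> i \<Longrightarrow> i < j \<Longrightarrow> j \<le> H 1 \<Longrightarrow>
      (\<Sum>y | y \<in> X \<and> \<tau> y = i. f (\<tau>(y := j))) = 0"
    and content: "\<And>\<tau>. f \<tau> \<noteq> 0 \<Longrightarrow> \<exists>s. s permutes X \<and> \<tau> = rw \<circ> s"
begin

section \<open>Alternation within the columns\<close>

lemma f_repeat:
  assumes "y \<in> X" "z \<in> X" "cl y = cl z" "y \<noteq> z" "\<tau> y = \<tau> z"
  shows "f \<tau> = 0"
proof -
  have "\<tau> \<circ> Transposition.transpose y z = \<tau>"
    using assms by (auto simp: fun_eq_iff Transposition.transpose_def)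
  then have "f \<tau> = - f \<tau>"
    using col_sign[OF col_group_transpose[of y X z cl], of \<tau>] assms by (simp add: sign_swap_id)
  then show ?thesis using eq_neg_zero two by blast
qed

lemma f_inj_on_Col: "f \<tau> \<noteq> 0 \<Longrightarrow> inj_on \<tau> (Col c)"
proof (rule inj_onI)
  fix y z
  assume "f \<tau> \<noteq> 0" "y \<in> Col c" "z \<in> Col c" "\<tau> y = \<tau> z"
  then show "y = z" using f_repeat[of y z \<tau>] by (auto simp: Col_def)
qed

text \<open>Up to sign \<open>f\<close> depends only on the set of labels in each column, since a
  nonzero value forces these labels to be distinct.\<close>

lemma f_sort:
  assumes im: "\<tau> ` Col c = \<tau>' ` Col c" and off: "\<And>y. y \<notin> Col c \<Longrightarrow> \<tau> y = \<tau>' y" and z: "f \<tau>' = 0"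
  shows "f \<tau> = 0"
proof (rule ccontr)
  assume nz: "f \<tau> \<noteq> 0"
  have inj: "inj_on \<tau> (Col c)" using nz by (rule f_inj_on_Col)
  then have inj': "inj_on \<tau>' (Col c)"
    using im card_image[OF inj] by (intro eq_card_imp_inj_on finite_Col) simp
  define s where "s = (\<lambda>y. if y \<in> Col c then the_inv_into (Col c) \<tau> (\<tau>' y) else y)"
  have sC: "s y \<in> Col c \<and> \<tau> (s y) = \<tau>' y" if "y \<in> Col c" for y
  proof -
    have "\<tau>' y \<in> \<tau> ` Col c" using im that by auto
    then show ?thesis using inj that
      by (simp add: s_def the_inv_into_into f_the_inv_into_f)
  qed
  have "bij_betw s (Col c) (Col c)"
  proof -
    have "inj_on s (Col c)"
    proof (rule inj_onI)
      fix y z assume "y \<in> Col c" "z \<in> Col c" "s y = s z"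
      then show "y = z" using sC[of y] sC[of z] inj_onD[OF inj', of y z] by simp
    qed
    moreover have "s ` Col c \<subseteq> Col c" using sC by auto
    ultimately show ?thesis using endo_inj_surj[OF finite_Col, of s c] by (simp add: bij_betw_def)
  qed
  then have "s permutes Col c" by (intro bij_imp_permutes) (auto simp: s_def)
  moreover have "cl (s y) = cl y" for y
    using sC[of y] by (cases "y \<in> Col c") (auto simp: s_def Col_def)
  ultimately have "s \<in> col_group X cl"
    using Col_subset by (auto simp: col_group_def intro: permutes_subset)
  then have "f (\<tau> \<circ> s) = of_int (sign s) * f \<tau>" by (rule col_sign)
  moreover have "\<tau> \<circ> s = \<tau>'"
  proof
    fix y show "(\<tau> \<circ> s) y = \<tau>' y" using sC[of y] off[of y] by (cases "y \<in> Col c") (auto simp: s_def)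
  qed
  moreover have "(of_int (sign s) :: 'a) \<noteq> 0" by (simp add: sign_def)
  ultimately show False using z nz by simp
qed

text \<open>If the columns from \<open>c\<close> on carry their standard labels in any order, column
  \<open>c\<close> can only hold \<open>1, \<dots>, H c\<close>: its \<open>H c\<close> labels are
  distinct and none exceeds \<open>H c\<close>. Sorting this column leaves the same situation for
  the next one.\<close>

lemma f_standard_rest:
  assumes "1 \<le> c" "ms c \<tau> = ms c rw" "f (\<lambda>y. if y \<in> X \<and> c \<le> cl y then rw y else \<tau> y) = 0"
  shows "f \<tau> = 0"
  using assms
proof (induction "Suc q - c" arbitrary: c \<tau>)
  case 0
  then have "\<not> c \<le> cl y" if "y \<in> X" for y
    using cell_bounds(4)[OF that] cl_x0 by (cases "y = x0") auto
  then have "(\<lambda>y. if y \<in> X \<and> c \<le> cl y then rw y else \<tau> y) = \<tau>" by (intro ext) auto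
  then show ?case using 0 by simp
next
  case (Suc k)
  show ?case
  proof (rule ccontr)
    assume nz: "f \<tau> \<noteq> 0"
    note inj = f_inj_on_Col[OF nz, of c]
    have sub: "\<tau> ` Col c \<subseteq> {1..H c}"
    proof
      fix a assume "a \<in> \<tau> ` Col c"
      then have "a \<in># ms c \<tau>" by (auto simp: in_ms Col_def)
      then obtain y where y: "y \<in> X" "c \<le> cl y" "rw y = a" using Suc.prems(2) by (auto simp: in_ms)
      then have "y \<noteq> x0" using Suc.prems(1) cl_x0 by auto
      then show "a \<in> {1..H c}" using y cell_bounds[of y] H_anti[of c "cl y"] by auto
    qed
    have im: "\<tau> ` Col c = {1..H c}"
      using sub card_image[OF inj] card_Col[OF Suc.prems(1)] by (intro card_subset_eq) auto
    define \<tau>1 where "\<tau>1 = (\<lambda>y. if y \<in> Col c then rw y else \<tau> y)"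
    have "ms (Suc c) \<tau>1 = ms (Suc c) \<tau>" by (rule ms_cong) (auto simp: \<tau>1_def Col_def)
    also have "\<dots> = ms (Suc c) rw"
      using Suc.prems ms_Suc[of c \<tau>] ms_Suc[of c rw] image_mset_Col[OF inj] im image_mset_Col_rw[of c] by simp
    finally have m: "ms (Suc c) \<tau>1 = ms (Suc c) rw" .
    have e: "(\<lambda>y. if y \<in> X \<and> Suc c \<le> cl y then rw y else \<tau>1 y) =
        (\<lambda>y. if y \<in> X \<and> c \<le> cl y then rw y else \<tau> y)"
      by (auto simp: \<tau>1_def Col_def fun_eq_iff)
    have "f \<tau>1 = 0"
    proof (rule Suc.hyps(1)[OF _ _ m])
      show "k = Suc q - Suc c" using Suc.hyps(2) by simp
      show "f (\<lambda>y. if y \<in> X \<and> Suc c \<le> cl y then rw y else \<tau>1 y) = 0"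
        unfolding e by (rule Suc.prems(3))
    qed simp
    moreover have "\<tau>1 ` Col c = \<tau> ` Col c"
      using Col_rw[OF Suc.prems(1)] im by (simp add: \<tau>1_def bij_betw_def)
    ultimately have "f \<tau> = 0" by (intro f_sort[of \<tau> c \<tau>1]) (auto simp: \<tau>1_def)
    then show False using nz by simp
  qed
qed

text \<open>The state of the sorting process at column \<open>c\<close>: \<open>x0\<close> has taken
  a 1, each earlier column has exchanged its bottom label for that of its predecessor, and the
  columns left over lack a 1 and have the surplus label \<open>H (c - 1)\<close>. For
  \<open>c = 1\<close> the surplus is the original label of \<open>x0\<close>.\<close>

definition shifted_below :: "nat \<Rightarrow> ('l \<Rightarrow> nat) \<Rightarrow> bool" where
  "shifted_below c \<tau> \<longleftrightarrow> \<tau> x0 = 1 \<and> (\<forall>y. y \<notin> X \<longrightarrow> \<tau> y = 0)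
    \<and> (\<forall>y\<in>X. 1 \<le> cl y \<longrightarrow> cl y < c \<longrightarrow> \<tau> y = shift y)
    \<and> add_mset 1 (ms c \<tau>) = add_mset (H (c - 1)) (ms c rw)"

lemma shift_image:
  assumes "1 \<le> c" "1 \<le> H c"
  shows "shift ` Col c = insert (H (c - 1)) ({1..H c} - {H c})"
proof
  show "shift ` Col c \<subseteq> insert (H (c - 1)) ({1..H c} - {H c})"
  proof
    fix i assume "i \<in> shift ` Col c"
    then obtain y where y: "y \<in> Col c" "i = shift y" by blast
    then have "rw y \<in> {1..H c}" "cl y = c"
      using bij_betwE[OF Col_rw[OF assms(1)]] by (auto simp: Col_def)
    then show "i \<in> insert (H (c - 1)) ({1..H c} - {H c})" using y(2) by (auto simp: shift_def)
  qed
  show "insert (H (c - 1)) ({1..H c} - {H c}) \<subseteq> shift ` Col c"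
  proof
    fix i assume i: "i \<in> insert (H (c - 1)) ({1..H c} - {H c})"
    show "i \<in> shift ` Col c"
    proof (cases "i = H (c - 1)")
      case True
      from cell_ex[OF assms order_refl] obtain y where "y \<in> Col c" "rw y = H c" by blast
      then show ?thesis using True by (intro image_eqI[of _ _ y]) (auto simp: shift_def Col_def)
    next
      case False
      with i have "1 \<le> i" "i \<le> H c" by auto
      from cell_ex[OF assms(1) this] obtain y where "y \<in> Col c" "rw y = i" by blast
      then show ?thesis using i False by (intro image_eqI[of _ _ y]) (auto simp: shift_def Col_def)
    qed
  qed
qed

text \<open>Column \<open>c\<close> takes the surplus label and releases its own bottom label, which
  becomes the surplus of the remaining columns.\<close>

lemma f_shift_step:
  assumes c: "1 \<le> c" "1 \<le> H c" and sb: "shifted_below c \<tau>"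
    and im: "\<tau> ` Col c = insert (H (c - 1)) ({1..H c} - {H c})"
    and IH: "\<And>\<tau>. shifted_below (Suc c) \<tau> \<Longrightarrow> f \<tau> = 0"
  shows "f \<tau> = 0"
proof (rule ccontr)
  assume nz: "f \<tau> \<noteq> 0"
  note inj = f_inj_on_Col[OF nz, of c]
  define \<tau>1 where "\<tau>1 = (\<lambda>y. if y \<in> Col c then shift y else \<tau> y)"
  let ?M = "mset_set ({1..H c} - {H c})"
  have v: "H (c - 1) \<notin> {1..H c} - {H c}" using H_anti[of "c - 1" c] by auto
  have "ms (Suc c) \<tau>1 = ms (Suc c) \<tau>" by (rule ms_cong) (auto simp: \<tau>1_def Col_def)
  moreover have "ms c \<tau> = add_mset (H (c - 1)) ?M + ms (Suc c) \<tau>"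
    using ms_Suc[of c \<tau>] image_mset_Col[OF inj] im v by simp
  moreover have "ms c rw = add_mset (H c) ?M + ms (Suc c) rw"
  proof -
    have "mset_set {1..H c} = add_mset (H c) ?M" using c by (intro mset_set.remove) auto
    then show ?thesis using ms_Suc[of c rw] image_mset_Col_rw[OF c(1)] by simp
  qed
  moreover have "add_mset 1 (ms c \<tau>) = add_mset (H (c - 1)) (ms c rw)" using sb by (simp add: shifted_below_def)
  ultimately have "add_mset 1 (ms (Suc c) \<tau>1) = add_mset (H c) (ms (Suc c) rw)" by simp
  then have "shifted_below (Suc c) \<tau>1"
    using sb c cl_x0 unfolding shifted_below_def by (auto simp: \<tau>1_def Col_def less_Suc_eq)
  then have "f \<tau>1 = 0" by (rule IH)
  moreover have "\<tau>1 ` Col c = \<tau> ` Col c"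
    using shift_image[OF c] im by (simp add: \<tau>1_def)
  ultimately have "f \<tau> = 0" by (intro f_sort[of \<tau> c \<tau>1]) (auto simp: \<tau>1_def)
  then show False using nz by simp
qed

lemma shifted_labels:
  assumes "1 \<le> c" "shifted_below c \<tau>" "y \<in> X" "c \<le> cl y"
  shows "\<tau> y = H (c - 1) \<or> \<tau> y \<in> {1..H c}"
proof -
  have "\<tau> y \<in># add_mset 1 (ms c \<tau>)" using assms by (auto simp: in_ms)
  moreover have "add_mset 1 (ms c \<tau>) = add_mset (H (c - 1)) (ms c rw)"
    using assms(2) unfolding shifted_below_def by blast
  ultimately have "\<tau> y \<in># add_mset (H (c - 1)) (ms c rw)" by metis
  then consider "\<tau> y = H (c - 1)" | z where "z \<in> X" "c \<le> cl z" "rw z = \<tau> y" by (auto simp: in_ms)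
  then show ?thesis
  proof cases
    case 2
    then have "z \<noteq> x0" using assms cl_x0 by auto
    then show ?thesis using cell_bounds[of z] 2 H_anti[of c "cl z"] by simp
  qed simp
qed

lemma shifted_transpose:
  assumes sb: "shifted_below c \<tau>" and yz: "y \<in> X" "z \<in> X" "c \<le> cl y" "c \<le> cl z" and c: "1 \<le> c"
  shows "shifted_below c (\<tau> \<circ> Transposition.transpose y z)"
proof -
  have "y \<noteq> x0" "z \<noteq> x0" using yz c cl_x0 by auto
  then have "(\<tau> \<circ> Transposition.transpose y z) x = \<tau> x" if "x = x0 \<or> x \<notin> X \<or> cl x < c" for x
    using that yz by (auto simp: Transposition.transpose_def)
  then show ?thesis
    using sb ms_transpose[OF yz, of \<tau>] unfolding shifted_below_def by metis
qed

text \<open>Induction on the number of columns left. When a column holds a surplus label larger than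
  its height, exactly one of its own labels is missing. If that is the bottom label, the process
  continues; if it is 1, the assignment is \<open>chain 1 c\<close> up to sorting; and a kernel
  relation trades any other missing label for the bottom one.\<close>

lemma f_shifted_zero:
  assumes ev: "\<And>c. 1 \<le> c \<Longrightarrow> c \<le> q \<Longrightarrow> H c < H (c - 1) \<Longrightarrow> f (chain 1 c) = 0"
    and q: "1 \<le> q"
  shows "1 \<le> c \<Longrightarrow> c \<le> Suc q \<Longrightarrow> shifted_below c \<tau> \<Longrightarrow> f \<tau> = 0"
proof (induction "Suc q - c" arbitrary: c \<tau>)
  case 0
  then have c: "c = Suc q" by simp
  \<comment> \<open>No column is left to hold the surplus \<open>H q\<close>, so it must be the
    missing 1.\<close>
  then have "H q = 1" using 0 ms_empty[of c] by (simp add: shifted_below_def)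
  \<comment> \<open>All columns from \<open>d\<close> to \<open>q\<close> have height 1, so shifting
    changes nothing beyond \<open>d\<close>, and the completely shifted assignment is
    \<open>chain 1 d\<close>. As \<open>H 0\<close> is at least 2, column \<open>d\<close> is not
    the fictitious one.\<close>
  define d where "d = (LEAST c. H c \<le> 1)"
  have Hd: "H d \<le> 1" unfolding d_def by (rule LeastI[of _ q]) (simp add: \<open>H q = 1\<close>)
  have d_le: "d \<le> m" if "H m \<le> 1" for m unfolding d_def using that by (rule Least_le)
  have dq: "d \<le> q" by (rule d_le) (simp add: \<open>H q = 1\<close>)
  have "H 1 \<noteq> 0" using H_zero[of 1] q by auto
  then have d1: "1 \<le> d" using Hd H_0 by (cases d) auto
  have Hd1: "H d = 1" using Hd H_zero[of d] dq by auto
  have "\<not> H (d - 1) \<le> 1" using d1 d_le[of "d - 1"] by auto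
  then have "f (chain 1 d) = 0" using ev d1 dq Hd by auto
  moreover have "chain 1 d = \<tau>"
  proof
    fix y
    consider "y \<notin> X" | "y = x0" | "y \<in> X" "y \<noteq> x0" by blast
    then show "chain 1 d y = \<tau> y"
    proof cases
      case 3
      note b = cell_bounds[OF 3]
      have ty: "\<tau> y = shift y" using 0 b 3 c by (auto simp: shifted_below_def)
      consider "cl y < d" | "cl y = d" | "d < cl y" by linarith
      then show ?thesis
      proof cases
        case 1
        then show ?thesis using ty b 3 by (auto simp: chain_def shift_def)
      next
        case 2
        then have "rw y = 1" using b Hd1 by auto
        then show ?thesis using ty b 2 3 Hd1 by (auto simp: chain_def shift_def)
      next
        case d: 3
        then have "H (cl y) \<le> 1" "H (cl y - 1) \<le> 1" using Hd1 H_anti[of d "cl y"] H_anti[of d "cl y - 1"] by auto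
        moreover have "H (cl y - 1) \<noteq> 0" using H_zero[of "cl y - 1"] b by auto
        ultimately have "rw y = 1" "H (cl y - 1) = 1" "H (cl y) = 1" using b by linarith+
        then show ?thesis using ty d 3 b by (auto simp: chain_def shift_def)
      qed
    qed (use 0 x0 in \<open>auto simp: chain_def shifted_below_def\<close>)
  qed
  ultimately show ?case by simp
next
  case (Suc k)
  then have cq: "1 \<le> c" "c \<le> q" by auto
  then have Hc: "1 \<le> H c" using H_zero[of c] by auto
  have IH: "f \<tau> = 0" if "shifted_below (Suc c) \<tau>" for \<tau>
    using Suc.hyps(2) cq that by (intro Suc.hyps(1)[of "Suc c"]) auto
  note step = f_shift_step[OF cq(1) Hc _ _ IH]
  show ?case
  proof (cases "H (c - 1) = H c")
    \<comment> \<open>The surplus equals the bottom label, so column \<open>c\<close> holds exactly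
      \<open>1, \<dots>, H c\<close> and already counts as shifted.\<close>
    case True
    show ?thesis
    proof (rule ccontr)
      assume nz: "f \<tau> \<noteq> 0"
      have "\<tau> ` Col c \<subseteq> {1..H c}"
        using shifted_labels[OF cq(1) Suc.prems(3)] True Hc by (fastforce simp: Col_def)
      then have "\<tau> ` Col c = {1..H c}"
        using card_image[OF f_inj_on_Col[OF nz, of c]] card_Col[OF cq(1)] by (intro card_subset_eq) auto
      then have "\<tau> ` Col c = insert (H (c - 1)) ({1..H c} - {H c})" using True Hc by auto
      then show False using step Suc.prems(3) nz by blast
    qed
  next
    case False
    define v where "v = H (c - 1)"
    have v: "H c < v" using False H_anti[of "c - 1" c] by (simp add: v_def)
    have key: "f \<tau> = 0" if sb: "shifted_below c \<tau>" and y: "y \<in> Col c" "\<tau> y = v" for \<tau> y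
    proof (rule ccontr)
      assume nz: "f \<tau> \<noteq> 0"
      note inj = f_inj_on_Col[OF nz, of c]
      have sub: "\<tau> ` Col c \<subseteq> insert v {1..H c}"
        using shifted_labels[OF cq(1) sb] by (fastforce simp: Col_def v_def)
      have vin: "v \<in> \<tau> ` Col c" using y by auto
      have "card (insert v {1..H c} - \<tau> ` Col c) = 1"
        using sub v card_image[OF inj] card_Col[OF cq(1)] by (subst card_Diff_subset) (auto simp: finite_Col)
      then obtain p where p: "insert v {1..H c} - \<tau> ` Col c = {p}" by (auto simp: card_1_singleton_iff)
      have pv: "p \<noteq> v" "p \<in> {1..H c}" using p vin by auto
      have im: "\<tau> ` Col c = insert v ({1..H c} - {p})"
      proof -
        have "\<tau> ` Col c = insert v {1..H c} - {p}" using p sub by blast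
        then show ?thesis using pv by auto
      qed
      consider "p = H c" | "p = 1" "p < H c" | "1 < p" "p < H c" using pv by fastforce
      then show False
      proof cases
        case 1
        then show False using step[OF sb] im nz by (simp add: v_def)
      next
        case 2
        let ?M = "mset_set ({1..H c} - {1})"
        have "ms c \<tau> = add_mset v ?M + ms (Suc c) \<tau>"
          using ms_Suc[of c \<tau>] image_mset_Col[OF inj] im v 2 by simp
        moreover have "ms c rw = add_mset 1 ?M + ms (Suc c) rw"
        proof -
          have "mset_set {1..H c} = add_mset 1 ?M" using Hc by (intro mset_set.remove) auto
          then show ?thesis using ms_Suc[of c rw] image_mset_Col_rw[OF cq(1)] by simp
        qed
        moreover have "add_mset 1 (ms c \<tau>) = add_mset v (ms c rw)" using sb by (simp add: shifted_below_def v_def)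
        \<comment> \<open>The 1 missing from column \<open>c\<close> is the one taken by
          \<open>x0\<close>, so the later columns carry their standard labels.\<close>
        ultimately have m: "ms (Suc c) \<tau> = ms (Suc c) rw" by simp
        let ?t = "\<lambda>y. if y \<in> X \<and> Suc c \<le> cl y then rw y else \<tau> y"
        have "f ?t = 0"
        proof (rule f_sort[of _ c "chain 1 c"])
          show "f (chain 1 c) = 0" using ev cq v by (simp add: v_def)
          have "?t ` Col c = \<tau> ` Col c" by (intro image_cong) (auto simp: Col_def)
          also have "\<dots> = insert v ({1..H c} - {1})" using im 2 by simp
          also have "\<dots> = chain 1 c ` Col c"
          proof
            have ch: "chain 1 c y = (if rw y = 1 then v else rw y)" if "y \<in> Col c" for y
              using that cq cl_x0 H_0 by (auto simp: chain_def Col_def v_def)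
            show "insert v ({1..H c} - {1}) \<subseteq> chain 1 c ` Col c"
            proof
              fix i assume i: "i \<in> insert v ({1..H c} - {1})"
              show "i \<in> chain 1 c ` Col c"
              proof (cases "i = v")
                case True
                from cell_ex[OF cq(1) order_refl Hc] obtain y where "y \<in> Col c" "rw y = 1" by blast
                then show ?thesis using True ch[of y] by (intro image_eqI[of _ _ y]) simp_all
              next
                case False
                with i have "1 \<le> i" "i \<le> H c" by auto
                from cell_ex[OF cq(1) this] obtain y where "y \<in> Col c" "rw y = i" by blast
                then show ?thesis using False i ch[of y] by (intro image_eqI[of _ _ y]) auto
              qed
            qed
            show "chain 1 c ` Col c \<subseteq> insert v ({1..H c} - {1})"
            proof
              fix i assume "i \<in> chain 1 c ` Col c"
              then obtain y where y: "y \<in> Col c" "i = chain 1 c y" by blast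
              then have "rw y \<in> {1..H c}" using bij_betwE[OF Col_rw[OF cq(1)]] by blast
              then show "i \<in> insert v ({1..H c} - {1})" using y(2) ch[OF y(1)] by auto
            qed
          qed
          finally show "?t ` Col c = chain 1 c ` Col c" .
          fix y assume y: "y \<notin> Col c"
          consider "y \<notin> X" | "y = x0" | "y \<in> X" "y \<noteq> x0" by blast
          then show "?t y = chain 1 c y"
          proof cases
            case 3
            note b = cell_bounds[OF 3]
            have "cl y < c \<or> c < cl y" using y 3 by (auto simp: Col_def)
            then show ?thesis using b 3 sb by (auto simp: chain_def shift_def shifted_below_def)
          qed (use sb x0 cl_x0 in \<open>auto simp: chain_def shifted_below_def\<close>)
        qed
        then have "f \<tau> = 0" using m by (intro f_standard_rest[of "Suc c" \<tau>]) auto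
        then show False using nz by simp
      next
        case 3
        have "H c \<in> \<tau> ` Col c" using im 3 by auto
        then obtain y1 where y1: "y1 \<in> Col c" "\<tau> y1 = H c" by auto
        \<comment> \<open>In the kernel relation for \<open>p\<close> and \<open>H c\<close> only
          the letter \<open>y1\<close> contributes, and its term is \<open>f \<tau>\<close>. In an
          earlier column the label \<open>H c\<close> would occur twice; in column \<open>c\<close>
          the label \<open>p\<close> does not occur; and for a later column the exchange leaves
          column \<open>c\<close> without its bottom label, the case already settled.\<close>
        let ?U = "\<tau>(y1 := p)"
        have "(\<Sum>y | y \<in> X \<and> ?U y = p. f (?U(y := H c))) = 0"
          using 3 H_anti[of 1 c] cq by (intro kernel) auto
        moreover have "f (?U(y := H c)) = 0" if "y \<in> X" "?U y = p" "y \<noteq> y1" for y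
        proof -
          have ty: "\<tau> y = p" using that by simp
          have yx: "y \<noteq> x0" using ty sb 3 by (auto simp: shifted_below_def)
          note b = cell_bounds[OF that(1) yx]
          consider "cl y < c" | "cl y = c" | "c < cl y" by linarith
          then show ?thesis
          proof cases
            case 1
            have "H (c - 1) \<le> H (cl y)" using 1 by (intro H_anti) auto
            then have "H c < H (cl y)" using v by (simp add: v_def)
            moreover from this obtain z where z: "z \<in> Col (cl y)" "rw z = H c" "z \<noteq> x0"
              using cell_ex[OF b(1) Hc] by (metis less_imp_le)
            ultimately have "\<tau> z = H c" using sb 1 b by (auto simp: shifted_below_def shift_def Col_def)
            moreover have "z \<noteq> y1" using z y1 1 by (auto simp: Col_def)
            moreover have "z \<noteq> y" using ty calculation 3 by auto
            ultimately show ?thesis using z that by (intro f_repeat[of y z]) (auto simp: Col_def)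
          next
            case 2
            then have "p \<in> \<tau> ` Col c" using that ty by (auto simp: Col_def)
            then show ?thesis using im pv by auto
          next
            case gt: 3
            have e: "?U(y := H c) = \<tau> \<circ> Transposition.transpose y1 y"
              using ty y1 that by (auto simp: fun_eq_iff Transposition.transpose_def)
            have "shifted_below c (?U(y := H c))"
              unfolding e using sb y1 gt that cq by (intro shifted_transpose) (auto simp: Col_def)
            moreover have "(?U(y := H c)) ` Col c = insert v ({1..H c} - {H c})"
            proof -
              have "(?U(y := H c)) ` Col c = insert p (\<tau> ` (Col c - {y1}))"
                using y1 gt by (auto simp: Col_def image_iff)
              also have "\<tau> ` (Col c - {y1}) = \<tau> ` Col c - {H c}"
                using inj y1 by (auto simp: inj_on_def)
              finally show ?thesis using im pv v 3 by auto
            qed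
            ultimately show ?thesis using step by (simp add: v_def)
          qed
        qed
        ultimately have "f (?U(y1 := H c)) = 0"
        proof -
          assume s: "(\<Sum>y | y \<in> X \<and> ?U y = p. f (?U(y := H c))) = 0"
            and o: "\<And>y. y \<in> X \<Longrightarrow> ?U y = p \<Longrightarrow> y \<noteq> y1 \<Longrightarrow> f (?U(y := H c)) = 0"
          have "(\<Sum>y | y \<in> X \<and> ?U y = p. f (?U(y := H c))) = (\<Sum>y\<in>{y1}. f (?U(y := H c)))"
            using fin y1 o by (intro sum.mono_neutral_right) (auto simp: Col_def)
          then show ?thesis using s by simp
        qed
        moreover have "?U(y1 := H c) = \<tau>" using y1 by (auto simp: fun_eq_iff)
        ultimately show False using nz by simp
      qed
    qed
    \<comment> \<open>If the surplus label sits in a later column, a Garnir relation brings it into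
      column \<open>c\<close>.\<close>
    have "v \<in># add_mset 1 (ms c \<tau>)" using Suc.prems(3) by (simp add: shifted_below_def v_def)
    then obtain y where y: "y \<in> X" "c \<le> cl y" "\<tau> y = v" using v Hc by (auto simp: in_ms)
    show ?thesis
    proof (cases "cl y = c")
      case True
      then show ?thesis using key[OF Suc.prems(3), of y] y by (simp add: Col_def)
    next
      case False
      then have "f \<tau> = (\<Sum>z\<in>Col c. f (\<tau> \<circ> Transposition.transpose y z))"
        using y cq by (intro garnir) auto
      also have "\<dots> = 0"
      proof (rule sum.neutral, rule ballI)
        fix z assume z: "z \<in> Col c"
        show "f (\<tau> \<circ> Transposition.transpose y z) = 0"
          using z y Suc.prems(3) cq
          by (intro key[of _ z] shifted_transpose) (auto simp: Col_def)
      qed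
      finally show ?thesis .
    qed
  qed
qed

text \<open>The label of \<open>x0\<close> decides. If it is \<open>H 0\<close>, the other letters
  carry standard labels; if it is 1, the shifting process applies; and the kernel relation with
  \<open>i = 1\<close> reduces every other label to the case 1.\<close>

theorem f_zero:
  assumes ev: "\<And>c. 1 \<le> c \<Longrightarrow> c \<le> q \<Longrightarrow> H c < H (c - 1) \<Longrightarrow> f (chain 1 c) = 0"
    and ev0: "f rw = 0"
  shows "f \<tau> = 0"
proof -
  have all: "ms 0 \<tau> = add_mset (\<tau> x0) (ms 1 \<tau>)" for \<tau>
  proof -
    have "Col 0 = {x0}" using cl_eq_0 x0 by (auto simp: Col_def)
    then show ?thesis using ms_Suc[of 0 \<tau>] by simp
  qed
  have cont: "add_mset (\<tau> x0) (ms 1 \<tau>) = add_mset (H 0) (ms 1 rw)" "\<tau> y = 0 \<longleftrightarrow> y \<notin> X" "\<tau> x0 \<le> H 0" if nz: "f \<tau> \<noteq> 0" for \<tau> y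
  proof -
    from content[OF nz] obtain s where s: "s permutes X" "\<tau> = rw \<circ> s" by blast
    have "image_mset \<tau> (mset_set X) = image_mset rw (mset_set X)"
      using s by (simp add: image_mset_mset_set permutes_inj_on permutes_image flip: multiset.map_comp)
    then have "ms 0 \<tau> = ms 0 rw" by (simp add: ms_def)
    then show "add_mset (\<tau> x0) (ms 1 \<tau>) = add_mset (H 0) (ms 1 rw)" by (simp add: all rw_x0)
    have "rw z = 0 \<longleftrightarrow> z \<notin> X" for z
      using cell_bounds(2)[of z] rw_x0 rw_out[of z] H_0 by (cases "z = x0") (auto simp: x0)
    then show "\<tau> y = 0 \<longleftrightarrow> y \<notin> X" using s by (simp add: permutes_in_image)
    have "rw z \<le> H 0" for z
      using cell_bounds(3)[of z] rw_x0 rw_out[of z] H_anti[of 0 "cl z"] by (cases "z \<in> X \<and> z \<noteq> x0") auto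
    then show "\<tau> x0 \<le> H 0" using s by simp
  qed
  have last: "f \<tau> = 0" if "\<tau> x0 = H 0" for \<tau>
  proof (rule ccontr)
    assume nz: "f \<tau> \<noteq> 0"
    have e: "(\<lambda>y. if y \<in> X \<and> 1 \<le> cl y then rw y else \<tau> y) = rw"
    proof
      fix y show "(if y \<in> X \<and> 1 \<le> cl y then rw y else \<tau> y) = rw y"
        using cont(2)[OF nz, of y] rw_out[of y] cl_eq_0[of y] rw_x0 that by (auto simp: Suc_le_eq)
    qed
    have "ms 1 \<tau> = ms 1 rw" using cont(1)[OF nz] that by simp
    then have "f \<tau> = 0" by (rule f_standard_rest[OF order_refl]) (simp only: e ev0)
    then show False using nz by simp
  qed
  have first: "f \<tau> = 0" if "\<tau> x0 = 1" "H 1 \<noteq> 0" for \<tau>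
  proof (rule ccontr)
    assume nz: "f \<tau> \<noteq> 0"
    have "shifted_below 1 \<tau>"
      using cont[OF nz] that by (auto simp: shifted_below_def)
    moreover have "1 \<le> q" using that(2) H_zero[of 1] by auto
    ultimately have "f \<tau> = 0" by (intro f_shifted_zero[of 1 \<tau>] ev) auto
    then show False using nz by simp
  qed
  show ?thesis
  proof (rule ccontr)
    assume nz: "f \<tau> \<noteq> 0"
    have "\<tau> x0 \<noteq> H 0" using last nz by blast
    moreover have "\<tau> x0 \<noteq> 0" using cont(2)[OF nz, of x0] x0 by simp
    ultimately have a: "1 \<le> \<tau> x0" "\<tau> x0 \<le> H 1" using cont(3)[OF nz] H_0 by auto
    then have "1 < \<tau> x0" using first[of \<tau>] nz by (cases "\<tau> x0 = 1") auto
    let ?U = "\<tau>(x0 := 1)"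
    have "(\<Sum>y | y \<in> X \<and> ?U y = 1. f (?U(y := \<tau> x0))) = 0"
      using a \<open>1 < \<tau> x0\<close> by (intro kernel) auto
    also have "(\<Sum>y | y \<in> X \<and> ?U y = 1. f (?U(y := \<tau> x0))) = (\<Sum>y\<in>{x0}. f (?U(y := \<tau> x0)))"
      using fin x0 a by (intro sum.mono_neutral_right) (auto intro!: first)
    finally have "f (?U(x0 := \<tau> x0)) = 0" by simp
    then show False using nz by simp
  qed
qed

end

section \<open>The Jucys--Murphy operator on the induced module\<close>

context labelled_diagram
begin

abbreviation e :: "('l \<Rightarrow> nat) \<Rightarrow> 'a :: comm_ring_1" where "e \<equiv> polytab X cl rw"

text \<open>The action of the Jucys--Murphy element, the sum of the transpositions moving \<open>x0\<close>, from the right: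
  in an assignment \<open>\<tau>\<close> the place of \<open>x0\<close> is taken by the letter with label \<open>H 0\<close>.\<close>

definition jm :: "(('l \<Rightarrow> nat) \<Rightarrow> 'a :: comm_ring_1) \<Rightarrow> ('l \<Rightarrow> nat) \<Rightarrow> 'a" where
  "jm F \<tau> = (\<Sum>x | x \<in> X \<and> \<tau> x = H 0. \<Sum>y\<in>X - {x}. F (\<tau> \<circ> Transposition.transpose x y))"

lemma rw_eq_H0: "y \<in> X \<Longrightarrow> rw y = H 0 \<longleftrightarrow> y = x0"
  using cell_bounds(3)[of y] cell_bounds(1)[of y] rw_x0 H_0 H_anti[of 1 "cl y"] by (cases "y = x0") auto

lemma transpose_comp_permutes:
  assumes "g permutes S"
  shows "Transposition.transpose (g x) (g y) \<circ> g = g \<circ> Transposition.transpose x y"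
  using permutes_inj[OF assms] by (auto simp: fun_eq_iff Transposition.transpose_def dest: injD)

text \<open>The operator selects letters by their labels only, so composing with \<open>g\<close>
  merely renames the letters that are summed over and conjugates the transpositions.\<close>

lemma jm_act:
  assumes g: "g permutes X"
  shows "jm (\<lambda>\<tau>. F (\<tau> \<circ> g)) \<tau> = jm F (\<tau> \<circ> g)"
proof -
  have "jm F (\<tau> \<circ> g) = (\<Sum>x | x \<in> X \<and> \<tau> (g x) = H 0. \<Sum>y\<in>X - {x}. F (\<tau> \<circ> Transposition.transpose (g x) (g y) \<circ> g))"
    unfolding jm_def by (simp add: comp_assoc transpose_comp_permutes[OF g])
  also have "\<dots> = (\<Sum>x | x \<in> X \<and> \<tau> (g x) = H 0. \<Sum>y\<in>X - {g x}. F (\<tau> \<circ> Transposition.transpose (g x) y \<circ> g))"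
  proof (rule sum.cong[OF refl])
    fix x
    have "bij_betw g (X - {x}) (X - {g x})"
      using permutes_imp_bij[OF g] permutes_inj[OF g] by (auto simp: bij_betw_def inj_on_def inj_def)
    then show "(\<Sum>y\<in>X - {x}. F (\<tau> \<circ> Transposition.transpose (g x) (g y) \<circ> g)) =
        (\<Sum>y\<in>X - {g x}. F (\<tau> \<circ> Transposition.transpose (g x) y \<circ> g))"
      by (rule sum.reindex_bij_betw)
  qed
  also have "\<dots> = (\<Sum>x | x \<in> X \<and> \<tau> x = H 0. \<Sum>y\<in>X - {x}. F (\<tau> \<circ> Transposition.transpose x y \<circ> g))"
  proof (rule sum.reindex_bij_betw)
    show "bij_betw g {x \<in> X. \<tau> (g x) = H 0} {x \<in> X. \<tau> x = H 0}"
      using permutes_image[OF g] permutes_inj[OF g] by (auto simp: bij_betw_def inj_on_def inj_def)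
  qed
  finally show ?thesis by (simp add: jm_def)
qed

lemma jm_linear: "jm (\<lambda>\<tau>. a * F \<tau> + b * G \<tau>) \<tau> = a * jm F \<tau> + b * jm G \<tau>"
  by (simp add: jm_def sum.distrib sum_distrib_left)

lemma jm_zero: "jm (\<lambda>\<tau>. 0) \<tau> = 0"
  by (simp add: jm_def)

lemma e_support_x0: "e \<tau> \<noteq> (0 :: 'a :: comm_ring_1) \<Longrightarrow> y \<in> X \<Longrightarrow> \<tau> y = H 0 \<longleftrightarrow> y = x0"
proof -
  assume "e \<tau> \<noteq> (0 :: 'a)" and y: "y \<in> X"
  from polytab_support[OF this(1)] obtain s where s: "s \<in> col_group X cl" "\<tau> = rw \<circ> s" by blast
  have sp: "s permutes X" "cl (s y) = cl y" using s by (auto simp: col_group_def)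
  have "\<tau> y = H 0 \<longleftrightarrow> s y = x0" using s(2) y sp by (simp add: rw_eq_H0 permutes_in_image)
  also have "\<dots> \<longleftrightarrow> cl (s y) = 0" using cl_eq_0[of "s y"] sp(1) y by (simp only: permutes_in_image)
  also have "\<dots> \<longleftrightarrow> y = x0" using sp(2) cl_eq_0[OF y] by simp
  finally show ?thesis .
qed

text \<open>In the term for \<open>x\<close> and \<open>y\<close> the letter \<open>y\<close>
  receives the label \<open>H 0\<close>, so only \<open>y = x0\<close> can survive, and for
  \<open>x = x0\<close> nothing does. On the generator the operator thus agrees with the
  Jucys--Murphy element of the letter \<open>x0\<close>.\<close>

lemma jm_e: "jm e \<tau> = (\<Sum>y\<in>X - {x0}. e (\<tau> \<circ> Transposition.transpose x0 y) :: 'a :: comm_ring_1)"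
proof -
  have "(\<Sum>y\<in>X - {x}. e (\<tau> \<circ> Transposition.transpose x y)) =
      (if x = x0 then 0 else e (\<tau> \<circ> Transposition.transpose x0 x) :: 'a)" if x: "x \<in> X" "\<tau> x = H 0" for x
  proof -
    have nz: "y = x0" if "y \<in> X" "e (\<tau> \<circ> Transposition.transpose x y) \<noteq> (0 :: 'a)" for y
      using e_support_x0[OF that(2), of y] that(1) x by simp
    show ?thesis
    proof (cases "x = x0")
      case True
      then have "e (\<tau> \<circ> Transposition.transpose x y) = (0 :: 'a)" if "y \<in> X - {x}" for y using nz[of y] that by auto
      then show ?thesis using True by simp
    next
      case False
      have "(\<Sum>y\<in>X - {x}. e (\<tau> \<circ> Transposition.transpose x y)) = (\<Sum>y\<in>{x0}. e (\<tau> \<circ> Transposition.transpose x y) :: 'a)"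
        using fin x0 False nz by (intro sum.mono_neutral_right) auto
      then show ?thesis using False by (simp add: transpose_commute)
    qed
  qed
  then have "jm e \<tau> = (\<Sum>x | x \<in> X \<and> \<tau> x = H 0. if x = x0 then 0 else e (\<tau> \<circ> Transposition.transpose x0 x) :: 'a)"
    unfolding jm_def by (intro sum.cong) auto
  also have "\<dots> = (\<Sum>x\<in>X. if x = x0 then 0 else e (\<tau> \<circ> Transposition.transpose x0 x))"
  proof (rule sum.mono_neutral_left)
    show "\<forall>x\<in>X - {x \<in> X. \<tau> x = H 0}. (if x = x0 then 0 else e (\<tau> \<circ> Transposition.transpose x0 x)) = (0 :: 'a)"
    proof
      fix x assume x: "x \<in> X - {x \<in> X. \<tau> x = H 0}"
      have "(\<tau> \<circ> Transposition.transpose x0 x) x0 \<noteq> H 0" using x by auto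
      then have "e (\<tau> \<circ> Transposition.transpose x0 x) = (0 :: 'a)" using e_support_x0 x0 by blast
      then show "(if x = x0 then 0 else e (\<tau> \<circ> Transposition.transpose x0 x)) = (0 :: 'a)" by simp
    qed
  qed (use fin in auto)
  also have "\<dots> = (\<Sum>y\<in>X - {x0}. e (\<tau> \<circ> Transposition.transpose x0 y))"
    using fin x0 by (simp add: sum.remove[of X x0])
  finally show ?thesis .
qed

section \<open>The space spanned by the translates of the generator\<close>

inductive_set ind_space :: "(('l \<Rightarrow> nat) \<Rightarrow> 'a :: comm_ring_1) set" where
  zero: "(\<lambda>\<tau>. 0) \<in> ind_space"
| step: "F \<in> ind_space \<Longrightarrow> g permutes X \<Longrightarrow> (\<lambda>\<tau>. F \<tau> + c * e (\<tau> \<circ> g)) \<in> ind_space"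

lemma ind_space_add:
  assumes F: "F \<in> ind_space" and G: "G \<in> ind_space"
  shows "(\<lambda>\<tau>. F \<tau> + G \<tau>) \<in> ind_space"
  using G
proof induction
  case zero
  then show ?case using F by simp
next
  case (step G g c)
  from ind_space.step[OF step.IH step.hyps(2), of c] show ?case by (simp add: add.assoc)
qed

lemma ind_space_scale:
  assumes "F \<in> ind_space" shows "(\<lambda>\<tau>. a * F \<tau>) \<in> ind_space"
  using assms
proof induction
  case zero
  then show ?case using ind_space.zero by simp
next
  case (step F g c)
  from ind_space.step[OF step.IH step.hyps(2), of "a * c"] show ?case by (simp add: algebra_simps)
qed

lemma ind_space_act:
  assumes "F \<in> ind_space" "h permutes X" shows "(\<lambda>\<tau>. F (\<tau> \<circ> h)) \<in> ind_space"
  using assms(1)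
proof induction
  case zero
  then show ?case using ind_space.zero by simp
next
  case (step F g c)
  from ind_space.step[OF step.IH permutes_compose[OF step.hyps(2) assms(2)], of c] show ?case
    by (simp only: comp_assoc)
qed

lemma e_in_ind_space: "e \<in> ind_space"
  using ind_space.step[OF ind_space.zero permutes_id, of 1] by simp

lemma ind_space_sum: "(\<And>y. y \<in> Y \<Longrightarrow> F y \<in> ind_space) \<Longrightarrow> (\<lambda>\<tau>. \<Sum>y\<in>Y. F y \<tau>) \<in> ind_space"
proof (induction Y rule: infinite_finite_induct)
  case (insert y Y)
  then show ?case using ind_space_add[of "F y" "\<lambda>\<tau>. \<Sum>y\<in>Y. F y \<tau>"] by simp
qed (auto simp: ind_space.zero)

lemma jm_e_in_ind_space: "jm e \<in> ind_space"
proof -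
  have "jm e = (\<lambda>\<tau>. \<Sum>y\<in>X - {x0}. e (\<tau> \<circ> Transposition.transpose x0 y))" by (rule ext) (rule jm_e)
  also have "\<dots> \<in> ind_space"
    using x0 by (intro ind_space_sum ind_space_act e_in_ind_space permutes_swap_id) auto
  finally show ?thesis .
qed

lemma jm_ind_space:
  fixes F :: "('l \<Rightarrow> nat) \<Rightarrow> 'a :: comm_ring_1"
  shows "F \<in> ind_space \<Longrightarrow> jm F \<in> ind_space"
proof (induction rule: ind_space.induct)
  case zero
  have "jm (\<lambda>\<tau>. 0) = (\<lambda>\<tau>. 0 :: 'a)" by (rule ext) (rule jm_zero)
  then show ?case by (simp only: ind_space.zero)
next
  case (step F g c)
  have "jm (\<lambda>\<tau>. F \<tau> + c * e (\<tau> \<circ> g)) = (\<lambda>\<tau>. jm F \<tau> + c * jm e (\<tau> \<circ> g))"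
    using jm_linear[of 1 F c "\<lambda>\<tau>. e (\<tau> \<circ> g)"] jm_act[OF step.hyps(2), of "e :: _ \<Rightarrow> 'a"] by (intro ext) simp
  also have "\<dots> \<in> ind_space"
    by (intro ind_space_add step.IH ind_space_scale ind_space_act jm_e_in_ind_space step.hyps)
  finally show ?case .
qed

lemma ind_space_content:
  assumes "F \<in> ind_space" "F \<tau> \<noteq> 0"
  shows "\<exists>s. s permutes X \<and> \<tau> = rw \<circ> s"
  using assms
proof induction
  case (step F g c)
  show ?case
  proof (cases "F \<tau> = 0")
    case True
    then have "e (\<tau> \<circ> g) \<noteq> (0 :: 'a)" using step.prems by auto
    from polytab_support[OF this] obtain s where s: "s permutes X" "\<tau> \<circ> g = rw \<circ> s" by (auto simp: col_group_def)
    have "\<tau> = (\<tau> \<circ> g) \<circ> Hilbert_Choice.inv g" using step.hyps by (simp add: comp_assoc permutes_inv_o)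
    also have "\<dots> = rw \<circ> (s \<circ> Hilbert_Choice.inv g)" by (simp add: s comp_assoc)
    finally show ?thesis using s step.hyps permutes_compose permutes_inv by blast
  qed (use step in auto)
qed simp

text \<open>Renaming letters only permutes the terms of the relation, so it passes from
  \<open>e\<close> to its translates. The bound \<open>j \<le> H 1\<close> excludes the label of
  \<open>x0\<close>, so a letter in row \<open>j\<close> has one in row \<open>i\<close> above it in
  the same column.\<close>

lemma ind_space_kernel:
  fixes F :: "('l \<Rightarrow> nat) \<Rightarrow> 'a :: comm_ring_1"
  assumes "F \<in> ind_space" and ij: "1 \<le> i" "i < j" "j \<le> H 1"
  shows "(\<Sum>y | y \<in> X \<and> \<tau> y = i. F (\<tau>(y := j))) = 0"
  using assms(1)
proof (induction arbitrary: \<tau>)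
  case (step F g c)
  have "(\<Sum>y | y \<in> X \<and> \<tau> y = i. e (\<tau>(y := j) \<circ> g)) = (\<Sum>y | y \<in> X \<and> (\<tau> \<circ> g) y = i. e ((\<tau> \<circ> g)(y := j)) :: 'a)"
  proof (rule sum.reindex_bij_witness[where i = g and j = "Hilbert_Choice.inv g"])
    note g = step.hyps(2)
    fix y
    show "g (Hilbert_Choice.inv g y) = y" "Hilbert_Choice.inv g (g y) = y"
      using g by (simp_all add: permutes_inverses)
    assume y: "y \<in> {y \<in> X. \<tau> y = i}"
    show "Hilbert_Choice.inv g y \<in> {y \<in> X. (\<tau> \<circ> g) y = i}"
      using y g by (simp add: permutes_inverses permutes_in_image[OF permutes_inv])
    have "\<tau>(y := j) \<circ> g = (\<tau> \<circ> g)(Hilbert_Choice.inv g y := j)"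
      using g by (auto simp: fun_eq_iff permutes_inverses)
    then show "e ((\<tau> \<circ> g)(Hilbert_Choice.inv g y := j)) = e (\<tau>(y := j) \<circ> g)" by simp
  next
    fix y assume "y \<in> {y \<in> X. (\<tau> \<circ> g) y = i}"
    then show "g y \<in> {y \<in> X. \<tau> y = i}" using step.hyps by (simp add: permutes_in_image)
  qed
  also have "\<dots> = 0"
  proof (rule polytab_kernel[OF fin])
    show "y = z" if "y \<in> X" "z \<in> X" "cl y = cl z" "rw y = rw z" for y z using cell_inj that by blast
    show "\<exists>z\<in>X. cl z = cl y \<and> rw z = i" if y: "y \<in> X" "rw y = j" for y
    proof -
      have "y \<noteq> x0" using y ij rw_x0 H_0 by auto
      then have "1 \<le> cl y" "i \<le> H (cl y)" using cell_bounds[OF y(1)] y ij by auto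
      from cell_ex[OF this(1) ij(1) this(2)] show ?thesis by (auto simp: Col_def)
    qed
    show "i \<noteq> j" using ij by simp
  qed
  finally have "(\<Sum>y | y \<in> X \<and> \<tau> y = i. e (\<tau>(y := j) \<circ> g)) = (0 :: 'a)" .
  then show ?case
    by (simp only: sum.distrib sum_distrib_left[symmetric] step.IH mult_zero_right add_0)
qed simp

text \<open>Linearity and equivariance are required on \<open>ind_space\<close> only, because
  operators are total functions whose values elsewhere are not determined by an
  endomorphism.\<close>

definition equivariant :: "((('l \<Rightarrow> nat) \<Rightarrow> 'a :: comm_ring_1) \<Rightarrow> ('l \<Rightarrow> nat) \<Rightarrow> 'a) \<Rightarrow> bool" where
  "equivariant \<Phi> \<longleftrightarrow> (\<forall>F\<in>ind_space. \<Phi> F \<in> ind_space)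
    \<and> (\<forall>F\<in>ind_space. \<forall>G\<in>ind_space. \<forall>\<tau>. \<Phi> (\<lambda>\<tau>. F \<tau> + G \<tau>) \<tau> = \<Phi> F \<tau> + \<Phi> G \<tau>)
    \<and> (\<forall>F\<in>ind_space. \<forall>c \<tau>. \<Phi> (\<lambda>\<tau>. c * F \<tau>) \<tau> = c * \<Phi> F \<tau>)
    \<and> (\<forall>F\<in>ind_space. \<forall>g \<tau>. g permutes X \<longrightarrow> \<Phi> (\<lambda>\<tau>. F (\<tau> \<circ> g)) \<tau> = \<Phi> F (\<tau> \<circ> g))"

lemma equivariantD:
  assumes "equivariant \<Phi>" "F \<in> ind_space"
  shows "\<Phi> F \<in> ind_space"
    and "G \<in> ind_space \<Longrightarrow> \<Phi> (\<lambda>\<tau>. F \<tau> + G \<tau>) \<tau> = \<Phi> F \<tau> + \<Phi> G \<tau>"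
    and "\<Phi> (\<lambda>\<tau>. c * F \<tau>) \<tau> = c * \<Phi> F \<tau>"
    and "g permutes X \<Longrightarrow> \<Phi> (\<lambda>\<tau>. F (\<tau> \<circ> g)) \<tau> = \<Phi> F (\<tau> \<circ> g)"
  using assms unfolding equivariant_def by blast+

lemma equivariant_zero: "equivariant \<Phi> \<Longrightarrow> \<Phi> (\<lambda>\<tau>. 0) \<tau> = 0"
  using equivariantD(3)[OF _ ind_space.zero, of \<Phi> 0] by simp

lemma equivariant_sum:
  assumes \<Phi>: "equivariant \<Phi>" and F: "\<And>y. y \<in> Y \<Longrightarrow> F y \<in> ind_space"
  shows "\<Phi> (\<lambda>\<tau>. \<Sum>y\<in>Y. F y \<tau>) \<tau> = (\<Sum>y\<in>Y. \<Phi> (F y) \<tau>)"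
  using F
proof (induction Y rule: infinite_finite_induct)
  case (insert y Y)
  then have "F y \<in> ind_space" "(\<lambda>\<tau>. \<Sum>y\<in>Y. F y \<tau>) \<in> ind_space" by (auto intro: ind_space_sum)
  then have "\<Phi> (\<lambda>\<tau>. F y \<tau> + (\<Sum>y\<in>Y. F y \<tau>)) \<tau> = \<Phi> (F y) \<tau> + \<Phi> (\<lambda>\<tau>. \<Sum>y\<in>Y. F y \<tau>) \<tau>"
    using \<Phi> by (simp add: equivariant_def)
  then show ?case using insert by simp
qed (simp_all add: equivariant_zero[OF \<Phi>])

text \<open>The translates of \<open>e\<close> span the space, so \<open>e\<close> generates it as a
  module over the group algebra.\<close>

lemma equivariant_eqI:
  assumes \<Phi>: "equivariant \<Phi>" and \<Psi>: "equivariant \<Psi>" and eq: "\<Phi> e = \<Psi> e" and F: "F \<in> ind_space"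
  shows "\<Phi> F = \<Psi> F"
  using F
proof induction
  case zero
  then show ?case by (intro ext) (simp add: equivariant_zero \<Phi> \<Psi>)
next
  case (step F g c)
  note mem = ind_space_act[OF e_in_ind_space step.hyps(2)]
  have dist: "\<Theta> (\<lambda>\<tau>. F \<tau> + c * e (\<tau> \<circ> g)) \<tau> = \<Theta> F \<tau> + c * \<Theta> e (\<tau> \<circ> g)" if "equivariant \<Theta>" for \<Theta> \<tau>
    by (simp only: equivariantD(2)[OF that step.hyps(1) ind_space_scale[OF mem]]
      equivariantD(3)[OF that mem] equivariantD(4)[OF that e_in_ind_space step.hyps(2)])
  then show ?case by (intro ext) (simp only: dist[OF \<Phi>] dist[OF \<Psi>] eq step.IH)
qed

text \<open>Identities between translates of \<open>e\<close> are carried over by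
  \<open>\<Phi>\<close>; the kernel and content properties hold because \<open>\<Phi> e\<close> is
  again an element of the module.\<close>

lemma garnir_function_equivariant:
  fixes \<Phi> :: "(('l \<Rightarrow> nat) \<Rightarrow> 'a :: idom) \<Rightarrow> ('l \<Rightarrow> nat) \<Rightarrow> 'a"
  assumes \<Phi>: "equivariant \<Phi>" and two: "(2 :: 'a) \<noteq> 0"
  shows "garnir_function H q X x0 rw cl (\<Phi> e)"
proof unfold_locales
  show "(2 :: 'a) \<noteq> 0" by fact
  have mem: "\<Phi> e \<in> ind_space" using \<Phi> e_in_ind_space by (auto simp: equivariant_def)
  note act = equivariantD(4)[OF \<Phi> e_in_ind_space]
  show "\<Phi> e (\<tau> \<circ> s) = of_int (sign s) * \<Phi> e \<tau>" if s: "s \<in> col_group X cl" for s \<tau>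
  proof -
    have "\<Phi> e (\<tau> \<circ> s) = \<Phi> (\<lambda>\<tau>. e (\<tau> \<circ> s)) \<tau>" using s by (simp add: act col_group_def)
    also have "\<dots> = \<Phi> (\<lambda>\<tau>. of_int (sign s) * e \<tau>) \<tau>" by (simp add: polytab_sign[OF fin s])
    also have "\<dots> = of_int (sign s) * \<Phi> e \<tau>" by (rule equivariantD(3)[OF \<Phi> e_in_ind_space])
    finally show ?thesis .
  qed
  show "\<Phi> e \<tau> = (\<Sum>z\<in>Col c. \<Phi> e (\<tau> \<circ> Transposition.transpose y z))"
    if y: "y \<in> X" "1 \<le> c" "c < cl y" for y c \<tau>
  proof -
    have p: "Transposition.transpose y z permutes X" if "z \<in> Col c" for z
      using that y by (auto simp: Col_def permutes_swap_id)
    have "e = (\<lambda>\<tau>. \<Sum>z\<in>Col c. e (\<tau> \<circ> Transposition.transpose y z) :: 'a)"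
    proof (rule ext, unfold Col_def, rule polytab_garnir[OF two fin])
      show "y = z" if "y \<in> X" "z \<in> X" "cl y = cl z" "rw y = rw z" for y z using cell_inj that by blast
      have "rw ` {z \<in> X. cl z = d} = {1..H d}" if "1 \<le> d" for d
        using Col_rw[OF that] by (simp add: bij_betw_def Col_def)
      then show "rw ` {z \<in> X. cl z = cl y} \<subseteq> rw ` {z \<in> X. cl z = c}"
        using y H_anti[of c "cl y"] by simp
    qed (use y in auto)
    then have "\<Phi> e \<tau> = \<Phi> (\<lambda>\<tau>. \<Sum>z\<in>Col c. e (\<tau> \<circ> Transposition.transpose y z)) \<tau>" by simp
    also have "\<dots> = (\<Sum>z\<in>Col c. \<Phi> (\<lambda>\<tau>. e (\<tau> \<circ> Transposition.transpose y z)) \<tau>)"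
      using p by (intro equivariant_sum[OF \<Phi>] ind_space_act e_in_ind_space) auto
    also have "\<dots> = (\<Sum>z\<in>Col c. \<Phi> e (\<tau> \<circ> Transposition.transpose y z))"
      using p by (intro sum.cong refl act)
    finally show ?thesis .
  qed
  show "(\<Sum>y | y \<in> X \<and> \<tau> y = i. \<Phi> e (\<tau>(y := j))) = 0" if "1 \<le> i" "i < j" "j \<le> H 1" for i j \<tau>
    using ind_space_kernel[OF mem that] .
  show "\<exists>s. s permutes X \<and> \<tau> = rw \<circ> s" if "\<Phi> e \<tau> \<noteq> 0" for \<tau>
    using ind_space_content[OF mem that] .
qed

section \<open>Polynomials in the Jucys--Murphy operator\<close>

definition jm_poly :: "'a poly \<Rightarrow> (('l \<Rightarrow> nat) \<Rightarrow> 'a :: comm_ring_1) \<Rightarrow> ('l \<Rightarrow> nat) \<Rightarrow> 'a" where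
  "jm_poly p F \<tau> = (\<Sum>i\<le>degree p. coeff p i * (jm ^^ i) F \<tau>)"

lemma jm_poly_bound: "degree p \<le> n \<Longrightarrow> jm_poly p F \<tau> = (\<Sum>i\<le>n. coeff p i * (jm ^^ i) F \<tau>)"
  unfolding jm_poly_def by (intro sum.mono_neutral_left) (auto simp: coeff_eq_0)

lemma jm_poly_add: "jm_poly (p + p') F \<tau> = jm_poly p F \<tau> + jm_poly p' F \<tau>"
proof -
  let ?n = "max (degree p) (degree p')"
  have "degree (p + p') \<le> ?n" by (rule degree_add_le_max)
  then show ?thesis
    by (simp add: jm_poly_bound[of _ ?n] sum.distrib algebra_simps)
qed

lemma jm_poly_smult: "jm_poly (Polynomial.smult a p) F \<tau> = a * jm_poly p F \<tau>"
proof -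
  have "jm_poly (Polynomial.smult a p) F \<tau> = (\<Sum>i\<le>degree p. coeff (Polynomial.smult a p) i * (jm ^^ i) F \<tau>)"
    by (rule jm_poly_bound) (rule degree_smult_le)
  then show ?thesis by (simp add: jm_poly_def sum_distrib_left mult.assoc)
qed

lemma jm_poly_0: "jm_poly 0 F \<tau> = 0"
  by (simp add: jm_poly_def)

lemma jm_poly_monom: "jm_poly (monom a n) F \<tau> = a * (jm ^^ n) F \<tau>"
proof -
  have "jm_poly (monom a n) F \<tau> = (\<Sum>i\<le>n. if i = n then a * (jm ^^ i) F \<tau> else 0)"
    unfolding jm_poly_bound[OF degree_monom_le] by (intro sum.cong) auto
  then show ?thesis by simp
qed

lemma jm_sum: "jm (\<lambda>\<tau>. \<Sum>i\<in>I. c i * F i \<tau>) \<tau> = (\<Sum>i\<in>I. c i * jm (F i) \<tau>)"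
proof (induction I rule: infinite_finite_induct)
  case (insert i I)
  then show ?case using jm_linear[of "c i" "F i" 1 "\<lambda>\<tau>. \<Sum>i\<in>I. c i * F i \<tau>" \<tau>] by simp
qed (simp_all add: jm_zero)

text \<open>Horner's rule, the form in which multiplicativity and equivariance follow by induction
  on the polynomial.\<close>

lemma jm_poly_pCons: "jm_poly (pCons a p) F \<tau> = a * F \<tau> + jm (jm_poly p F) \<tau>"
proof -
  have "jm_poly (pCons a p) F \<tau> = (\<Sum>i\<le>Suc (degree p). coeff (pCons a p) i * (jm ^^ i) F \<tau>)"
    by (rule jm_poly_bound) (rule degree_pCons_le)
  also have "\<dots> = a * F \<tau> + (\<Sum>i\<le>degree p. coeff p i * jm ((jm ^^ i) F) \<tau>)"
    by (simp add: sum.atMost_Suc_shift del: sum.atMost_Suc)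
  also have "(\<Sum>i\<le>degree p. coeff p i * jm ((jm ^^ i) F) \<tau>) = jm (jm_poly p F) \<tau>"
    by (simp add: jm_sum[symmetric] jm_poly_def[abs_def])
  finally show ?thesis .
qed

lemma jm_poly_mult: "jm_poly (p * p') F = jm_poly p (jm_poly p' F)"
proof (induction p)
  case 0
  then show ?case by (intro ext) (simp add: jm_poly_0)
next
  case (pCons a p)
  show ?case
  proof
    fix \<tau>
    have "pCons a p * p' = Polynomial.smult a p' + pCons 0 (p * p')" by simp
    then have "jm_poly (pCons a p * p') F \<tau> = a * jm_poly p' F \<tau> + jm (jm_poly (p * p') F) \<tau>"
      by (simp only: jm_poly_add jm_poly_smult jm_poly_pCons mult_zero_left add_0)
    then show "jm_poly (pCons a p * p') F \<tau> = jm_poly (pCons a p) (jm_poly p' F) \<tau>"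
      by (simp add: jm_poly_pCons pCons.IH)
  qed
qed

lemma jm_poly_1: "jm_poly 1 F = F"
  by (rule ext) (simp add: jm_poly_def)

lemma equivariant_jm: "equivariant jm"
  unfolding equivariant_def using jm_linear[of 1 _ 1] jm_linear[of _ _ 0 "\<lambda>_. 0"]
  by (auto simp: jm_ind_space jm_act)

lemma equivariant_lincomb:
  assumes "equivariant \<Phi>" "equivariant \<Psi>"
  shows "equivariant (\<lambda>F \<tau>. a * \<Phi> F \<tau> + b * \<Psi> F \<tau>)"
  using assms unfolding equivariant_def
  by (auto intro!: ind_space_add ind_space_scale simp: algebra_simps)

lemma equivariant_comp:
  assumes "equivariant \<Phi>" "equivariant \<Psi>"
  shows "equivariant (\<lambda>F. \<Phi> (\<Psi> F))"
proof -
  have "\<Psi> (\<lambda>\<tau>. F \<tau> + G \<tau>) = (\<lambda>\<tau>. \<Psi> F \<tau> + \<Psi> G \<tau>)" if "F \<in> ind_space" "G \<in> ind_space" for F G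
    using assms that by (intro ext) (simp add: equivariant_def)
  moreover have "\<Psi> (\<lambda>\<tau>. c * F \<tau>) = (\<lambda>\<tau>. c * \<Psi> F \<tau>)" if "F \<in> ind_space" for F c
    using assms that by (intro ext) (simp add: equivariant_def)
  moreover have "\<Psi> (\<lambda>\<tau>. F (\<tau> \<circ> g)) = (\<lambda>\<tau>. \<Psi> F (\<tau> \<circ> g))" if "F \<in> ind_space" "g permutes X" for F g
    using assms that by (intro ext) (simp add: equivariant_def)
  ultimately show ?thesis using assms unfolding equivariant_def by auto
qed

lemma equivariant_jm_poly: "equivariant (jm_poly p)"
proof (induction p)
  case 0
  then show ?case by (simp add: equivariant_def jm_poly_0 ind_space.zero)
next
  case (pCons a p)
  have "equivariant (\<lambda>F. F)" by (simp add: equivariant_def)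
  from equivariant_lincomb[OF this equivariant_comp[OF equivariant_jm pCons.IH], of a 1]
  show ?case by (simp add: jm_poly_pCons[abs_def])
qed

end

section \<open>Endomorphisms are polynomials in the Jucys--Murphy operator\<close>

context labelled_diagram
begin

text \<open>The addable nodes at the foot of a column of the diagram. The one at the end of the
  first row, in column \<open>q + 1\<close>, is left out; in the count it is matched by the test
  assignment \<open>rw\<close>.\<close>

definition Ad :: "nat set" where "Ad = {c. 1 \<le> c \<and> c \<le> q \<and> H c < H (c - 1)}"

definition bad_cols :: "('l \<Rightarrow> nat) \<Rightarrow> nat set" where
  "bad_cols \<tau> = {c. 1 \<le> c \<and> c \<le> q \<and> \<tau> ` Col c \<noteq> {1..H c}}"

lemma finite_Ad: "finite Ad" and finite_bad_cols: "finite (bad_cols \<tau>)"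
  by (auto simp: Ad_def bad_cols_def)

lemma H_less_H0: "1 \<le> c \<Longrightarrow> H c < H 0"
  using H_0 H_anti[of 1 c] by simp

lemma bad_colsI:
  assumes "1 \<le> c" "c \<le> q" "y \<in> Col c" "H c < \<tau> y"
  shows "c \<in> bad_cols \<tau>"
proof -
  have "\<tau> y \<in> \<tau> ` Col c" using assms(3) by blast
  then have "\<tau> ` Col c \<noteq> {1..H c}" using assms(4) by (metis atLeastAtMost_iff leD)
  then show ?thesis using assms by (simp add: bad_cols_def)
qed

text \<open>If \<open>y\<close> lies in the diagram, its column holds the label \<open>H 0\<close>
  after the exchange, which exceeds every height, and so is bad. Hence at most the column of
  \<open>x\<close> is repaired.\<close>

lemma bad_cols_transpose_subset:
  assumes "x \<in> X" "\<tau> x = H 0" "y \<in> X"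
  shows "bad_cols \<tau> \<subseteq> insert (cl x) (bad_cols (\<tau> \<circ> Transposition.transpose x y))"
proof
  fix c assume c: "c \<in> bad_cols \<tau>"
  then have cq: "1 \<le> c" "c \<le> q" by (auto simp: bad_cols_def)
  let ?\<tau> = "\<tau> \<circ> Transposition.transpose x y"
  consider "c = cl x" | "c \<noteq> cl x" "c \<noteq> cl y" | "c = cl y" by blast
  then show "c \<in> insert (cl x) (bad_cols ?\<tau>)"
  proof cases
    case 2
    then have "Transposition.transpose x y z = z" if "z \<in> Col c" for z
      using that by (auto simp: Transposition.transpose_def Col_def)
    then have "?\<tau> ` Col c = \<tau> ` Col c" by (intro image_cong) auto
    then show ?thesis using c by (simp add: bad_cols_def)
  next
    case 3
    then have "c \<in> bad_cols ?\<tau>"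
      using cq assms H_less_H0[OF cq(1)] by (intro bad_colsI[of c y]) (auto simp: Col_def)
    then show ?thesis by simp
  qed simp
qed

text \<open>\<open>e\<close> vanishes wherever some column is bad, and each application of
  \<open>jm\<close> repairs at most one column.\<close>

lemma card_bad_cols_le:
  "(jm ^^ i) e \<tau> \<noteq> (0 :: 'a :: comm_ring_1) \<Longrightarrow> card (bad_cols \<tau>) \<le> i"
proof (induction i arbitrary: \<tau>)
  case 0
  have "\<tau> ` Col c = {1..H c}" if "1 \<le> c" for c
    using polytab_support_image[of X cl rw \<tau> c] 0 Col_rw[OF that] by (simp add: Col_def bij_betw_def)
  then show ?case by (simp add: bad_cols_def)
next
  case (Suc i)
  have "jm ((jm ^^ i) e) \<tau> \<noteq> (0 :: 'a)" using Suc.prems by simp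
  then have "(\<Sum>x | x \<in> X \<and> \<tau> x = H 0. \<Sum>y\<in>X - {x}. (jm ^^ i) e (\<tau> \<circ> Transposition.transpose x y)) \<noteq> (0 :: 'a)"
    unfolding jm_def[of "(jm ^^ i) e"] .
  from sum.not_neutral_contains_not_neutral[OF this] obtain x where
    x: "x \<in> X" "\<tau> x = H 0" "(\<Sum>y\<in>X - {x}. (jm ^^ i) e (\<tau> \<circ> Transposition.transpose x y)) \<noteq> (0 :: 'a)" by blast
  from sum.not_neutral_contains_not_neutral[OF x(3)] obtain y where
    y: "y \<in> X" "(jm ^^ i) e (\<tau> \<circ> Transposition.transpose x y) \<noteq> (0 :: 'a)" by blast
  have "card (bad_cols \<tau>) \<le> card (insert (cl x) (bad_cols (\<tau> \<circ> Transposition.transpose x y)))"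
    using bad_cols_transpose_subset[of x \<tau> y, OF x(1,2) y(1)] by (intro card_mono) (simp_all add: finite_bad_cols)
  also have "\<dots> \<le> Suc (card (bad_cols (\<tau> \<circ> Transposition.transpose x y)))" by (rule card_insert_le_m1) simp_all
  also have "\<dots> \<le> Suc i" using Suc.IH[OF y(2)] by (simp only: Suc_le_mono)
  finally show ?case .
qed

text \<open>The row of the letter in column \<open>c\<close> that is relabelled by a chain ending in
  column \<open>w\<close>.\<close>

definition turn :: "nat \<Rightarrow> nat \<Rightarrow> nat" where "turn w c = (if c = w then 1 else H c)"

lemma turn_bounds: "c \<in> Ad \<Longrightarrow> 1 \<le> turn w c \<and> turn w c \<le> H c"
  using H_zero[of c] by (auto simp: turn_def Ad_def)

lemma chain_eq:
  assumes "y \<in> X" "y \<noteq> x0"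
  shows "chain u w y = (if u \<le> cl y \<and> cl y \<le> w \<and> rw y = turn w (cl y)
    then (if cl y = u then H 0 else H (cl y - 1)) else rw y)"
  using assms by (simp add: chain_def turn_def)

lemma chain_H0:
  assumes "u \<in> Ad" "w \<in> Ad" "u \<le> w" "y \<in> X" "chain u w y = H 0"
  shows "y \<noteq> x0 \<and> cl y = u \<and> rw y = turn w u"
proof -
  have "H w \<noteq> 0" using H_zero[of w] assms by (auto simp: Ad_def)
  then have H1: "H 1 \<noteq> 0" using H_anti[of 1 w] assms by (auto simp: Ad_def)
  have "y \<noteq> x0" using assms H1 H_0 by (auto simp: chain_def)
  moreover from this have "cl y = u \<and> rw y = turn w u"
  proof (rule_tac ccontr)
    assume y: "y \<noteq> x0" and c: "\<not> (cl y = u \<and> rw y = turn w u)"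
    note b = cell_bounds[OF assms(4) y]
    have "rw y < H 0" using b H_less_H0[of "cl y"] by linarith
    then have "cl y \<noteq> u" "u \<le> cl y" "H (cl y - 1) = H 0"
      using assms(5) c unfolding chain_eq[OF assms(4) y] by (auto split: if_splits)
    moreover from this have "H (cl y - 1) < H 0" using assms(1) by (intro H_less_H0) (auto simp: Ad_def)
    ultimately show False by simp
  qed
  ultimately show ?thesis by simp
qed

lemma chain_bad:
  assumes "u \<in> Ad" "w \<in> Ad" "c \<in> Ad" "u \<le> c" "c \<le> w"
  obtains y where "y \<in> Col c" "y \<noteq> x0" "rw y = turn w c" "H c < chain u w y"
proof -
  have c: "1 \<le> c" "H c < H (c - 1)" using assms by (auto simp: Ad_def)
  from cell_ex[OF c(1)] turn_bounds[OF assms(3), of w] obtain y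
    where y: "y \<in> Col c" "rw y = turn w c" "y \<noteq> x0" by blast
  have "H c < chain u w y"
    using y assms c H_less_H0[OF c(1)] by (subst chain_eq) (auto simp: Col_def)
  then show ?thesis using that y by blast
qed

lemma chain_in_bad_cols:
  "u \<in> Ad \<Longrightarrow> w \<in> Ad \<Longrightarrow> Ad \<inter> {u..w} \<subseteq> bad_cols (chain u w)"
proof
  fix c assume uw: "u \<in> Ad" "w \<in> Ad" and c: "c \<in> Ad \<inter> {u..w}"
  then obtain y where "y \<in> Col c" "H c < chain u w y" using chain_bad[of u w c] by auto
  then show "c \<in> bad_cols (chain u w)" using c by (intro bad_colsI) (auto simp: Ad_def)
qed

text \<open>The exponent equals the number of addable columns that the chain passes, all of which
  are bad, so every step has to repair one of them. The letter labelled \<open>H 0\<close> sits in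
  column \<open>u\<close>, and a single exchange repairs this column without spoiling another: it
  yields the chain from the next addable column on, or \<open>rw\<close> when
  \<open>u = w\<close>.\<close>

lemma jm_pow_chain:
  assumes "u \<in> Ad" "w \<in> Ad" "u \<le> w"
  shows "(jm ^^ card (Ad \<inter> {u..w})) e (chain u w) = (1 :: 'a :: comm_ring_1)"
  using assms
proof (induction "w - u" arbitrary: u rule: less_induct)
  case less
  note uw = less.prems
  have u1: "1 \<le> u" "u \<le> q" "H u < H (u - 1)" using uw by (auto simp: Ad_def)
  let ?\<tau> = "chain u w"
  define A where "A = Ad \<inter> {u..w}"
  have finA: "finite A" using finite_Ad by (simp add: A_def)
  have uA: "u \<in> A" using uw by (simp add: A_def)
  define N where "N = card (A - {u})"
  have cardA: "card A = Suc N" using card.remove[OF finA uA] by (simp add: N_def)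
  from cell_ex[OF u1(1)] turn_bounds[OF uw(1), of w] obtain x
    where x: "x \<in> Col u" "rw x = turn w u" "x \<noteq> x0" by blast
  have xX: "x \<in> X" "cl x = u" using x by (auto simp: Col_def)
  have tx: "?\<tau> x = H 0" using x xX uw by (simp add: chain_eq)
  have x_uniq: "{x \<in> X. ?\<tau> x = H 0} = {x}"
    using chain_H0[OF uw] tx xX x cell_inj by auto
  have "(jm ^^ card A) e ?\<tau> = jm ((jm ^^ N) e) ?\<tau>" using cardA by simp
  also have "\<dots> = (\<Sum>y\<in>X - {x}. (jm ^^ N) e (?\<tau> \<circ> Transposition.transpose x y) :: 'a)"
    unfolding jm_def x_uniq by simp
  finally have sum: "(jm ^^ card A) e ?\<tau> = (\<Sum>y\<in>X - {x}. (jm ^^ N) e (?\<tau> \<circ> Transposition.transpose x y) :: 'a)" .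
  \<comment> \<open>All other exchanges leave more than \<open>N\<close> bad columns: either column
    \<open>u\<close> does not get back the label \<open>turn w u\<close> and all of \<open>A\<close>
    is bad, or the column of \<open>y\<close> makes up for \<open>u\<close> in the count.\<close>
  have good: "(jm ^^ N) e (?\<tau> \<circ> Transposition.transpose x y) = (0 :: 'a)"
    if y: "y \<in> X" "y \<noteq> x"
      and ny: "\<not> (u = w \<and> y = x0)"
        "\<not> (u < w \<and> y \<noteq> x0 \<and> cl y \<in> Ad \<and> u < cl y \<and> cl y \<le> w \<and> rw y = turn w (cl y) \<and> H (cl y - 1) = H u)"
    for y
  proof (rule ccontr)
    let ?t = "?\<tau> \<circ> Transposition.transpose x y"
    assume "(jm ^^ N) e ?t \<noteq> (0 :: 'a)"
    then have le: "card (bad_cols ?t) \<le> N" by (rule card_bad_cols_le)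
    have rest: "c \<in> bad_cols ?t" if "c \<in> A" "c \<noteq> u" "c \<noteq> cl y" for c
    proof -
      have "c \<in> bad_cols ?\<tau>" using chain_in_bad_cols[OF uw(1,2)] that by (auto simp: A_def)
      then show ?thesis using bad_cols_transpose_subset[of x ?\<tau> y, OF xX(1) tx y(1)] that xX by auto
    qed
    have cly: "cl y \<in> bad_cols ?t" if "y \<noteq> x0"
      using cell_bounds[OF y(1) that] y H_less_H0[of "cl y"] tx by (intro bad_colsI[of _ y]) (auto simp: Col_def)
    have u_bad: "u \<in> bad_cols ?t" if tu: "?\<tau> y \<noteq> turn w u"
    proof (cases "cl y = u \<and> y \<noteq> x0")
      case True then show ?thesis using cly by auto
    next
      case False
      have "turn w u \<notin> ?t ` Col u"
      proof
        assume "turn w u \<in> ?t ` Col u"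
        then obtain z where z: "z \<in> Col u" "turn w u = ?t z" by (rule imageE)
        have zX: "z \<in> X" "cl z = u" using z by (auto simp: Col_def)
        show False
        proof (cases "z = x")
          case True
          then show False using z tu by simp
        next
          case nz: False
          have "z \<noteq> y" using False zX u1 cl_x0 by auto
          then have tz: "?\<tau> z = turn w u" using nz z by simp
          have z0: "z \<noteq> x0" using zX u1 cl_x0 by auto
          have "rw z \<noteq> turn w u" using cell_inj[OF zX(1) xX(1)] x zX xX nz by auto
          then show False using tz zX chain_eq[OF zX(1) z0] by simp
        qed
      qed
      then have "?t ` Col u \<noteq> {1..H u}" using turn_bounds[OF uw(1), of w] by auto
      then show ?thesis using u1 by (simp add: bad_cols_def)
    qed
    have A_sub: "\<not> A \<subseteq> bad_cols ?t"
      using le cardA card_mono[OF finite_bad_cols, of A ?t] by auto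
    show False
    proof (cases "y = x0")
      case True
      then have "u < w" using ny uw by simp
      then have "H w \<le> H (u)" "1 \<le> H w" "H w < H (w - 1)" "H (w - 1) \<le> H u"
        using H_anti[of u w] H_anti[of u "w - 1"] uw H_zero[of w] by (auto simp: Ad_def)
      then have "?\<tau> y \<noteq> turn w u" using True x0 \<open>u < w\<close> by (auto simp: chain_def turn_def)
      then have "u \<in> bad_cols ?t" by (rule u_bad)
      moreover have "cl y \<notin> A" using True cl_x0 by (simp add: A_def Ad_def)
      ultimately have "A \<subseteq> bad_cols ?t" using rest by blast
      then show False using A_sub by simp
    next
      case False
      note b = cell_bounds[OF y(1) False]
      show False
      proof (cases "cl y \<in> A - {u}")
        case True
        have "?\<tau> y \<noteq> turn w u"
        proof
          assume eq: "?\<tau> y = turn w u"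
          have lt: "u < cl y" "cl y \<le> w" "cl y \<in> Ad" using True by (auto simp: A_def)
          then have t: "turn w u = H u" by (simp add: turn_def)
          have "H (cl y) < H (cl y - 1)" "H (cl y - 1) \<le> H u"
            using lt H_anti[of u "cl y - 1"] by (auto simp: Ad_def)
          then have "rw y \<noteq> H u" using b by linarith
          then have "rw y = turn w (cl y)" "H (cl y - 1) = H u"
            using eq lt unfolding t chain_eq[OF y(1) False] by (auto split: if_splits)
          then show False using ny(2) lt False by auto
        qed
        then have "u \<in> bad_cols ?t" by (rule u_bad)
        then have "A \<subseteq> bad_cols ?t" using rest cly[OF False] by blast
        then show False using A_sub by simp
      next
        case nA: False
        then have "insert (cl y) (A - {u}) \<subseteq> bad_cols ?t" using rest cly[OF False] by auto
        then have "card (insert (cl y) (A - {u})) \<le> N" using le card_mono[OF finite_bad_cols] le_trans by blast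
        moreover have "card (insert (cl y) (A - {u})) = Suc N"
          using nA finA by (simp add: N_def)
        ultimately show False by simp
      qed
    qed
  qed
  show ?case
  proof (cases "u = w")
    case True
    have AN: "N = 0" using True by (auto simp: N_def A_def)
    have "?\<tau> \<circ> Transposition.transpose x x0 = rw"
    proof
      fix y
      consider "y \<notin> X" | "y = x0" | "y = x" | "y \<in> X" "y \<noteq> x0" "y \<noteq> x" by blast
      then show "(?\<tau> \<circ> Transposition.transpose x x0) y = rw y"
      proof cases
        case 1
        then have "y \<noteq> x" "y \<noteq> x0" using xX x0 by auto
        then show ?thesis using 1 by (simp add: chain_def rw_out)
      next
        case 2
        then show ?thesis using tx rw_x0 by simp
      next
        case 3
        then show ?thesis using x x0 True by (simp add: chain_def turn_def)
      next
        case 4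
        then have "\<not> (cl y = u \<and> rw y = turn w u)" using cell_inj[of y x] xX x by auto
        then have "?\<tau> y = rw y" using True 4 by (auto simp: chain_eq)
        then show ?thesis using 4 by simp
      qed
    qed
    moreover have "(\<Sum>y\<in>X - {x}. (jm ^^ N) e (?\<tau> \<circ> Transposition.transpose x y) :: 'a) =
        (\<Sum>y\<in>{x0}. (jm ^^ N) e (?\<tau> \<circ> Transposition.transpose x y))"
      using fin x0 x good True by (intro sum.mono_neutral_right) auto
    ultimately have "(jm ^^ card A) e ?\<tau> = (e rw :: 'a)" using sum AN by simp
    then show ?thesis using polytab_row[OF fin cell_inj] by (simp add: A_def)
  next
    case False
    then have uw': "u < w" using uw by simp
    \<comment> \<open>The next addable column. Between \<open>u\<close> and \<open>u'\<close> the
      heights are constant, so \<open>chain u w\<close> replaces the bottom labels there by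
      themselves.\<close>
    define u' where "u' = (LEAST c. c \<in> Ad \<and> u < c)"
    have u': "u' \<in> Ad \<and> u < u'" unfolding u'_def by (rule LeastI[of _ w]) (use uw uw' in simp)
    have u'_le: "u' \<le> c" if "c \<in> Ad" "u < c" for c unfolding u'_def by (rule Least_le) (use that in simp)
    have u'w: "u' \<le> w" using u'_le uw uw' by blast
    have between: "H c = H u" if "u \<le> c" "c < u'" for c
      using that
    proof (induction "c - u" arbitrary: c)
      case (Suc k)
      then have "H (c - 1) = H u" by (intro Suc.hyps(1)) auto
      moreover have "u < c" using Suc.hyps(2) by linarith
      then have "c \<notin> Ad" using u'_le[of c] Suc.prems by auto
      moreover have "1 \<le> c" "c \<le> q" using Suc u1 u' by (auto simp: Ad_def)
      ultimately show ?case using H_anti[of "c - 1" c] by (auto simp: Ad_def)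
    qed simp
    from cell_ex[of u' "turn w u'"] turn_bounds[of u' w] u' obtain z
      where z: "z \<in> Col u'" "rw z = turn w u'" "z \<noteq> x0" by (auto simp: Ad_def)
    have zX: "z \<in> X" "cl z = u'" using z by (auto simp: Col_def)
    have zx: "z \<noteq> x" using zX xX u' by auto
    have AN: "N = card (Ad \<inter> {u'..w})"
    proof -
      have "A - {u} = Ad \<inter> {u'..w}" using u'_le u' by (auto simp: A_def)
      then show ?thesis by (simp add: N_def)
    qed
    have "H (u' - 1) = H u" using u' by (intro between) auto
    then have tz: "?\<tau> z = H u"
      using z zX u' u'w by (simp add: chain_eq)
    \<comment> \<open>The label \<open>H u\<close>, carried by \<open>z\<close>, returns to column
      \<open>u\<close>, and \<open>H 0\<close> moves on to column \<open>u'\<close>.\<close>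
    have next_chain: "?\<tau> \<circ> Transposition.transpose x z = chain u' w"
    proof
      fix y
      consider "y \<notin> X" | "y = x0" | "y = x" | "y = z" | "y \<in> X" "y \<noteq> x0" "y \<noteq> x" "y \<noteq> z" by blast
      then show "(?\<tau> \<circ> Transposition.transpose x z) y = chain u' w y"
      proof cases
        case 1
        then have "y \<noteq> x" "y \<noteq> z" using xX zX by auto
        then show ?thesis using 1 by (simp add: chain_def)
      next
        case 2
        then show ?thesis using x z x0 by (simp add: chain_def)
      next
        case 3
        have "chain u' w x = rw x" using u' xX x by (simp add: chain_eq)
        then show ?thesis using 3 tz x uw' by (simp add: turn_def)
      next
        case 4
        have "chain u' w z = H 0" using u'w zX z by (simp add: chain_eq)
        then show ?thesis using 4 tx by simp
      next
        case 5
        note b = cell_bounds[OF 5(1,2)]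
        have nx: "\<not> (cl y = u \<and> rw y = turn w u)" using cell_inj[of y x] xX x 5 by auto
        have nz: "\<not> (cl y = u' \<and> rw y = turn w u')" using cell_inj[of y z] zX z 5 by auto
        have "?\<tau> y = chain u' w y"
        proof (cases "u < cl y \<and> cl y < u'")
          case True
          then have "H (cl y - 1) = H u" "H (cl y) = H u" by (auto intro!: between)
          then show ?thesis using True 5 u'w by (auto simp: chain_eq turn_def)
        next
          case False
          then show ?thesis using 5 nx nz u' by (auto simp: chain_eq)
        qed
        then show ?thesis using 5 by simp
      qed
    qed
    have uniq: "y = z" if "y \<in> X" "y \<noteq> x0" "cl y \<in> Ad" "u < cl y" "rw y = turn w (cl y)" "H (cl y - 1) = H u" for y
    proof -
      have "cl y = u'"
      proof (rule ccontr)
        assume "cl y \<noteq> u'"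
        then have "u' \<le> cl y - 1" using u'_le[of "cl y"] that by auto
        then have "H (cl y - 1) \<le> H u'" "H u' < H (u' - 1)" "H (u' - 1) \<le> H u"
          using H_anti[of u' "cl y - 1"] H_anti[of u "u' - 1"] u' by (auto simp: Ad_def)
        then show False using that by simp
      qed
      then show ?thesis using cell_inj[of y z] that zX z by auto
    qed
    have "(\<Sum>y\<in>X - {x}. (jm ^^ N) e (?\<tau> \<circ> Transposition.transpose x y) :: 'a) =
        (\<Sum>y\<in>{z}. (jm ^^ N) e (?\<tau> \<circ> Transposition.transpose x y))"
    proof (rule sum.mono_neutral_right)
      show "\<forall>y\<in>X - {x} - {z}. (jm ^^ N) e (?\<tau> \<circ> Transposition.transpose x y) = (0 :: 'a)"
        using good uniq uw' by blast
    qed (use fin zX zx in auto)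
    then have "(jm ^^ card A) e ?\<tau> = ((jm ^^ N) e (chain u' w) :: 'a)" using sum next_chain by simp
    also have "\<dots> = 1" unfolding AN using u' u'w uw by (intro less.hyps) auto
    finally show ?thesis by (simp add: A_def)
  qed
qed

text \<open>For \<open>1 \<le> j \<le> card Ad\<close> the choice is unique and picks the
  \<open>j\<close>-th addable column, counted from the left.\<close>

definition test_assignment :: "nat \<Rightarrow> 'l \<Rightarrow> nat" where
  "test_assignment j = (if j = 0 then rw else chain 1 (SOME w. w \<in> Ad \<and> card (Ad \<inter> {1..w}) = j))"

lemma Ad_nonempty_1: "1 \<le> q \<Longrightarrow> 1 \<in> Ad"
  using H_0 by (simp add: Ad_def)

lemma card_Ad_less:
  assumes "w' \<in> Ad" "w < w'"
  shows "card (Ad \<inter> {1..w}) < card (Ad \<inter> {1..w'})"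
proof (rule psubset_card_mono)
  have "w' \<in> Ad \<inter> {1..w'}" "w' \<notin> Ad \<inter> {1..w}" using assms by (auto simp: Ad_def)
  moreover have "Ad \<inter> {1..w} \<subseteq> Ad \<inter> {1..w'}" using assms by auto
  ultimately show "Ad \<inter> {1..w} \<subset> Ad \<inter> {1..w'}" by blast
qed (simp add: finite_Ad)

lemma inj_on_card_Ad: "inj_on (\<lambda>w. card (Ad \<inter> {1..w})) Ad"
proof (rule inj_onI)
  fix w w' assume "w \<in> Ad" "w' \<in> Ad" "card (Ad \<inter> {1..w}) = card (Ad \<inter> {1..w'})"
  then show "w = w'" using card_Ad_less[of w' w] card_Ad_less[of w w'] by (cases w w' rule: linorder_cases) auto
qed

lemma test_assignment_card:
  assumes "w \<in> Ad"
  shows "test_assignment (card (Ad \<inter> {1..w})) = chain 1 w"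
proof -
  have inj: "w' = w" if "w' \<in> Ad" "card (Ad \<inter> {1..w'}) = card (Ad \<inter> {1..w})" for w'
    using inj_onD[OF inj_on_card_Ad that(2,1) assms] .
  have "w \<in> Ad \<inter> {1..w}" using assms by (auto simp: Ad_def)
  then have "card (Ad \<inter> {1..w}) \<noteq> 0" using finite_Ad by (auto simp: card_eq_0_iff)
  moreover have "(SOME w'. w' \<in> Ad \<and> card (Ad \<inter> {1..w'}) = card (Ad \<inter> {1..w})) = w"
    using inj assms by (intro some_equality) auto
  ultimately show ?thesis by (simp add: test_assignment_def)
qed

lemma test_assignment_cases:
  assumes "j \<le> card Ad" "j \<noteq> 0"
  obtains w where "w \<in> Ad" "card (Ad \<inter> {1..w}) = j"
proof -
  note inj = inj_on_card_Ad
  have sub: "(\<lambda>w. card (Ad \<inter> {1..w})) ` Ad \<subseteq> {1..card Ad}"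
  proof
    fix i assume "i \<in> (\<lambda>w. card (Ad \<inter> {1..w})) ` Ad"
    then obtain w where w: "w \<in> Ad" "i = card (Ad \<inter> {1..w})" by blast
    then have "w \<in> Ad \<inter> {1..w}" by (auto simp: Ad_def)
    then have "card (Ad \<inter> {1..w}) \<noteq> 0" using finite_Ad by (auto simp: card_eq_0_iff)
    moreover have "card (Ad \<inter> {1..w}) \<le> card Ad" using finite_Ad by (intro card_mono) auto
    ultimately show "i \<in> {1..card Ad}" unfolding w(2) by (metis One_nat_def atLeastAtMost_iff not0_implies_Suc Suc_le_mono zero_le)
  qed
  have "(\<lambda>w. card (Ad \<inter> {1..w})) ` Ad = {1..card Ad}"
    using card_image[OF inj] by (intro card_subset_eq sub) auto
  then have "j \<in> (\<lambda>w. card (Ad \<inter> {1..w})) ` Ad" using assms by auto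
  then show ?thesis using that by blast
qed

lemma jm_pow_test_eq_1: "j \<le> card Ad \<Longrightarrow> (jm ^^ j) e (test_assignment j) = (1 :: 'a :: comm_ring_1)"
proof (cases "j = 0")
  case True
  then show ?thesis using polytab_row[OF fin cell_inj] by (simp add: test_assignment_def)
next
  case False
  assume "j \<le> card Ad"
  with False obtain w where w: "w \<in> Ad" "card (Ad \<inter> {1..w}) = j" using test_assignment_cases by metis
  moreover have "1 \<in> Ad" using w by (intro Ad_nonempty_1) (auto simp: Ad_def)
  ultimately show ?thesis using jm_pow_chain[of 1 w] test_assignment_card[of w] by (auto simp: Ad_def)
qed

lemma jm_pow_test_eq_0:
  assumes "j \<le> card Ad" "i < j"
  shows "(jm ^^ i) e (test_assignment j) = (0 :: 'a :: comm_ring_1)"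
proof (rule ccontr)
  assume "(jm ^^ i) e (test_assignment j) \<noteq> (0 :: 'a)"
  then have le: "card (bad_cols (test_assignment j)) \<le> i" by (rule card_bad_cols_le)
  from assms obtain w where w: "w \<in> Ad" "card (Ad \<inter> {1..w}) = j" using test_assignment_cases by (metis not_less_zero)
  moreover have "1 \<in> Ad" using w by (intro Ad_nonempty_1) (auto simp: Ad_def)
  ultimately have "Ad \<inter> {1..w} \<subseteq> bad_cols (test_assignment j)"
    using chain_in_bad_cols[of 1 w] test_assignment_card[of w] by auto
  then have "j \<le> card (bad_cols (test_assignment j))" using w card_mono[OF finite_bad_cols] by blast
  then show False using le assms by simp
qed

text \<open>Elimination from the last test assignment down: \<open>jm ^^ d\<close> applied to
  \<open>e\<close> has the value 1 at the test assignment \<open>d\<close> and 0 at all later ones,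
  so subtracting a multiple of it clears one more value and keeps the zeros already reached. When
  all values are cleared, \<open>f_zero\<close> applies.\<close>

theorem equivariant_eq_jm_poly_on_e:
  fixes \<Phi> :: "(('l \<Rightarrow> nat) \<Rightarrow> 'a :: idom) \<Rightarrow> ('l \<Rightarrow> nat) \<Rightarrow> 'a"
  assumes two: "(2 :: 'a) \<noteq> 0" and \<Phi>: "equivariant \<Phi>"
  obtains p where "degree p \<le> card Ad" "\<Phi> e = jm_poly p e"
proof -
  have "\<exists>p. degree p \<le> card Ad \<and> \<Phi> e = jm_poly p e"
    if "d \<le> Suc (card Ad)" "equivariant \<Phi>" "\<And>j. d \<le> j \<Longrightarrow> j \<le> card Ad \<Longrightarrow> \<Phi> e (test_assignment j) = 0"
    for d and \<Phi> :: "(('l \<Rightarrow> nat) \<Rightarrow> 'a) \<Rightarrow> ('l \<Rightarrow> nat) \<Rightarrow> 'a"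
    using that
  proof (induction d arbitrary: \<Phi>)
    case 0
    interpret garnir_function H q X x0 rw cl "\<Phi> e"
      using 0 two by (intro garnir_function_equivariant)
    have "\<Phi> e \<tau> = 0" for \<tau>
    proof (rule f_zero)
      show "\<Phi> e rw = 0" using 0(3)[of 0] by (simp add: test_assignment_def)
      fix c assume c: "1 \<le> c" "c \<le> q" "H c < H (c - 1)"
      then have "c \<in> Ad" by (simp add: Ad_def)
      moreover have "card (Ad \<inter> {1..c}) \<le> card Ad" using finite_Ad by (intro card_mono) auto
      ultimately show "\<Phi> e (chain 1 c) = 0"
        using 0(3)[of "card (Ad \<inter> {1..c})"] unfolding test_assignment_card[OF \<open>c \<in> Ad\<close>] by simp
    qed
    then have "\<Phi> e = jm_poly 0 e" by (intro ext) (simp add: jm_poly_0)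
    then show ?case by (intro exI[of _ 0]) simp
  next
    case (Suc d)
    define a where "a = \<Phi> e (test_assignment d)"
    let ?\<Psi> = "\<lambda>F \<tau>. 1 * \<Phi> F \<tau> + (- a) * jm_poly (monom 1 d) F \<tau>"
    have "\<exists>p. degree p \<le> card Ad \<and> ?\<Psi> e = jm_poly p e"
    proof (rule Suc.IH)
      show "equivariant ?\<Psi>" by (intro equivariant_lincomb Suc.prems equivariant_jm_poly)
      show "?\<Psi> e (test_assignment j) = 0" if "d \<le> j" "j \<le> card Ad" for j
        using that Suc.prems(3)[of j] jm_pow_test_eq_0[where 'a = 'a, of j d] jm_pow_test_eq_1[where 'a = 'a, of d]
        by (cases "j = d") (simp_all add: jm_poly_monom a_def)
    qed (use Suc.prems in simp)
    then obtain p where p: "degree p \<le> card Ad" "?\<Psi> e = jm_poly p e" by blast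
    have "\<Phi> e = jm_poly (p + monom a d) e"
    proof
      fix \<tau>
      show "\<Phi> e \<tau> = jm_poly (p + monom a d) e \<tau>"
        using fun_cong[OF p(2), of \<tau>] by (simp add: jm_poly_add jm_poly_monom diff_eq_eq)
    qed
    moreover have "degree (p + monom a d) \<le> card Ad"
      using p(1) Suc.prems(1) degree_monom_le[of a d] by (intro degree_add_le) auto
    ultimately show ?case by blast
  qed
  from this[of "Suc (card Ad)" \<Phi>] \<Phi> that show ?thesis by auto
qed

text \<open>At the test assignment indexed by the degree of \<open>p\<close> only the leading term
  is seen.\<close>

lemma jm_poly_e_eq_0:
  assumes "jm_poly p e = (\<lambda>_. 0 :: 'a :: comm_ring_1)" "degree p \<le> card Ad"
  shows "p = 0"
proof -
  let ?n = "degree p"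
  have "jm_poly p e (test_assignment ?n) = (\<Sum>i\<le>?n. if i = ?n then coeff p i else 0)"
    unfolding jm_poly_def using assms(2) jm_pow_test_eq_0[where 'a = 'a, of ?n] jm_pow_test_eq_1[where 'a = 'a, of ?n]
    by (intro sum.cong) auto
  then have "lead_coeff p = 0" using assms(1) by simp
  then show ?thesis by simp
qed

end

section \<open>The minimal polynomial of the Jucys--Murphy operator\<close>

text \<open>For \<open>Y = X\<close> this is the action of twice the sum of all transpositions, a
  central element of the group algebra. It commutes with \<open>jm\<close> and gives access to the
  eigenvalues of \<open>jm\<close>.\<close>

definition transp_sum :: "'l set \<Rightarrow> (('l \<Rightarrow> nat) \<Rightarrow> 'a :: comm_ring_1) \<Rightarrow> ('l \<Rightarrow> nat) \<Rightarrow> 'a" where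
  "transp_sum Y F \<tau> = (\<Sum>y\<in>Y. \<Sum>z\<in>Y - {y}. F (\<tau> \<circ> Transposition.transpose y z))"

text \<open>Ordered pairs are summed, so this is twice the content sum of the diagram.\<close>

lemma transp_sum_polytab:
  fixes cl rw :: "'l \<Rightarrow> nat"
  assumes two: "(2 :: 'a :: idom) \<noteq> 0" and X: "finite X"
    and inj: "\<And>y z. y \<in> X \<Longrightarrow> z \<in> X \<Longrightarrow> cl y = cl z \<Longrightarrow> rw y = rw z \<Longrightarrow> y = z"
    and Y: "Y = {y \<in> X. 1 \<le> cl y}"
    and nested: "\<And>c d. 1 \<le> c \<Longrightarrow> c < d \<Longrightarrow> rw ` {y \<in> X. cl y = d} \<subseteq> rw ` {y \<in> X. cl y = c}"
  shows "transp_sum Y (polytab X cl rw) \<tau> =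
    (of_int (\<Sum>y\<in>Y. 2 * (int (cl y) - 1) - (int (card {z \<in> X. cl z = cl y}) - 1)) * polytab X cl rw \<tau> :: 'a)"
proof -
  let ?e = "polytab X cl rw :: _ \<Rightarrow> 'a"
  let ?t = "Transposition.transpose :: 'l \<Rightarrow> 'l \<Rightarrow> 'l \<Rightarrow> 'l"
  let ?f = "\<lambda>y z. ?e (\<tau> \<circ> ?t y z)"
  have finY: "finite Y" using X Y by simp
  \<comment> \<open>One Garnir relation for each of the \<open>cl y - 1\<close> columns to the left
    of \<open>y\<close>.\<close>
  have left: "(\<Sum>z | z \<in> Y \<and> cl z < cl y. ?f y z) = of_int (int (cl y) - 1) * ?e \<tau>" if y: "y \<in> Y" for y
  proof -
    have "(\<Sum>z | z \<in> Y \<and> cl z < cl y. ?f y z) = (\<Sum>c\<in>{1..<cl y}. \<Sum>z | z \<in> {z \<in> Y. cl z < cl y} \<and> cl z = c. ?f y z)"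
      using finY Y X by (intro sum.group[symmetric]) auto
    also have "\<dots> = (\<Sum>c\<in>{1..<cl y}. ?e \<tau>)"
    proof (rule sum.cong[OF refl])
      fix c assume c: "c \<in> {1..<cl y}"
      then have "{z \<in> {z \<in> Y. cl z < cl y}. cl z = c} = {z. z \<in> X \<and> cl z = c}" using Y by auto
      moreover have "?e \<tau> = (\<Sum>z | z \<in> X \<and> cl z = c. ?f y z)"
        using c y Y nested[of c "cl y"] by (intro polytab_garnir[OF two X inj]) auto
      ultimately show "(\<Sum>z | z \<in> {z \<in> Y. cl z < cl y} \<and> cl z = c. ?f y z) = ?e \<tau>" by simp
    qed
    also have "\<dots> = of_int (int (cl y) - 1) * ?e \<tau>"
      using y Y by (simp add: of_nat_diff)
    finally show ?thesis .
  qed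
  \<comment> \<open>Each transposition within a column acts as -1.\<close>
  have same: "(\<Sum>z | z \<in> Y - {y} \<and> cl z = cl y. ?f y z) = - of_int (int (card {z \<in> X. cl z = cl y}) - 1) * ?e \<tau>"
    if y: "y \<in> Y" for y
  proof -
    have "(\<Sum>z | z \<in> Y - {y} \<and> cl z = cl y. ?f y z) = (\<Sum>z | z \<in> Y - {y} \<and> cl z = cl y. - ?e \<tau>)"
      using y Y X by (intro sum.cong refl polytab_transpose) auto
    also have "\<dots> = - (of_nat (card {z. z \<in> Y - {y} \<and> cl z = cl y}) * ?e \<tau>)"
      by (simp only: sum_constant mult_minus_right)
    finally have sum: "(\<Sum>z | z \<in> Y - {y} \<and> cl z = cl y. ?f y z) = - (of_nat (card {z. z \<in> Y - {y} \<and> cl z = cl y}) * ?e \<tau>)" .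
    have S: "{z. z \<in> Y - {y} \<and> cl z = cl y} = {z \<in> X. cl z = cl y} - {y}" using Y y by auto
    have "int (card ({z \<in> X. cl z = cl y} - {y})) = int (card {z \<in> X. cl z = cl y}) - 1"
      using y Y X card_Diff_singleton[of y "{z \<in> X. cl z = cl y}"] card_gt_0_iff[of "{z \<in> X. cl z = cl y}"]
      by (auto simp: of_nat_diff Suc_le_eq)
    from arg_cong[OF this, of "of_int :: int \<Rightarrow> 'a"]
    have n: "(of_nat (card ({z \<in> X. cl z = cl y} - {y})) :: 'a) = of_int (int (card {z \<in> X. cl z = cl y}) - 1)"
      by simp
    show ?thesis using sum unfolding S n by (simp only: mult_minus_left)
  qed
  \<comment> \<open>An exchange with a letter to the right is an exchange of that letter with one to
    its left; this is the origin of the factor 2 in the result.\<close>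
  have right: "(\<Sum>y\<in>Y. \<Sum>z | z \<in> Y \<and> cl y < cl z. ?f y z) = (\<Sum>y\<in>Y. of_int (int (cl y) - 1) * ?e \<tau>)"
  proof -
    have "(\<Sum>y\<in>Y. \<Sum>z | z \<in> Y \<and> cl y < cl z. ?f y z) = (\<Sum>z\<in>Y. \<Sum>y | y \<in> Y \<and> cl y < cl z. ?f y z)"
      using finY by (intro sum.swap_restrict) auto
    also have "\<dots> = (\<Sum>z\<in>Y. \<Sum>y | y \<in> Y \<and> cl y < cl z. ?f z y)"
      by (simp only: transpose_commute)
    also have "\<dots> = (\<Sum>y\<in>Y. of_int (int (cl y) - 1) * ?e \<tau>)"
      by (intro sum.cong refl left)
    finally show ?thesis .
  qed
  have "(\<Sum>z\<in>Y - {y}. ?f y z) = (\<Sum>z | z \<in> Y \<and> cl z < cl y. ?f y z)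
      + (\<Sum>z | z \<in> Y - {y} \<and> cl z = cl y. ?f y z) + (\<Sum>z | z \<in> Y \<and> cl y < cl z. ?f y z)" if "y \<in> Y" for y
  proof -
    have "Y - {y} = ({z. z \<in> Y \<and> cl z < cl y} \<union> {z. z \<in> Y - {y} \<and> cl z = cl y}) \<union> {z. z \<in> Y \<and> cl y < cl z}"
      by auto
    then have "(\<Sum>z\<in>Y - {y}. ?f y z) = sum (?f y) (({z. z \<in> Y \<and> cl z < cl y} \<union> {z. z \<in> Y - {y} \<and> cl z = cl y}) \<union> {z. z \<in> Y \<and> cl y < cl z})"
      by (simp only:)
    also have "\<dots> = sum (?f y) ({z. z \<in> Y \<and> cl z < cl y} \<union> {z. z \<in> Y - {y} \<and> cl z = cl y}) + (\<Sum>z | z \<in> Y \<and> cl y < cl z. ?f y z)"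
      using finY by (intro sum.union_disjoint) auto
    also have "sum (?f y) ({z. z \<in> Y \<and> cl z < cl y} \<union> {z. z \<in> Y - {y} \<and> cl z = cl y}) =
        (\<Sum>z | z \<in> Y \<and> cl z < cl y. ?f y z) + (\<Sum>z | z \<in> Y - {y} \<and> cl z = cl y. ?f y z)"
      using finY by (intro sum.union_disjoint) auto
    finally show ?thesis .
  qed
  then have "transp_sum Y ?e \<tau> = (\<Sum>y\<in>Y. (\<Sum>z | z \<in> Y \<and> cl z < cl y. ?f y z)
      + (\<Sum>z | z \<in> Y - {y} \<and> cl z = cl y. ?f y z)) + (\<Sum>y\<in>Y. \<Sum>z | z \<in> Y \<and> cl y < cl z. ?f y z)"
    unfolding transp_sum_def by (simp add: sum.distrib)
  also have "(\<Sum>y\<in>Y. (\<Sum>z | z \<in> Y \<and> cl z < cl y. ?f y z) + (\<Sum>z | z \<in> Y - {y} \<and> cl z = cl y. ?f y z)) =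
      (\<Sum>y\<in>Y. of_int (int (cl y) - 1) * ?e \<tau> + - of_int (int (card {z \<in> X. cl z = cl y}) - 1) * ?e \<tau>)"
    by (intro sum.cong refl arg_cong2[where f = "(+)"] left same)
  also note right
  also have "(\<Sum>y\<in>Y. of_int (int (cl y) - 1) * ?e \<tau> + - of_int (int (card {z \<in> X. cl z = cl y}) - 1) * ?e \<tau>)
        + (\<Sum>y\<in>Y. of_int (int (cl y) - 1) * ?e \<tau>) =
      (\<Sum>y\<in>Y. of_int (2 * (int (cl y) - 1) - (int (card {z \<in> X. cl z = cl y}) - 1)) * ?e \<tau>)"
    unfolding sum.distrib[symmetric] by (intro sum.cong refl) (simp add: algebra_simps)
  finally show ?thesis by (simp only: of_int_sum sum_distrib_right)
qed

context labelled_diagram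
begin

section \<open>Residues as eigenvalues, read off from the central element\<close>

definition residue_of_col :: "nat \<Rightarrow> int" where "residue_of_col c = int c - 1 - int (H c)"

text \<open>Column \<open>q + 1\<close> carries the addable node in the first row.\<close>

definition addable_cols :: "nat set" where "addable_cols = insert (Suc q) Ad"

lemma finite_addable_cols: "finite addable_cols"
  by (simp add: addable_cols_def finite_Ad)

lemma card_addable_cols: "card addable_cols = Suc (card Ad)"
  using finite_Ad by (auto simp: addable_cols_def Ad_def)

lemma addable_cols_iff: "c \<in> addable_cols \<longleftrightarrow> 1 \<le> c \<and> H c < H (c - 1)"
  using H_zero[of c] H_zero[of "c - 1"] by (auto simp: addable_cols_def Ad_def)

lemma transp_sum_jm: "transp_sum X (jm F) = jm (transp_sum X F)"
proof
  fix \<tau>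
  have p: "Transposition.transpose y z permutes X" if "y \<in> X" "z \<in> X - {y}" for y z
    using that by (auto intro: permutes_swap_id)
  have lin: "jm (\<lambda>\<tau>. \<Sum>i\<in>I. G i \<tau>) \<tau> = (\<Sum>i\<in>I. jm (G i) \<tau>)" for I :: "'l set" and G \<tau>
    using jm_sum[of "\<lambda>_. 1" G I \<tau>] by simp
  have "jm (transp_sum X F) \<tau> = (\<Sum>y\<in>X. \<Sum>z\<in>X - {y}. jm (\<lambda>\<tau>. F (\<tau> \<circ> Transposition.transpose y z)) \<tau>)"
    unfolding transp_sum_def[abs_def] by (simp only: lin)
  also have "\<dots> = transp_sum X (jm F) \<tau>"
    unfolding transp_sum_def by (intro sum.cong refl jm_act p)
  finally show "transp_sum X (jm F) \<tau> = jm (transp_sum X F) \<tau>" ..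
qed

definition content_sum :: int where
  "content_sum = (\<Sum>y\<in>X - {x0}. 2 * (int (cl y) - 1) - (int (H (cl y)) - 1))"

text \<open>The transpositions that fix \<open>x0\<close> act on \<open>e\<close> through the
  contents of the diagram, and those that move \<open>x0\<close>, each counted twice, through
  \<open>jm\<close>. So on \<open>e\<close> the operator \<open>jm\<close> agrees with an affine
  function of a central operator.\<close>

lemma transp_sum_e:
  assumes two: "(2 :: 'a :: idom) \<noteq> 0"
  shows "transp_sum X e \<tau> = (of_int content_sum * e \<tau> + 2 * jm e \<tau> :: 'a)"
proof -
  let ?f = "\<lambda>y z. e (\<tau> \<circ> Transposition.transpose y z) :: 'a"
  let ?Y = "X - {x0}"
  have Y: "?Y = {y \<in> X. 1 \<le> cl y}" using cl_eq_0 cl_x0 by (auto simp: Suc_le_eq)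
  have im: "rw ` {y \<in> X. cl y = d} = {1..H d}" if "1 \<le> d" for d
    using Col_rw[OF that] by (simp add: bij_betw_def Col_def)
  have "transp_sum ?Y e \<tau> = (of_int (\<Sum>y\<in>?Y. 2 * (int (cl y) - 1) - (int (card {z \<in> X. cl z = cl y}) - 1)) * e \<tau> :: 'a)"
    using H_anti by (intro transp_sum_polytab[OF two fin cell_inj Y]) (auto simp: im)
  also have "(\<Sum>y\<in>?Y. 2 * (int (cl y) - 1) - (int (card {z \<in> X. cl z = cl y}) - 1)) = content_sum"
    unfolding content_sum_def using card_Col cell_bounds(1) by (intro sum.cong refl) (auto simp: Col_def)
  finally have inner: "transp_sum ?Y e \<tau> = (of_int content_sum * e \<tau> :: 'a)" .
  have "(\<Sum>z\<in>X - {y}. ?f y z) = ?f y x0 + (\<Sum>z\<in>?Y - {y}. ?f y z)" if "y \<in> ?Y" for y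
  proof -
    have "X - {y} - {x0} = ?Y - {y}" by auto
    then show ?thesis using sum.remove[of "X - {y}" x0 "?f y"] fin x0 that by auto
  qed
  then have "transp_sum X e \<tau> = (\<Sum>z\<in>?Y. ?f x0 z) + (\<Sum>y\<in>?Y. ?f y x0 + (\<Sum>z\<in>?Y - {y}. ?f y z))"
    unfolding transp_sum_def using sum.remove[OF fin x0, of "\<lambda>y. \<Sum>z\<in>X - {y}. ?f y z"] by simp
  also have "(\<Sum>y\<in>?Y. ?f y x0 + (\<Sum>z\<in>?Y - {y}. ?f y z)) = (\<Sum>y\<in>?Y. ?f x0 y) + transp_sum ?Y e \<tau>"
    unfolding transp_sum_def sum.distrib by (simp only: transpose_commute)
  finally show ?thesis by (simp only: inner jm_e mult_2 add_ac)
qed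

lemma transp_sum_jm_pow:
  assumes two: "(2 :: 'a :: idom) \<noteq> 0"
  shows "transp_sum X ((jm ^^ i) e) \<tau> = (of_int content_sum * (jm ^^ i) e \<tau> + 2 * (jm ^^ Suc i) e \<tau> :: 'a)"
proof (induction i arbitrary: \<tau>)
  case 0
  show ?case using transp_sum_e[OF two] by simp
next
  case (Suc i)
  have "transp_sum X ((jm ^^ i) e) = (\<lambda>\<tau>. of_int content_sum * (jm ^^ i) e \<tau> + 2 * (jm ^^ Suc i) e \<tau> :: 'a)"
    by (rule ext) (rule Suc.IH)
  then have "transp_sum X (jm ((jm ^^ i) e)) \<tau> = jm (\<lambda>\<tau>. of_int content_sum * (jm ^^ i) e \<tau> + 2 * (jm ^^ Suc i) e \<tau> :: 'a) \<tau>"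
    by (simp only: transp_sum_jm)
  also have "\<dots> = of_int content_sum * jm ((jm ^^ i) e) \<tau> + 2 * jm ((jm ^^ Suc i) e) \<tau>" by (rule jm_linear)
  finally show ?case by simp
qed

text \<open>For an addable node, pairing with a polytabloid of the enlarged diagram is an eigenfunctional of
  \<^const>\<open>jm\<close>, because the sum of all transpositions acts on the polytabloids of both diagrams by
  scalars.\<close>

lemma eigenfunctional:
  assumes c: "c \<in> addable_cols" and zero: "jm_poly p e = (\<lambda>_. 0 :: rat)"
  shows "poly p (of_int (residue_of_col c)) = 0"
proof -
  have two: "(2 :: rat) \<noteq> 0" by simp
  have c1: "1 \<le> c" "H c < H (c - 1)" using c by (auto simp: addable_cols_iff)
  \<comment> \<open>The diagram with the addable node of column \<open>c\<close> adjoined, and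
    \<open>x0\<close> placed in that node.\<close>
  define r where "r = Suc (H c)"
  define cl' where "cl' = cl(x0 := c)"
  define rw' where "rw' = rw(x0 := r)"
  let ?w = "polytab X cl' rw' :: _ \<Rightarrow> rat"
  have inj: "y = z" if "y \<in> X" "z \<in> X" "cl' y = cl' z" "rw' y = rw' z" for y z
  proof -
    have "False" if "y \<in> X" "y \<noteq> x0" "cl y = c" "rw y = r" for y
      using cell_bounds(3)[OF that(1,2)] that by (simp add: r_def)
    then show ?thesis using that cell_inj[of y z] unfolding cl'_def rw'_def by (auto split: if_splits)
  qed
  have col': "{y \<in> X. cl' y = d} = (if d = c then insert x0 (Col c) else Col d)" if "1 \<le> d" for d
    using that x0 cl_x0 by (auto simp: cl'_def Col_def)
  have x0_notin: "x0 \<notin> Col d" if "1 \<le> d" for d using that cl_x0 by (auto simp: Col_def)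
  have im: "rw' ` {y \<in> X. cl' y = d} = {1..(if d = c then r else H d)}" if "1 \<le> d" for d
  proof -
    have "rw' ` Col d = rw ` Col d" using x0_notin[OF that] by (intro image_cong) (auto simp: rw'_def)
    then have "rw' ` Col d = {1..H d}" using Col_rw[OF that] by (simp add: bij_betw_def)
    moreover have "rw' x0 = r" by (simp add: rw'_def)
    ultimately show ?thesis unfolding col'[OF that] by (auto simp: r_def atLeastAtMostSuc_conv)
  qed
  have nested: "rw' ` {y \<in> X. cl' y = d} \<subseteq> rw' ` {y \<in> X. cl' y = d'}" if "1 \<le> d'" "d' < d" for d d'
  proof -
    have "(if d = c then r else H d) \<le> (if d' = c then r else H d')"
    proof -
      have "d' < c \<Longrightarrow> H (c - 1) \<le> H d'" by (rule H_anti) simp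
      then show ?thesis using H_anti[of d' d] that c1 by (auto simp: r_def)
    qed
    then show ?thesis using that im[of d] im[of d'] by auto
  qed
  define \<kappa> where "\<kappa> = (\<Sum>y\<in>X. 2 * (int (cl' y) - 1) - (int (card {z \<in> X. cl' z = cl' y}) - 1))"
  have clge: "1 \<le> cl' y" if "y \<in> X" for y using that c1 cell_bounds(1)[of y] by (auto simp: cl'_def)
  have w: "transp_sum X ?w \<tau> = of_int \<kappa> * ?w \<tau>" for \<tau>
    unfolding \<kappa>_def using clge by (intro transp_sum_polytab[OF two fin inj _ nested]) auto
  have card': "card {z \<in> X. cl' z = d} = (if d = c then r else H d)" if "1 \<le> d" for d
    unfolding col'[OF that] using x0_notin card_Col that c1 finite_Col by (auto simp: r_def)
  \<comment> \<open>The new cell contributes \<open>2 * (c - 1) - H c\<close>, and each of the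
    \<open>H c\<close> letters above it loses 1 because its column has grown by one cell.\<close>
  have \<kappa>: "\<kappa> = content_sum + 2 * residue_of_col c"
  proof -
    have cx: "cl' x0 = c" by (simp add: cl'_def)
    have kx: "int (card {z \<in> X. cl' z = cl' x0}) = int (H c) + 1" using card'[OF c1(1)] by (simp add: cx r_def)
    have "\<kappa> = (2 * (int (cl' x0) - 1) - (int (card {z \<in> X. cl' z = cl' x0}) - 1)) +
        (\<Sum>y\<in>X - {x0}. 2 * (int (cl' y) - 1) - (int (card {z \<in> X. cl' z = cl' y}) - 1))"
      unfolding \<kappa>_def by (rule sum.remove[OF fin x0])
    also have "2 * (int (cl' x0) - 1) - (int (card {z \<in> X. cl' z = cl' x0}) - 1) = 2 * (int c - 1) - int (H c)"
      unfolding kx unfolding cx by simp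
    also have "(\<Sum>y\<in>X - {x0}. 2 * (int (cl' y) - 1) - (int (card {z \<in> X. cl' z = cl' y}) - 1)) =
        (\<Sum>y\<in>X - {x0}. (2 * (int (cl y) - 1) - (int (H (cl y)) - 1)) - (if y \<in> Col c then 1 else 0))"
    proof (rule sum.cong[OF refl])
      fix y assume y: "y \<in> X - {x0}"
      then have "cl' y = cl y" "1 \<le> cl y" using cell_bounds(1) by (auto simp: cl'_def)
      then show "2 * (int (cl' y) - 1) - (int (card {z \<in> X. cl' z = cl' y}) - 1) =
          (2 * (int (cl y) - 1) - (int (H (cl y)) - 1)) - (if y \<in> Col c then 1 else 0)"
        using y by (simp add: card' Col_def r_def)
    qed
    also have "\<dots> = content_sum - (\<Sum>y\<in>X - {x0}. if y \<in> Col c then 1 else 0)"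
      unfolding content_sum_def by (rule sum_subtractf)
    also have "(\<Sum>y\<in>X - {x0}. if y \<in> Col c then 1 else 0 :: int) = int (H c)"
    proof -
      have "(X - {x0}) \<inter> Col c = Col c" using x0_notin[OF c1(1)] Col_subset by auto
      then show ?thesis using fin card_Col[OF c1(1)] by (simp add: sum.inter_restrict[symmetric])
    qed
    finally show ?thesis by (simp add: residue_of_col_def)
  qed
  \<comment> \<open>\<open>\<Omega>\<close> consists of all rearrangements of \<open>rw\<close>.
    Summing over it pairs functions for the original diagram with the polytabloid of the enlarged
    one; replacing the label \<open>H 0\<close> by the row \<open>r\<close> of the new node
    translates between the two kinds of assignments.\<close>
  define \<Omega> where "\<Omega> = (\<lambda>s. rw \<circ> s) ` {s. s permutes X}"
  have fin\<Omega>: "finite \<Omega>" unfolding \<Omega>_def using finite_permutations[OF fin] by simp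
  define merge where "merge = (\<lambda>\<tau> :: 'l \<Rightarrow> nat. (\<lambda>k. if k = H 0 then r else k) \<circ> \<tau>)"
  define \<Lambda> where "\<Lambda> F = (\<Sum>\<tau>\<in>\<Omega>. F \<tau> * ?w (merge \<tau>))" for F :: "('l \<Rightarrow> nat) \<Rightarrow> rat"
  \<comment> \<open>Transpositions are their own inverses, so they can be moved to the other factor
    of the pairing, where their sum acts by the scalar \<open>\<kappa>\<close>.\<close>
  have \<Lambda>_transp: "\<Lambda> (transp_sum X F) = of_int \<kappa> * \<Lambda> F" for F
  proof -
    have "(\<Sum>\<tau>\<in>\<Omega>. F (\<tau> \<circ> Transposition.transpose y z) * ?w (merge \<tau>)) =
        (\<Sum>\<tau>\<in>\<Omega>. F \<tau> * ?w (merge \<tau> \<circ> Transposition.transpose y z))" if "y \<in> X" "z \<in> X" for y z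
    proof -
      have tO: "\<tau> \<circ> Transposition.transpose y z \<in> \<Omega>" if "\<tau> \<in> \<Omega>" for \<tau>
        using that permutes_compose[OF permutes_swap_id[OF \<open>y \<in> X\<close> \<open>z \<in> X\<close>]]
        unfolding \<Omega>_def by (auto simp: comp_assoc)
      show ?thesis
        by (rule sum.reindex_bij_witness[where i = "\<lambda>\<tau>. \<tau> \<circ> Transposition.transpose y z"
              and j = "\<lambda>\<tau>. \<tau> \<circ> Transposition.transpose y z"])
          (simp_all add: tO comp_assoc merge_def)
    qed
    note sw = this
    have "\<Lambda> (transp_sum X F) =
        (\<Sum>y\<in>X. \<Sum>z\<in>X - {y}. \<Sum>\<tau>\<in>\<Omega>. F (\<tau> \<circ> Transposition.transpose y z) * ?w (merge \<tau>))"
      unfolding \<Lambda>_def transp_sum_def sum_distrib_right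
      by (subst sum.swap, rule sum.cong[OF refl], rule sum.swap)
    also have "\<dots> = (\<Sum>y\<in>X. \<Sum>z\<in>X - {y}. \<Sum>\<tau>\<in>\<Omega>. F \<tau> * ?w (merge \<tau> \<circ> Transposition.transpose y z))"
      by (rule sum.cong[OF refl], rule sum.cong[OF refl], rule sw) auto
    also have "\<dots> = (\<Sum>\<tau>\<in>\<Omega>. F \<tau> * transp_sum X ?w (merge \<tau>))"
      unfolding transp_sum_def sum_distrib_left
      by (rule sym, subst sum.swap, rule sum.cong[OF refl], rule sum.swap)
    also have "\<dots> = of_int \<kappa> * \<Lambda> F"
      by (simp add: w \<Lambda>_def sum_distrib_left algebra_simps)
    finally show ?thesis .
  qed
  have \<Lambda>_lin: "\<Lambda> (\<lambda>\<tau>. a * F \<tau> + b * G \<tau>) = a * \<Lambda> F + b * \<Lambda> G" for a b F G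
    by (simp add: \<Lambda>_def sum.distrib sum_distrib_left algebra_simps)
  have pow: "\<Lambda> ((jm ^^ i) e) = of_int (residue_of_col c) ^ i * \<Lambda> e" for i
  proof (induction i)
    case (Suc i)
    have "transp_sum X ((jm ^^ i) e) = (\<lambda>\<tau>. of_int content_sum * (jm ^^ i) e \<tau> + 2 * (jm ^^ Suc i) e \<tau> :: rat)"
      by (rule ext) (rule transp_sum_jm_pow[OF two])
    then have "of_int \<kappa> * \<Lambda> ((jm ^^ i) e) = of_int content_sum * \<Lambda> ((jm ^^ i) e) + 2 * \<Lambda> ((jm ^^ Suc i) e)"
      by (simp only: \<Lambda>_transp[symmetric] \<Lambda>_lin)
    then have "\<Lambda> ((jm ^^ Suc i) e) = of_int (residue_of_col c) * \<Lambda> ((jm ^^ i) e)"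
      unfolding \<kappa> by (simp add: algebra_simps)
    then show ?case using Suc by simp
  qed simp
  \<comment> \<open>Column permutations of the diagram fix \<open>x0\<close> and are column
    permutations of the enlarged diagram as well, so each of them contributes
    \<open>sign s * sign s\<close>. The resulting group order is nonzero because the field is
    \<open>rat\<close>.\<close>
  have "\<Lambda> e = of_nat (card (col_group X cl))"
  proof -
    have "\<Lambda> e = (\<Sum>s\<in>col_group X cl. \<Sum>\<tau>\<in>\<Omega>. (if \<tau> \<circ> s = rw then of_int (sign s) else 0) * ?w (merge \<tau>))"
      unfolding \<Lambda>_def polytab_def[of X cl rw] sum_distrib_right by (rule sum.swap)
    also have "\<dots> = (\<Sum>s\<in>col_group X cl. 1)"
    proof (rule sum.cong[OF refl])
      fix s assume s: "s \<in> col_group X cl"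
      let ?i = "Hilbert_Choice.inv s"
      have sp: "s permutes X" using s by (simp add: col_group_def)
      have "(\<Sum>\<tau>\<in>\<Omega>. (if \<tau> \<circ> s = rw then of_int (sign s) else 0) * ?w (merge \<tau>)) =
          (\<Sum>\<tau>\<in>{rw \<circ> ?i}. of_int (sign s) * ?w (merge \<tau>))"
      proof (rule sum.mono_neutral_cong_right[OF fin\<Omega>])
        show "{rw \<circ> ?i} \<subseteq> \<Omega>" unfolding \<Omega>_def using permutes_inv[OF sp] by auto
        show "\<forall>\<tau>\<in>\<Omega> - {rw \<circ> ?i}. (if \<tau> \<circ> s = rw then of_int (sign s) else 0) * ?w (merge \<tau>) = 0"
        proof
          fix \<tau> assume "\<tau> \<in> \<Omega> - {rw \<circ> ?i}"
          then have "\<tau> \<circ> s \<noteq> rw" using permutes_inv_o(1)[OF sp] by (metis DiffE comp_assoc comp_id singletonI)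
          then show "(if \<tau> \<circ> s = rw then of_int (sign s) else 0) * ?w (merge \<tau>) = 0" by simp
        qed
        show "(if \<tau> \<circ> s = rw then of_int (sign s) else 0) * ?w (merge \<tau>) = of_int (sign s) * ?w (merge \<tau>)"
          if "\<tau> \<in> {rw \<circ> ?i}" for \<tau>
          using that permutes_inv_o(2)[OF sp] by (simp add: comp_assoc)
      qed
      also have "\<dots> = of_int (sign s) * ?w (merge rw \<circ> ?i)" by (simp add: merge_def comp_assoc)
      also have "merge rw = rw'"
      proof
        fix y show "merge rw y = rw' y"
          using rw_eq_H0[of y] rw_out[of y] H_0 x0 by (cases "y \<in> X") (auto simp: merge_def rw'_def rw_x0)
      qed
      also have "?w (rw' \<circ> ?i) = of_int (sign ?i) * ?w rw'"
      proof (rule polytab_sign[OF fin])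
        have "?i \<in> col_group X cl" by (rule col_group_inv[OF s])
        then have i: "?i permutes X" "\<And>y. cl (?i y) = cl y" by (auto simp: col_group_def)
        have "?i y = x0 \<longleftrightarrow> y = x0" for y
        proof (cases "y \<in> X")
          case True
          then have "?i y \<in> X" using i by (simp add: permutes_in_image)
          then show ?thesis using cl_eq_0[of y] cl_eq_0[of "?i y"] i(2)[of y] True by auto
        next
          case False
          then show ?thesis using i(1) by (simp add: permutes_not_in)
        qed
        then have "cl' (?i y) = cl' y" for y using i(2)[of y] by (simp add: cl'_def)
        then show "?i \<in> col_group X cl'" using i by (simp add: col_group_def)
      qed
      also have "?w rw' = 1" by (rule polytab_row[OF fin inj])
      also have "sign ?i = sign s" using sp fin by (meson permutation_permutes sign_inverse)
      also have "rat_of_int (sign s) * (rat_of_int (sign s) * 1) = 1" by (simp add: sign_def)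
      finally show "(\<Sum>\<tau>\<in>\<Omega>. (if \<tau> \<circ> s = rw then of_int (sign s) else 0) * ?w (merge \<tau>)) = 1" .
    qed
    finally show ?thesis by simp
  qed
  then have nz: "\<Lambda> e \<noteq> 0" using finite_col_group[OF fin, of cl] id_col_group[of X cl] by auto
  have "0 = \<Lambda> (jm_poly p e)" unfolding zero by (simp add: \<Lambda>_def)
  also have "\<dots> = (\<Sum>i\<le>degree p. coeff p i * \<Lambda> ((jm ^^ i) e))"
    unfolding \<Lambda>_def jm_poly_def sum_distrib_right sum_distrib_left mult.assoc by (rule sum.swap)
  also have "\<dots> = poly p (of_int (residue_of_col c)) * \<Lambda> e"
    by (simp add: pow poly_altdef sum_distrib_right mult.assoc)
  finally show ?thesis using nz by simp
qed

section \<open>The polynomial with the residues as roots\<close>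

definition residue_poly :: "'a :: comm_ring_1 poly" where
  "residue_poly = (\<Prod>c\<in>addable_cols. [:- of_int (residue_of_col c), 1:])"

lemma residue_of_col_less: "c < d \<Longrightarrow> residue_of_col c < residue_of_col d"
  using H_anti[of c d] by (simp add: residue_of_col_def)

lemma inj_residue_of_col: "inj residue_of_col"
  using residue_of_col_less by (intro linorder_injI) (metis less_irrefl)

lemma degree_residue_poly: "degree (residue_poly :: 'a :: idom poly) = Suc (card Ad)"
proof -
  have "degree (residue_poly :: 'a poly) = (\<Sum>c\<in>addable_cols. degree [:- of_int (residue_of_col c), 1 :: 'a:])"
    unfolding residue_poly_def by (rule degree_prod_eq_sum_degree) simp
  then show ?thesis by (simp add: card_addable_cols)
qed

text \<open>Over the rationals, elimination expresses the power \<open>card Ad + 1\<close> of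
  \<open>jm\<close> on \<open>e\<close> by lower ones. This is a monic relation of degree
  \<open>card Ad + 1\<close> that vanishes at as many distinct residues, so it is the product of the
  corresponding linear factors.\<close>

lemma jm_poly_residue_poly_rat: "jm_poly residue_poly e = (\<lambda>_. 0 :: rat)"
proof -
  let ?k = "card Ad"
  obtain p where p: "degree p \<le> ?k" "(jm_poly (monom 1 (Suc ?k)) e :: _ \<Rightarrow> rat) = jm_poly p e"
    using equivariant_eq_jm_poly_on_e[of "jm_poly (monom (1 :: rat) (Suc ?k))"] equivariant_jm_poly by auto
  let ?g = "monom 1 (Suc ?k) + Polynomial.smult (- 1) p"
  have g0: "jm_poly ?g e = (\<lambda>_. 0 :: rat)"
  proof
    fix \<tau>
    show "jm_poly ?g e \<tau> = (0 :: rat)"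
      unfolding jm_poly_add jm_poly_smult using fun_cong[OF p(2), of \<tau>] by simp
  qed
  have "residue_poly = ?g"
  proof (rule ccontr)
    assume ne: "residue_poly \<noteq> ?g"
    let ?d = "residue_poly - ?g"
    have lc: "lead_coeff (residue_poly :: rat poly) = 1"
      unfolding residue_poly_def by (simp add: lead_coeff_prod)
    have "degree ?d \<le> ?k"
    proof (rule degree_le, intro allI impI)
      fix i assume i: "?k < i"
      have pi: "coeff p i = 0" using i p(1) by (simp add: coeff_eq_0)
      show "coeff ?d i = 0"
      proof (cases "i = Suc ?k")
        case True
        then show ?thesis using lc pi by (simp add: degree_residue_poly)
      next
        case False
        then have "degree (residue_poly :: rat poly) < i" using i by (simp add: degree_residue_poly)
        then show ?thesis using pi False by (simp add: coeff_eq_0)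
      qed
    qed
    moreover have "card (of_int ` residue_of_col ` addable_cols :: rat set) \<le> card {x. poly ?d x = 0}"
    proof (rule card_mono)
      show "finite {x. poly ?d x = 0}" using ne by (intro poly_roots_finite) simp
      show "of_int ` residue_of_col ` addable_cols \<subseteq> {x. poly ?d x = 0}"
      proof clarify
        fix c assume c: "c \<in> addable_cols"
        have "poly (residue_poly :: rat poly) (of_int (residue_of_col c)) = 0"
          unfolding residue_poly_def poly_prod using c finite_addable_cols by (intro prod_zero) auto
        moreover have "poly ?g (of_int (residue_of_col c)) = 0" by (rule eigenfunctional[OF c g0])
        ultimately show "poly ?d (of_int (residue_of_col c)) = 0" by (simp only: poly_diff)
      qed
    qed
    moreover have "card (of_int ` residue_of_col ` addable_cols :: rat set) = Suc ?k"
      using inj_residue_of_col card_addable_cols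
      by (simp add: card_image inj_on_def inj_def image_image)
    moreover have "card {x. poly ?d x = 0} \<le> degree ?d" using ne by (intro card_poly_roots_bound) simp
    ultimately show False by linarith
  qed
  then show ?thesis using g0 by simp
qed

lemma of_int_e: "of_int (e \<tau>) = (e \<tau> :: 'a :: comm_ring_1)"
  unfolding polytab_def of_int_sum by (intro sum.cong refl) auto

lemma of_int_jm_pow: "of_int ((jm ^^ i) e \<tau>) = ((jm ^^ i) e \<tau> :: 'a :: comm_ring_1)"
  by (induction i arbitrary: \<tau>) (simp_all add: of_int_e jm_def)

lemma of_int_jm_poly: "of_int (jm_poly p e \<tau>) = (jm_poly (map_poly of_int p) e \<tau> :: 'a :: comm_ring_1)"
proof -
  have "jm_poly (map_poly of_int p) e \<tau> = (\<Sum>i\<le>degree p. coeff (map_poly of_int p) i * (jm ^^ i) e \<tau> :: 'a)"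
    by (rule jm_poly_bound, rule degree_le) (simp add: coeff_map_poly coeff_eq_0)
  then show ?thesis by (simp add: jm_poly_def of_int_jm_pow coeff_map_poly)
qed

lemma map_poly_residue_poly: "map_poly of_int residue_poly = (residue_poly :: 'a :: comm_ring_1 poly)"
proof -
  have mult: "map_poly of_int (p * p') = (map_poly of_int p * map_poly of_int p' :: 'a poly)" for p p'
    by (intro poly_eqI) (simp add: coeff_map_poly coeff_mult)
  have "map_poly of_int (\<Prod>c\<in>C. [:- of_int (residue_of_col c), 1:]) = (\<Prod>c\<in>C. [:- of_int (residue_of_col c), 1 :: 'a:])" for C
  proof (induction C rule: infinite_finite_induct)
    case (insert c C)
    show ?case unfolding prod.insert[OF insert.hyps] mult insert.IH by (simp add: map_poly_pCons)
  qed simp_all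
  then show ?thesis by (simp add: residue_poly_def)
qed

text \<open>All values involved are images of integers under \<open>of_int\<close>, which is
  injective into the rationals. So the rational identity yields the integral one, and that maps to
  every commutative ring.\<close>

theorem jm_poly_residue_poly: "jm_poly residue_poly e = (\<lambda>_. 0 :: 'a :: comm_ring_1)"
proof
  fix \<tau>
  have "of_int (jm_poly residue_poly e \<tau>) = (0 :: rat)"
    by (simp only: of_int_jm_poly map_poly_residue_poly jm_poly_residue_poly_rat)
  then have "jm_poly residue_poly e \<tau> = (0 :: int)" by simp
  then have "of_int (jm_poly residue_poly e \<tau>) = (0 :: 'a)" by simp
  then show "jm_poly residue_poly e \<tau> = (0 :: 'a)"
    by (simp only: of_int_jm_poly map_poly_residue_poly)
qed

end

section \<open>Quotients of the polynomial ring by split polynomials\<close>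

abbreviation lin_factor :: "'a :: comm_ring_1 \<Rightarrow> 'a poly" where "lin_factor r \<equiv> [:- r, 1:]"

lemma lin_factor_power_mult_dvd:
  fixes p Q :: "'a :: field poly"
  assumes "lin_factor r ^ n dvd p" "Q dvd p" "poly Q r \<noteq> 0"
  shows "lin_factor r ^ n * Q dvd p"
proof (cases "p = 0")
  case False
  from assms(2) obtain k where k: "p = Q * k" by blast
  have "Polynomial.order r p = Polynomial.order r Q + Polynomial.order r k"
    using False unfolding k by (rule Polynomial.order_mult)
  moreover have "Polynomial.order r Q = 0" using assms(3) by (simp add: order_0I)
  ultimately have "lin_factor r ^ n dvd k"
    using assms(1) False by (simp add: order_divides)
  then show ?thesis unfolding k by (simp add: mult.commute mult_dvd_mono)
qed simp

lemma poly_prod_lin_factor: "s \<notin> S \<Longrightarrow> poly (\<Prod>r\<in>S. lin_factor r ^ m r) s \<noteq> (0 :: 'a :: field)"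
  by (induction S rule: infinite_finite_induct) auto

text \<open>Coprimality of the factors enters as nonvanishing of the remaining product at the root
  \<open>r\<close>.\<close>

lemma prod_lin_factor_dvd:
  fixes p :: "'a :: field poly"
  assumes "\<And>r. r \<in> S \<Longrightarrow> lin_factor r ^ m r dvd p"
  shows "(\<Prod>r\<in>S. lin_factor r ^ m r) dvd p"
  using assms
proof (induction S rule: infinite_finite_induct)
  case (insert r S)
  then show ?case using lin_factor_power_mult_dvd[of r "m r" p "\<Prod>r\<in>S. lin_factor r ^ m r"] poly_prod_lin_factor[of r S m]
    by simp
qed simp_all

text \<open>Up to a scalar, \<open>x = 1 - u\<close> with \<open>u r = 0\<close>, and the geometric series in \<open>u\<close> gives an inverse.\<close>

lemma unit_mod_lin_factor_power:
  fixes x :: "'a :: field poly"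
  assumes "poly x r \<noteq> 0"
  obtains y where "lin_factor r ^ n dvd 1 - x * y"
proof -
  define u where "u = 1 - Polynomial.smult (1 / poly x r) x"
  have "lin_factor r dvd u" using assms by (simp add: u_def poly_eq_0_iff_dvd[symmetric])
  then have d: "lin_factor r ^ n dvd u ^ n" by (rule dvd_power_same)
  have "1 - u ^ n = (1 - u) * (\<Sum>i<n. u ^ i)" by (rule one_diff_power_eq)
  also have "1 - u = x * [:1 / poly x r:]" by (simp add: u_def)
  finally have "u ^ n = 1 - x * ([:1 / poly x r:] * (\<Sum>i<n. u ^ i))" by (simp only: mult.assoc diff_eq_eq eq_diff_eq) (simp only: add.commute)
  with d have "lin_factor r ^ n dvd 1 - x * ([:1 / poly x r:] * (\<Sum>i<n. u ^ i))" by (simp only:)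
  then show ?thesis by (rule that)
qed

lemma pcompose_pow: "pcompose (p ^ n) q = pcompose p q ^ n" for p q :: "'a :: comm_semiring_1 poly"
  by (induction n) (simp_all add: pcompose_1 pcompose_mult)

text \<open>Substituting \<open>x + r\<close> for \<open>x\<close> moves the root \<open>r\<close>
  to 0, and substituting \<open>x - r\<close> undoes this.\<close>

lemma lin_factor_power_dvd_iff:
  fixes p :: "'a :: field poly"
  shows "lin_factor r ^ n dvd p \<longleftrightarrow> monom 1 n dvd pcompose p [:r, 1:]"
proof -
  have shift: "pcompose (lin_factor r ^ n) [:r, 1:] = monom 1 n"
    by (simp add: pcompose_pow pcompose_pCons monom_altdef)
  have unshift: "pcompose (pcompose p [:r, 1:]) [:- r, 1:] = p" for p :: "'a poly"
    by (simp add: pcompose_assoc[symmetric] pcompose_pCons)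
  show ?thesis
  proof
    assume "lin_factor r ^ n dvd p"
    then show "monom 1 n dvd pcompose p [:r, 1:]" by (auto simp: pcompose_mult shift elim!: dvdE)
  next
    assume "monom 1 n dvd pcompose p [:r, 1:]"
    then obtain k where "pcompose p [:r, 1:] = pcompose (lin_factor r ^ n) [:r, 1:] * k" by (auto simp: shift elim!: dvdE)
    then have "p = lin_factor r ^ n * pcompose k [:- r, 1:]" by (metis unshift pcompose_mult)
    then show "lin_factor r ^ n dvd p" by (rule dvdI)
  qed
qed

section \<open>Cosets in the truncated polynomial algebra\<close>

definition monom_coset :: "nat \<Rightarrow> 'a :: field poly \<Rightarrow> 'a poly set" where
  "monom_coset n p = {p'. monom 1 n dvd p' - p}"

lemma monom_coset_eq: "monom_coset n p = monom_coset n p' \<longleftrightarrow> monom 1 n dvd p - p'"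
proof
  assume "monom_coset n p = monom_coset n p'"
  moreover have "p \<in> monom_coset n p" by (simp add: monom_coset_def)
  ultimately show "monom 1 n dvd p - p'" by (simp add: monom_coset_def)
next
  assume d: "monom 1 n dvd p - p'"
  have "monom 1 n dvd x - p \<longleftrightarrow> monom 1 n dvd x - p'" for x
    using dvd_add_left_iff[OF d, of "x - p"] by simp
  then show "monom_coset n p = monom_coset n p'" by (simp add: monom_coset_def)
qed

lemma cring_poly_algebra: "cring (poly_algebra :: ('a :: field, 'a poly) module)"
proof (rule cringI)
  show "abelian_group (poly_algebra :: ('a, 'a poly) module)"
    by (rule abelian_groupI) (auto simp: poly_algebra_def algebra_simps intro: exI[of _ "- _"])
  show "comm_monoid (poly_algebra :: ('a, 'a poly) module)"
    by (rule comm_monoidI) (auto simp: poly_algebra_def algebra_simps)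
qed (simp add: poly_algebra_def algebra_simps)

lemma PIdl_monom: "PIdl\<^bsub>poly_algebra\<^esub> (monom 1 n :: 'a :: field poly) = {p. monom 1 n dvd p}"
  by (auto simp: cgenideal_def poly_algebra_def elim!: dvdE)

lemma poly_coset: "{p. monom 1 n dvd p} +>\<^bsub>poly_algebra\<^esub> p = monom_coset n (p :: 'a :: field poly)"
proof
  show "monom_coset n p \<subseteq> {p. monom 1 n dvd p} +>\<^bsub>poly_algebra\<^esub> p"
  proof
    fix x assume "x \<in> monom_coset n p"
    then show "x \<in> {p. monom 1 n dvd p} +>\<^bsub>poly_algebra\<^esub> p"
      unfolding a_r_coset_def' by (intro UN_I[of "x - p"]) (auto simp: monom_coset_def poly_algebra_def)
  qed
qed (auto simp: a_r_coset_def' monom_coset_def poly_algebra_def)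

lemma trunc_poly_simps:
  fixes p p' :: "'a :: field poly"
  shows "carrier (trunc_poly_algebra n :: ('a, 'a poly set) module) = range (monom_coset n)"
    and "monom_coset n p \<otimes>\<^bsub>trunc_poly_algebra n\<^esub> monom_coset n p' = monom_coset n (p * p')"
    and "monom_coset n p \<oplus>\<^bsub>trunc_poly_algebra n\<^esub> monom_coset n p' = monom_coset n (p + p')"
    and "\<one>\<^bsub>trunc_poly_algebra n\<^esub> = monom_coset n (1 :: 'a poly)"
    and "c \<odot>\<^bsub>trunc_poly_algebra n\<^esub> monom_coset n p = monom_coset n (Polynomial.smult c p)"
proof -
  let ?P = "poly_algebra :: ('a, 'a poly) module"
  let ?I = "{p :: 'a poly. monom 1 n dvd p}"
  interpret P: cring ?P by (rule cring_poly_algebra)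
  interpret I: ideal ?I ?P
    unfolding PIdl_monom[symmetric] by (rule P.cgenideal_ideal) (simp add: poly_algebra_def)
  have cp: "p \<in> carrier ?P" for p by (simp add: poly_algebra_def)
  note defs = trunc_poly_algebra_def quotient_def PIdl_monom FactRing_def ring.defs poly_coset
  show "carrier (trunc_poly_algebra n :: ('a, 'a poly set) module) = range (monom_coset n)"
    by (simp add: defs A_RCOSETS_def') (auto simp: poly_algebra_def)
  show "monom_coset n p \<otimes>\<^bsub>trunc_poly_algebra n\<^esub> monom_coset n p' = monom_coset n (p * p')"
    using I.rcoset_mult_add[OF cp cp, of p p'] by (simp add: defs) (simp add: poly_algebra_def)
  show "monom_coset n p \<oplus>\<^bsub>trunc_poly_algebra n\<^esub> monom_coset n p' = monom_coset n (p + p')"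
    using I.a_rcos_sum[OF cp cp, of p p'] by (simp add: defs) (simp add: poly_algebra_def)
  show "\<one>\<^bsub>trunc_poly_algebra n\<^esub> = monom_coset n (1 :: 'a poly)"
    by (simp add: defs) (simp add: poly_algebra_def)
  \<comment> \<open>In a quotient the scalar multiple is a union over all representatives, which
    give one and the same coset.\<close>
  have "monom_coset n (Polynomial.smult c x) = monom_coset n (Polynomial.smult c p)" if "x \<in> monom_coset n p" for x
    using that by (simp add: monom_coset_eq flip: smult_diff_right) (simp add: monom_coset_def dvd_smult)
  then have "(\<Union>x\<in>monom_coset n p. monom_coset n (Polynomial.smult c x)) = (\<Union>x\<in>monom_coset n p. monom_coset n (Polynomial.smult c p))"
    by (rule SUP_cong[OF refl])
  also have "\<dots> = monom_coset n (Polynomial.smult c p)"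
  proof -
    have "monom_coset n p \<noteq> {}" by (auto simp: monom_coset_def intro: exI[of _ p])
    then show ?thesis by simp
  qed
  finally show "c \<odot>\<^bsub>trunc_poly_algebra n\<^esub> monom_coset n p = monom_coset n (Polynomial.smult c p)"
    by (simp add: defs) (simp only: poly_algebra_def module.select_convs)
qed

text \<open>\<open>h\<close> presents \<open>A\<close> as the polynomial ring modulo the product of
  the powers \<open>lin_factor r ^ m r\<close>, and elements of \<open>A\<close> are handled through
  polynomial representatives. Positive exponents keep the component at each \<open>r\<close>
  nonzero.\<close>

locale split_quotient =
  fixes A :: "('a :: field, 'b) module" and h :: "'a poly \<Rightarrow> 'b" and R :: "'a set" and m :: "'a \<Rightarrow> nat"
  assumes carrier: "carrier A = range h"
    and h_add: "h p \<oplus>\<^bsub>A\<^esub> h p' = h (p + p')"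
    and h_mult: "h p \<otimes>\<^bsub>A\<^esub> h p' = h (p * p')"
    and h_zero: "\<zero>\<^bsub>A\<^esub> = h 0" and h_one: "\<one>\<^bsub>A\<^esub> = h 1"
    and h_smult: "c \<odot>\<^bsub>A\<^esub> h p = h (Polynomial.smult c p)"
    and h_eq: "h p = h p' \<longleftrightarrow> (\<Prod>r\<in>R. lin_factor r ^ m r) dvd p - p'"
    and finite_R: "finite R" and m_pos: "r \<in> R \<Longrightarrow> 1 \<le> m r"
begin

lemma h_closed: "h p \<in> carrier A" by (simp add: carrier)

lemma h_eq': "h p = h p' \<longleftrightarrow> (\<forall>r\<in>R. lin_factor r ^ m r dvd p - p')"
  unfolding h_eq using prod_lin_factor_dvd[of R m "p - p'"] dvd_trans[OF dvd_prodI[OF finite_R]] by blast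

lemma h_eq_0: "h p = h 0 \<longleftrightarrow> (\<forall>r\<in>R. lin_factor r ^ m r dvd p)"
  using h_eq'[of p 0] by simp

lemma ring_A: "cring A"
proof (rule cringI)
  have cl: "\<exists>p. x = h p" if "x \<in> carrier A" for x using that by (auto simp: carrier)
  show "abelian_group A"
  proof (rule abelian_groupI)
    fix x assume "x \<in> carrier A"
    then obtain p where "x = h p" using cl by blast
    then have "h (- p) \<oplus>\<^bsub>A\<^esub> x = \<zero>\<^bsub>A\<^esub>" by (simp add: h_add h_zero)
    then show "\<exists>y\<in>carrier A. y \<oplus>\<^bsub>A\<^esub> x = \<zero>\<^bsub>A\<^esub>" using h_closed by blast
  qed (auto simp: h_add h_zero h_closed algebra_simps dest!: cl)
  show "comm_monoid A"
    by (rule comm_monoidI) (auto simp: h_mult h_one h_closed algebra_simps dest!: cl)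
  show "(x \<oplus>\<^bsub>A\<^esub> y) \<otimes>\<^bsub>A\<^esub> z = x \<otimes>\<^bsub>A\<^esub> z \<oplus>\<^bsub>A\<^esub> y \<otimes>\<^bsub>A\<^esub> z"
    if "x \<in> carrier A" "y \<in> carrier A" "z \<in> carrier A" for x y z
    using cl[OF that(1)] cl[OF that(2)] cl[OF that(3)] by (auto simp: h_add h_mult algebra_simps)
qed

sublocale cring A by (rule ring_A)

lemma h_minus: "\<ominus>\<^bsub>A\<^esub> h p = h (- p)"
  by (rule minus_equality) (simp_all add: h_add h_zero h_closed)

lemma obtain_h:
  assumes "x \<in> carrier A" obtains p where "x = h p"
  using assms by (auto simp: carrier)

text \<open>Its multiples are the representatives that vanish in every component except possibly the
  one at \<open>r\<close>.\<close>

definition cofactor :: "'a \<Rightarrow> 'a poly" where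
  "cofactor r = (\<Prod>s\<in>R - {r}. lin_factor s ^ m s)"

lemma cofactor_dvd_iff: "cofactor r dvd p \<longleftrightarrow> (\<forall>s\<in>R - {r}. lin_factor s ^ m s dvd p)"
  unfolding cofactor_def
  using prod_lin_factor_dvd[of "R - {r}" m p] dvd_trans[OF dvd_prodI[of "R - {r}"]] finite_R by blast

text \<open>The cofactor does not vanish at \<open>r\<close>, so it is invertible modulo
  \<open>lin_factor r ^ m r\<close>, and a multiple of it is congruent to 1 there. This represents
  the idempotent of the component at \<open>r\<close>.\<close>

lemma ex_idem: "\<exists>p. cofactor r dvd p \<and> lin_factor r ^ m r dvd 1 - p"
proof -
  have "poly (cofactor r) r \<noteq> 0" unfolding cofactor_def by (rule poly_prod_lin_factor) simp
  from unit_mod_lin_factor_power[OF this, of "m r"] show ?thesis by (metis dvd_triv_left)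
qed

definition idem :: "'a \<Rightarrow> 'a poly" where
  "idem r = (SOME p. cofactor r dvd p \<and> lin_factor r ^ m r dvd 1 - p)"

lemma idem: "cofactor r dvd idem r" "lin_factor r ^ m r dvd 1 - idem r"
  using someI_ex[OF ex_idem, of r] by (simp_all add: idem_def)

lemma idem_other: "s \<in> R \<Longrightarrow> s \<noteq> r \<Longrightarrow> lin_factor s ^ m s dvd idem r"
  using idem(1)[of r] by (simp add: cofactor_dvd_iff)

lemma idem_mult_same: "lin_factor r ^ m r dvd idem r * p - p"
proof -
  have "idem r * p - p = (1 - idem r) * (- p)" by (simp add: algebra_simps)
  then show ?thesis using idem(2)[of r] by simp
qed

lemma poly_eq_of_dvd: "r \<in> R \<Longrightarrow> lin_factor r ^ m r dvd p - p' \<Longrightarrow> poly p r = poly p' r"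
proof -
  assume r: "r \<in> R" and d: "lin_factor r ^ m r dvd p - p'"
  have "lin_factor r dvd lin_factor r ^ m r" using m_pos[OF r] by (simp add: dvd_power)
  then have "lin_factor r dvd p - p'" using d dvd_trans by blast
  then show ?thesis by (simp add: poly_eq_0_iff_dvd[symmetric])
qed

lemma idem_h: "cofactor r dvd p \<Longrightarrow> h (idem r * p) = h p"
  unfolding h_eq'
proof
  fix s assume "cofactor r dvd p" "s \<in> R"
  then show "lin_factor s ^ m s dvd idem r * p - p"
    using idem_mult_same[of r p] by (cases "s = r") (auto simp: cofactor_dvd_iff intro: dvd_diff)
qed

section \<open>The component at a residue, its complement, and the classification of blocks\<close>

definition E :: "'a \<Rightarrow> 'b set" where "E r = h ` {p. cofactor r dvd p}"
definition E' :: "'a \<Rightarrow> 'b set" where "E' r = h ` {p. lin_factor r ^ m r dvd p}"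

lemma h_in_E: "h p \<in> E r \<longleftrightarrow> cofactor r dvd p"
proof
  assume "h p \<in> E r"
  then obtain p' where "cofactor r dvd p'" "h p = h p'" by (auto simp: E_def)
  then show "cofactor r dvd p" unfolding h_eq' cofactor_dvd_iff by (metis DiffD1 dvd_diff_right_iff dvd_diff_commute)
qed (auto simp: E_def)

lemma h_in_E': "r \<in> R \<Longrightarrow> h p \<in> E' r \<longleftrightarrow> lin_factor r ^ m r dvd p"
proof
  assume r: "r \<in> R" and "h p \<in> E' r"
  then obtain p' where "lin_factor r ^ m r dvd p'" "h p = h p'" by (auto simp: E'_def)
  moreover from this r have "lin_factor r ^ m r dvd p - p'" unfolding h_eq' by blast
  ultimately have "lin_factor r ^ m r dvd (p - p') + p'" by (rule_tac dvd_add)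
  then show "lin_factor r ^ m r dvd p" by simp
qed (auto simp: E'_def)

lemma ideal_dvd: "ideal (h ` {p. d dvd p}) A"
proof (rule idealI)
  show "ring A" by (rule cring.axioms(1)[OF ring_A])
  show "subgroup (h ` {p. d dvd p}) (add_monoid A)"
  proof (rule add.subgroupI)
    show "h ` {p. d dvd p} \<subseteq> carrier A" using h_closed by blast
    show "h ` {p. d dvd p} \<noteq> {}" using dvd_0_right by blast
    show "\<ominus>\<^bsub>A\<^esub> x \<in> h ` {p. d dvd p}" if "x \<in> h ` {p. d dvd p}" for x using that by (auto simp: h_minus)
    show "x \<oplus>\<^bsub>A\<^esub> y \<in> h ` {p. d dvd p}" if "x \<in> h ` {p. d dvd p}" "y \<in> h ` {p. d dvd p}" for x y
      using that by (auto simp: h_add)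
  qed
  fix a x assume "a \<in> h ` {p. d dvd p}" "x \<in> carrier A"
  then obtain p p' where "a = h p" "d dvd p" "x = h p'" by (auto simp: carrier)
  then show "x \<otimes>\<^bsub>A\<^esub> a \<in> h ` {p. d dvd p}" "a \<otimes>\<^bsub>A\<^esub> x \<in> h ` {p. d dvd p}" by (auto simp: h_mult)
qed

lemma ideal_E: "ideal (E r) A" and ideal_E': "ideal (E' r) A"
  unfolding E_def E'_def by (rule ideal_dvd)+

lemma E_subset: "E r \<subseteq> carrier A" using h_closed by (auto simp: E_def)

lemma E_Int_E': "r \<in> R \<Longrightarrow> E r \<inter> E' r = {\<zero>\<^bsub>A\<^esub>}"
proof
  assume r: "r \<in> R"
  show "E r \<inter> E' r \<subseteq> {\<zero>\<^bsub>A\<^esub>}"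
  proof
    fix x assume x: "x \<in> E r \<inter> E' r"
    then obtain p where p: "x = h p" by (auto simp: E_def)
    then have "cofactor r dvd p" "lin_factor r ^ m r dvd p" using x r h_in_E h_in_E' by auto
    then have "h p = h 0" unfolding h_eq_0 cofactor_dvd_iff by blast
    then show "x \<in> {\<zero>\<^bsub>A\<^esub>}" by (simp add: p h_zero)
  qed
  show "{\<zero>\<^bsub>A\<^esub>} \<subseteq> E r \<inter> E' r" using r by (simp add: h_zero h_in_E h_in_E')
qed

lemma in_set_add: "x \<in> I <+>\<^bsub>A\<^esub> J \<longleftrightarrow> (\<exists>i\<in>I. \<exists>j\<in>J. x = i \<oplus>\<^bsub>A\<^esub> j)"
  by (auto simp: set_add_def')

lemma decompose: "h p = h (idem r * p) \<oplus>\<^bsub>A\<^esub> h ((1 - idem r) * p)"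
  by (simp add: h_add algebra_simps)

lemma idem_part: "h (idem r * p) \<in> E r" "h ((1 - idem r) * p) \<in> E' r"
  using idem[of r] by (auto simp: E_def E'_def)

text \<open>Multiplication by an idempotent or by its complement stays inside every ideal, so every
  ideal splits along the idempotent.\<close>

lemma direct_sum_E:
  assumes B: "ideal B A" and r: "r \<in> R"
  shows "ideal_direct_sum A B (B \<inter> E r) (B \<inter> E' r)"
proof -
  interpret B: ideal B A by (rule B)
  have "(B \<inter> E r) \<inter> (B \<inter> E' r) = {\<zero>\<^bsub>A\<^esub>}" using E_Int_E'[OF r] B.zero_closed by blast
  moreover have "(B \<inter> E r) <+>\<^bsub>A\<^esub> (B \<inter> E' r) = B"
  proof
    show "(B \<inter> E r) <+>\<^bsub>A\<^esub> (B \<inter> E' r) \<subseteq> B" by (auto simp: in_set_add B.a_closed)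
    show "B \<subseteq> (B \<inter> E r) <+>\<^bsub>A\<^esub> (B \<inter> E' r)"
    proof
      fix x assume x: "x \<in> B"
      then obtain p where p: "x = h p" using B.a_subset by (auto simp: carrier)
      have "h (idem r * p) \<in> B" "h ((1 - idem r) * p) \<in> B"
        using B.I_l_closed[of x "h (idem r)"] B.I_l_closed[of x "h (1 - idem r)"] x h_closed by (auto simp: p h_mult)
      then show "x \<in> (B \<inter> E r) <+>\<^bsub>A\<^esub> (B \<inter> E' r)"
        using idem_part decompose[of p r] unfolding in_set_add p by blast
    qed
  qed
  ultimately show ?thesis using i_intersect[OF B ideal_E] i_intersect[OF B ideal_E'] by (simp add: ideal_direct_sum_def)
qed

lemma idem_in_E: "h (idem r) \<in> E r"
  using idem by (simp add: h_in_E)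

lemma E_nonzero: "r \<in> R \<Longrightarrow> E r \<noteq> {\<zero>\<^bsub>A\<^esub>}"
proof
  assume r: "r \<in> R" and "E r = {\<zero>\<^bsub>A\<^esub>}"
  then have "h (idem r) = h 0" using idem_in_E[of r] by (simp add: h_zero)
  then have "lin_factor r ^ m r dvd idem r - 0" using r unfolding h_eq' by blast
  then have "poly (idem r) r = 0" using poly_eq_of_dvd[OF r, of "idem r" 0] by simp
  moreover have "poly 1 r = poly (idem r) r" by (rule poly_eq_of_dvd[OF r idem(2)])
  ultimately show False by simp
qed

text \<open>A polynomial that does not vanish at \<open>r\<close> is a unit modulo
  \<open>lin_factor r ^ m r\<close>: the component is a local ring.\<close>

lemma E_local:
  assumes r: "r \<in> R" and J: "ideal J A" "J \<subseteq> E r" and p: "h p \<in> J" "poly p r \<noteq> 0"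
  shows "J = E r"
proof
  interpret J: ideal J A by (rule J)
  from unit_mod_lin_factor_power[OF p(2), of "m r"] obtain y where y: "lin_factor r ^ m r dvd 1 - p * y" .
  show "E r \<subseteq> J"
  proof
    fix x assume "x \<in> E r"
    then obtain p' where p': "x = h p'" "cofactor r dvd p'" by (auto simp: E_def)
    have "lin_factor s ^ m s dvd p' - p * (y * p')" if "s \<in> R" for s
    proof (cases "s = r")
      case True
      have "p' - p * (y * p') = (1 - p * y) * p'" by (simp add: algebra_simps)
      then show ?thesis using y True by simp
    next
      case False
      then have "lin_factor s ^ m s dvd p'" using p'(2) that by (simp add: cofactor_dvd_iff)
      then show ?thesis by simp
    qed
    then have "x = h (p * (y * p'))" unfolding p'(1) h_eq' by blast
    then show "x \<in> J" using J.I_r_closed[OF p(1) h_closed[of "y * p'"]] by (simp add: h_mult)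
  qed
qed (rule J)

text \<open>The identity of the component takes the value 1 at \<open>r\<close>, so one of its two
  parts does not vanish at \<open>r\<close>, and by \<open>E_local\<close> the ideal containing that
  part is everything.\<close>

lemma E_indecomposable:
  assumes r: "r \<in> R" and ds: "ideal_direct_sum A (E r) J K"
  shows "J = {\<zero>\<^bsub>A\<^esub>} \<or> K = {\<zero>\<^bsub>A\<^esub>}"
proof -
  interpret J: ideal J A using ds by (simp add: ideal_direct_sum_def)
  interpret K: ideal K A using ds by (simp add: ideal_direct_sum_def)
  have JK: "J \<inter> K = {\<zero>\<^bsub>A\<^esub>}" "J <+>\<^bsub>A\<^esub> K = E r" using ds by (auto simp: ideal_direct_sum_def)
  have JE: "J \<subseteq> E r"
  proof
    fix x assume x: "x \<in> J"
    then have "x = x \<oplus>\<^bsub>A\<^esub> \<zero>\<^bsub>A\<^esub>" using J.a_subset by auto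
    then show "x \<in> E r" using x K.zero_closed unfolding JK(2)[symmetric] in_set_add by blast
  qed
  have KE: "K \<subseteq> E r"
  proof
    fix x assume x: "x \<in> K"
    then have "x = \<zero>\<^bsub>A\<^esub> \<oplus>\<^bsub>A\<^esub> x" using K.a_subset by auto
    then show "x \<in> E r" using x J.zero_closed unfolding JK(2)[symmetric] in_set_add by blast
  qed
  obtain j k where jk: "j \<in> J" "k \<in> K" "h (idem r) = j \<oplus>\<^bsub>A\<^esub> k"
    using idem_in_E[of r] unfolding JK(2)[symmetric] in_set_add by blast
  obtain x y where xy: "j = h x" "k = h y" using jk J.a_subset K.a_subset by (metis obtain_h subsetD)
  have "lin_factor r ^ m r dvd idem r - (x + y)" using jk(3) r unfolding xy h_add h_eq' by blast
  then have "poly (idem r) r = poly (x + y) r" by (rule poly_eq_of_dvd[OF r])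
  moreover have "poly 1 r = poly (idem r) r" by (rule poly_eq_of_dvd[OF r idem(2)])
  ultimately consider "poly x r \<noteq> 0" | "poly y r \<noteq> 0" by (metis add_0 poly_1 poly_add zero_neq_one)
  then show ?thesis
  proof cases
    case 1
    then have "J = E r" using jk xy by (intro E_local[OF r J.ideal_axioms JE, of x]) auto
    then show ?thesis using JK(1) KE by blast
  next
    case 2
    then have "K = E r" using jk xy by (intro E_local[OF r K.ideal_axioms KE, of y]) auto
    then show ?thesis using JK(1) JE by blast
  qed
qed

lemma E_in_blocks:
  assumes r: "r \<in> R" shows "E r \<in> blocks A"
proof -
  have "ideal_direct_sum A (carrier A) (carrier A \<inter> E r) (carrier A \<inter> E' r)"
    by (rule direct_sum_E[OF oneideal r])
  moreover have "carrier A \<inter> E r = E r" "carrier A \<inter> E' r = E' r" using E_subset h_closed by (auto simp: E'_def)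
  ultimately show ?thesis
    using E_indecomposable[OF r] E_nonzero[OF r] ideal_E unfolding blocks_def by auto
qed

text \<open>A block has a nonzero component at some \<open>r\<close>. Being indecomposable it then
  lies inside \<open>E r\<close>, where it is again a direct summand, and \<open>E r\<close> is
  indecomposable too.\<close>

lemma blocks_eq: "blocks A = E ` R"
proof
  show "E ` R \<subseteq> blocks A" using E_in_blocks by blast
  show "blocks A \<subseteq> E ` R"
  proof
    fix B assume "B \<in> blocks A"
    then obtain D where B: "ideal B A" "B \<noteq> {\<zero>\<^bsub>A\<^esub>}" and D: "ideal_direct_sum A (carrier A) B D"
      and indec: "\<And>J K. ideal_direct_sum A B J K \<Longrightarrow> J = {\<zero>\<^bsub>A\<^esub>} \<or> K = {\<zero>\<^bsub>A\<^esub>}"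
      unfolding blocks_def by blast
    interpret B: ideal B A by (rule B)
    interpret D: ideal D A using D by (simp add: ideal_direct_sum_def)
    obtain x where x: "x \<in> B" "x \<noteq> \<zero>\<^bsub>A\<^esub>" using B(2) B.zero_closed by blast
    then obtain p where p: "x = h p" using B.a_subset by (auto simp: carrier)
    then have "h p \<noteq> h 0" using x by (simp add: h_zero)
    then obtain r where r: "r \<in> R" "\<not> lin_factor r ^ m r dvd p" unfolding h_eq_0 by blast
    have "h (idem r * p) \<noteq> h 0"
    proof
      assume "h (idem r * p) = h 0"
      then have "lin_factor r ^ m r dvd idem r * p" using r unfolding h_eq_0 by blast
      then have "lin_factor r ^ m r dvd idem r * p - (idem r * p - p)" using idem_mult_same by (rule dvd_diff)
      then show False using r by simp
    qed
    moreover have "h (idem r * p) \<in> B \<inter> E r"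
      using B.I_l_closed[OF x(1) h_closed[of "idem r"]] idem_part by (simp add: p h_mult)
    ultimately have "B \<inter> E r \<noteq> {\<zero>\<^bsub>A\<^esub>}" by (auto simp: h_zero)
    then have E': "B \<inter> E' r = {\<zero>\<^bsub>A\<^esub>}" using indec[OF direct_sum_E[OF B(1) r(1)]] by blast
    have "B \<subseteq> E r"
    proof
      fix x assume "x \<in> B"
      then have "x \<in> (B \<inter> E r) <+>\<^bsub>A\<^esub> (B \<inter> E' r)"
        using direct_sum_E[OF B(1) r(1)] by (simp add: ideal_direct_sum_def)
      then obtain i where "i \<in> B \<inter> E r" "x = i \<oplus>\<^bsub>A\<^esub> \<zero>\<^bsub>A\<^esub>" unfolding E' in_set_add by blast
      then show "x \<in> E r" using B.a_subset by auto
    qed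
    \<comment> \<open>The modular law, applicable since \<open>B\<close> lies in
      \<open>E r\<close>.\<close>
    have "ideal_direct_sum A (E r) B (D \<inter> E r)"
      unfolding ideal_direct_sum_def
    proof (intro conjI)
      show "ideal B A" by fact
      show "ideal (D \<inter> E r) A" by (rule i_intersect[OF D.ideal_axioms ideal_E])
      interpret E: ideal "E r" A by (rule ideal_E)
      show "B \<inter> (D \<inter> E r) = {\<zero>\<^bsub>A\<^esub>}"
        using D E.zero_closed unfolding ideal_direct_sum_def by blast
      show "B <+>\<^bsub>A\<^esub> (D \<inter> E r) = E r"
      proof
        show "B <+>\<^bsub>A\<^esub> (D \<inter> E r) \<subseteq> E r" using \<open>B \<subseteq> E r\<close> by (auto simp: in_set_add intro!: E.a_closed)
        show "E r \<subseteq> B <+>\<^bsub>A\<^esub> (D \<inter> E r)"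
        proof
          fix x assume x: "x \<in> E r"
          then have "x \<in> B <+>\<^bsub>A\<^esub> D" using D E_subset by (auto simp: ideal_direct_sum_def)
          then obtain b d where bd: "b \<in> B" "d \<in> D" "x = b \<oplus>\<^bsub>A\<^esub> d" unfolding in_set_add by blast
          have "b \<in> carrier A" "d \<in> carrier A" using bd B.a_subset D.a_subset by auto
          then have "d = \<ominus>\<^bsub>A\<^esub> b \<oplus>\<^bsub>A\<^esub> x" unfolding bd(3) by (simp add: a_assoc[symmetric] l_neg)
          moreover have "b \<in> E r" using bd \<open>B \<subseteq> E r\<close> by blast
          ultimately have "d \<in> E r" using x by (simp add: E.a_inv_closed)
          then show "x \<in> B <+>\<^bsub>A\<^esub> (D \<inter> E r)" using bd unfolding in_set_add by blast
        qed
      qed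
    qed
    from E_indecomposable[OF r(1) this] B(2) have D0: "D \<inter> E r = {\<zero>\<^bsub>A\<^esub>}" by blast
    have "E r \<subseteq> B"
    proof
      fix x assume "x \<in> E r"
      then have "x \<in> B <+>\<^bsub>A\<^esub> {\<zero>\<^bsub>A\<^esub>}"
        using \<open>ideal_direct_sum A (E r) B (D \<inter> E r)\<close> unfolding D0 by (simp add: ideal_direct_sum_def)
      then obtain b where "b \<in> B" "x = b \<oplus>\<^bsub>A\<^esub> \<zero>\<^bsub>A\<^esub>" unfolding in_set_add by blast
      then show "x \<in> B" using B.a_subset by auto
    qed
    then show "B \<in> E ` R" using \<open>B \<subseteq> E r\<close> r by blast
  qed
qed

lemma inj_E: "inj_on E R"
proof (rule inj_onI, rule ccontr)
  fix r s assume rs: "r \<in> R" "s \<in> R" "E r = E s" "r \<noteq> s"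
  then have "h (idem r) \<in> E s" using idem_in_E by blast
  then have "lin_factor r ^ m r dvd idem r - 0" using rs by (simp add: h_in_E cofactor_dvd_iff)
  then have "poly (idem r) r = poly 0 r" by (rule poly_eq_of_dvd[OF rs(1)])
  moreover have "poly 1 r = poly (idem r) r" by (rule poly_eq_of_dvd[OF rs(1) idem(2)])
  ultimately show False by simp
qed

lemma bij_E: "bij_betw E R (blocks A)"
  using inj_E blocks_eq by (simp add: bij_betw_def)

section \<open>The blocks as algebras\<close>

abbreviation Bl :: "'a \<Rightarrow> ('a, 'b) module" where "Bl r \<equiv> block_algebra A (E r)"

lemma block_one: "r \<in> R \<Longrightarrow> \<one>\<^bsub>Bl r\<^esub> = h (idem r)"
proof -
  assume r: "r \<in> R"
  have id: "h (idem r) \<otimes>\<^bsub>A\<^esub> x = x" "x \<otimes>\<^bsub>A\<^esub> h (idem r) = x" if "x \<in> E r" for x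
    using that idem_h by (auto simp: E_def h_mult mult.commute)
  have "(THE e. e \<in> E r \<and> (\<forall>x\<in>E r. e \<otimes>\<^bsub>A\<^esub> x = x \<and> x \<otimes>\<^bsub>A\<^esub> e = x)) = h (idem r)"
    using id idem_in_E by (intro the_equality) (auto, metis)
  then show ?thesis by (simp add: block_algebra_def)
qed

lemma block_simps: "carrier (Bl r) = E r" "x \<otimes>\<^bsub>Bl r\<^esub> y = x \<otimes>\<^bsub>A\<^esub> y" "x \<oplus>\<^bsub>Bl r\<^esub> y = x \<oplus>\<^bsub>A\<^esub> y"
  "\<zero>\<^bsub>Bl r\<^esub> = \<zero>\<^bsub>A\<^esub>" "c \<odot>\<^bsub>Bl r\<^esub> x = c \<odot>\<^bsub>A\<^esub> x"
  by (simp_all add: block_algebra_def)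

lemma block_carrier: "carrier (Bl r) = h ` {p. cofactor r dvd p}"
  unfolding block_simps(1) by (rule E_def)

lemma finsum_h: "finite I \<Longrightarrow> (\<Oplus>\<^bsub>A\<^esub> i\<in>I. h (p i)) = h (\<Sum>i\<in>I. p i)"
proof (induction I rule: finite_induct)
  case (insert i I)
  then show ?case using h_closed by (simp add: finsum_insert h_add)
qed (simp add: h_zero)

text \<open>The Chinese remainder theorem. Modulo \<open>lin_factor t ^ m t\<close> a sum of
  components reduces to its summand at \<open>t\<close>, and every identity is checked at one
  residue at a time.\<close>

lemma product_iso: "(\<lambda>x. \<Oplus>\<^bsub>A\<^esub> r\<in>R. x r) \<in> alg_iso (prod_algebra R Bl) A"
proof -
  let ?P = "prod_algebra R Bl" and ?f = "\<lambda>x. \<Oplus>\<^bsub>A\<^esub> r\<in>R. x r"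
  have rep: "\<exists>p. (\<forall>r\<in>R. x r = h (p r) \<and> cofactor r dvd p r) \<and> x \<in> extensional R" if "x \<in> carrier ?P" for x
  proof -
    have x: "x r \<in> E r" if "r \<in> R" for r
      using \<open>x \<in> carrier ?P\<close> that by (auto simp: prod_algebra_def block_simps)
    have "\<forall>r\<in>R. \<exists>p. x r = h p \<and> cofactor r dvd p"
      using x by (auto simp: E_def image_iff)
    from bchoice[OF this] have "\<exists>p. \<forall>r\<in>R. x r = h (p r) \<and> cofactor r dvd p r" .
    moreover have "x \<in> extensional R" using that by (auto simp: prod_algebra_def PiE_def)
    ultimately show ?thesis by blast
  qed
  have f_h: "?f x = h (\<Sum>r\<in>R. p r)" if "\<And>r. r \<in> R \<Longrightarrow> x r = h (p r)" for x p
  proof -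
    have "?f x = (\<Oplus>\<^bsub>A\<^esub> r\<in>R. h (p r))" using that h_closed by (intro finsum_cong') auto
    then show ?thesis using finsum_h[OF finite_R] by simp
  qed
  have mod: "lin_factor t ^ m t dvd (\<Sum>r\<in>R. p r) - p t" if "t \<in> R" "\<And>r. r \<in> R \<Longrightarrow> cofactor r dvd p r" for t p
  proof -
    have "(\<Sum>r\<in>R. p r) - p t = (\<Sum>r\<in>R - {t}. p r)" using sum.remove[OF finite_R that(1), of p] by simp
    moreover have "lin_factor t ^ m t dvd (\<Sum>r\<in>R - {t}. p r)"
      using that by (intro dvd_sum) (auto simp: cofactor_dvd_iff)
    ultimately show ?thesis by simp
  qed
  have mult: "?f (x \<otimes>\<^bsub>?P\<^esub> y) = ?f x \<otimes>\<^bsub>A\<^esub> ?f y" if xy: "x \<in> carrier ?P" "y \<in> carrier ?P" for x y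
  proof -
    from rep[OF xy(1)] obtain p where p: "\<And>r. r \<in> R \<Longrightarrow> x r = h (p r)" "\<And>r. r \<in> R \<Longrightarrow> cofactor r dvd p r" by blast
    from rep[OF xy(2)] obtain p' where p': "\<And>r. r \<in> R \<Longrightarrow> y r = h (p' r)" "\<And>r. r \<in> R \<Longrightarrow> cofactor r dvd p' r" by blast
    have "?f (x \<otimes>\<^bsub>?P\<^esub> y) = h (\<Sum>r\<in>R. p r * p' r)"
      by (rule f_h) (simp add: prod_algebra_def block_simps p p' h_mult)
    also have "\<dots> = h ((\<Sum>r\<in>R. p r) * (\<Sum>r\<in>R. p' r))"
      unfolding h_eq'
    proof
      fix t assume t: "t \<in> R"
      have a: "lin_factor t ^ m t dvd (\<Sum>r\<in>R. p r * p' r) - p t * p' t"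
        using p p' by (intro mod[OF t]) auto
      have b: "lin_factor t ^ m t dvd (\<Sum>r\<in>R. p r) - p t" and c: "lin_factor t ^ m t dvd (\<Sum>r\<in>R. p' r) - p' t"
        using mod[OF t] p p' by auto
      have "lin_factor t ^ m t dvd ((\<Sum>r\<in>R. p r * p' r) - p t * p' t)
          - (((\<Sum>r\<in>R. p r) - p t) * (\<Sum>r\<in>R. p' r) + p t * ((\<Sum>r\<in>R. p' r) - p' t))"
        by (rule dvd_diff[OF a dvd_add[OF dvd_mult2[OF b] dvd_mult[OF c]]])
      then show "lin_factor t ^ m t dvd (\<Sum>r\<in>R. p r * p' r) - (\<Sum>r\<in>R. p r) * (\<Sum>r\<in>R. p' r)"
        by (simp add: algebra_simps)
    qed
    also have "\<dots> = ?f x \<otimes>\<^bsub>A\<^esub> ?f y" using f_h[of x p, OF p(1)] f_h[of y p', OF p'(1)] by (simp add: h_mult)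
    finally show ?thesis .
  qed
  have add: "?f (x \<oplus>\<^bsub>?P\<^esub> y) = ?f x \<oplus>\<^bsub>A\<^esub> ?f y" if xy: "x \<in> carrier ?P" "y \<in> carrier ?P" for x y
  proof -
    from rep[OF xy(1)] obtain p where p: "\<And>r. r \<in> R \<Longrightarrow> x r = h (p r)" by blast
    from rep[OF xy(2)] obtain p' where p': "\<And>r. r \<in> R \<Longrightarrow> y r = h (p' r)" by blast
    have "?f (x \<oplus>\<^bsub>?P\<^esub> y) = h (\<Sum>r\<in>R. p r + p' r)"
      by (rule f_h) (simp add: prod_algebra_def block_simps p p' h_add)
    then show ?thesis using f_h[of x p, OF p] f_h[of y p', OF p'] by (simp add: h_add sum.distrib)
  qed
  have one: "?f \<one>\<^bsub>?P\<^esub> = \<one>\<^bsub>A\<^esub>"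
  proof -
    have "?f \<one>\<^bsub>?P\<^esub> = h (\<Sum>r\<in>R. idem r)"
      by (rule f_h) (simp add: prod_algebra_def block_one)
    also have "\<dots> = h 1"
      unfolding h_eq'
    proof
      fix t assume t: "t \<in> R"
      have "lin_factor t ^ m t dvd ((\<Sum>r\<in>R. idem r) - idem t) - (1 - idem t)"
        by (rule dvd_diff[OF mod[OF t] idem(2)]) (rule idem(1))
      then show "lin_factor t ^ m t dvd (\<Sum>r\<in>R. idem r) - 1" by simp
    qed
    finally show ?thesis by (simp add: h_one)
  qed
  have smult: "?f (c \<odot>\<^bsub>?P\<^esub> x) = c \<odot>\<^bsub>A\<^esub> ?f x" if x: "x \<in> carrier ?P" for c x
  proof -
    from rep[OF x] obtain p where p: "\<And>r. r \<in> R \<Longrightarrow> x r = h (p r)" by blast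
    have "?f (c \<odot>\<^bsub>?P\<^esub> x) = h (\<Sum>r\<in>R. Polynomial.smult c (p r))"
      by (rule f_h) (simp add: prod_algebra_def block_simps p h_smult)
    also have "(\<Sum>r\<in>R. Polynomial.smult c (p r)) = Polynomial.smult c (\<Sum>r\<in>R. p r)"
      by (induction R rule: infinite_finite_induct) (simp_all add: smult_add_right)
    finally show ?thesis using f_h[of x p, OF p] by (simp add: h_smult)
  qed
  have closed: "?f x \<in> carrier A" if "x \<in> carrier ?P" for x
    using that E_subset by (intro finsum_closed) (auto simp: prod_algebra_def block_simps)
  have inj: "inj_on ?f (carrier ?P)"
  proof (rule inj_onI)
    fix x y assume xy: "x \<in> carrier ?P" "y \<in> carrier ?P" "?f x = ?f y"
    from rep[OF xy(1)] obtain p where p: "\<And>r. r \<in> R \<Longrightarrow> x r = h (p r)" "\<And>r. r \<in> R \<Longrightarrow> cofactor r dvd p r" "x \<in> extensional R" by blast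
    from rep[OF xy(2)] obtain p' where p': "\<And>r. r \<in> R \<Longrightarrow> y r = h (p' r)" "\<And>r. r \<in> R \<Longrightarrow> cofactor r dvd p' r" "y \<in> extensional R" by blast
    have eq: "h (\<Sum>r\<in>R. p r) = h (\<Sum>r\<in>R. p' r)" using xy(3) f_h[of x p, OF p(1)] f_h[of y p', OF p'(1)] by simp
    have "x t = y t" if t: "t \<in> R" for t
    proof -
      have "h (p t) = h (p' t)"
        unfolding h_eq'
      proof
        fix s assume s: "s \<in> R"
        show "lin_factor s ^ m s dvd p t - p' t"
        proof (cases "s = t")
          case True
          have a: "lin_factor t ^ m t dvd (\<Sum>r\<in>R. p r) - (\<Sum>r\<in>R. p' r)" using eq t unfolding h_eq' by blast
          have b: "lin_factor t ^ m t dvd (\<Sum>r\<in>R. p r) - p t" and c: "lin_factor t ^ m t dvd (\<Sum>r\<in>R. p' r) - p' t"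
            using mod[OF t] p p' by auto
          have "lin_factor t ^ m t dvd ((\<Sum>r\<in>R. p r) - (\<Sum>r\<in>R. p' r)) - ((\<Sum>r\<in>R. p r) - p t) + ((\<Sum>r\<in>R. p' r) - p' t)"
            by (rule dvd_add[OF dvd_diff[OF a b] c])
          then show ?thesis using True by simp
        next
          case False
          then show ?thesis using p(2)[OF t] p'(2)[OF t] s by (auto simp: cofactor_dvd_iff intro: dvd_diff)
        qed
      qed
      then show ?thesis using p p' t by simp
    qed
    then show "x = y" using p(3) p'(3) by (intro extensionalityI) auto
  qed
  have surj: "?f ` carrier ?P = carrier A"
  proof
    show "carrier A \<subseteq> ?f ` carrier ?P"
    proof
      fix y assume "y \<in> carrier A"
      then obtain p where y: "y = h p" by (rule obtain_h)
      let ?x = "\<lambda>r\<in>R. h (idem r * p)"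
      have "?x \<in> carrier ?P" using idem_part by (auto simp: prod_algebra_def block_simps)
      moreover have "?f ?x = y"
      proof -
        have "?f ?x = h (\<Sum>r\<in>R. idem r * p)" by (rule f_h) simp
        also have "\<dots> = h p"
          unfolding h_eq'
        proof
          fix t assume t: "t \<in> R"
          have "lin_factor t ^ m t dvd ((\<Sum>r\<in>R. idem r * p) - idem t * p) + (idem t * p - p)"
            using mod[OF t, of "\<lambda>r. idem r * p"] idem by (intro dvd_add idem_mult_same) auto
          then show "lin_factor t ^ m t dvd (\<Sum>r\<in>R. idem r * p) - p" by simp
        qed
        finally show ?thesis by (simp add: y)
      qed
      ultimately show "y \<in> ?f ` carrier ?P" by blast
    qed
  qed (use closed in blast)
  show ?thesis
    unfolding alg_iso_def ring_iso_def Ring.ring_hom_def bij_betw_def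
    using mult add one smult closed inj surj by auto
qed

text \<open>Substituting \<open>x + r\<close> for \<open>x\<close> turns the component at
  \<open>r\<close> into the polynomials modulo the power \<open>m r\<close> of
  \<open>x\<close>.\<close>

lemma block_trunc_iso:
  assumes r: "r \<in> R"
  shows "alg_isomorphic (Bl r) (trunc_poly_algebra (m r))"
proof -
  let ?T = "trunc_poly_algebra (m r) :: ('a, 'a poly set) module"
  let ?s = "\<lambda>p. pcompose p [:r, 1:]"
  \<comment> \<open>Any representative gives the same coset, since two of them agree modulo
    \<open>lin_factor r ^ m r\<close>.\<close>
  define \<theta> where "\<theta> = (\<lambda>x. monom_coset (m r) (?s (SOME p. x = h p)))"
  have eq_iff: "monom_coset (m r) (?s p) = monom_coset (m r) (?s p') \<longleftrightarrow> lin_factor r ^ m r dvd p - p'" for p p'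
    by (simp add: monom_coset_eq lin_factor_power_dvd_iff pcompose_diff)
  have \<theta>: "\<theta> (h p) = monom_coset (m r) (?s p)" for p
  proof -
    have "h p = h (SOME p'. h p = h p')" by (rule someI[of "\<lambda>p'. h p = h p'" p]) simp
    from this[symmetric] have "lin_factor r ^ m r dvd (SOME p'. h p = h p') - p"
      using r h_eq'[of "SOME p'. h p = h p'" p] by blast
    then show ?thesis unfolding \<theta>_def eq_iff .
  qed
  have rep: "\<exists>p. x = h p" if "x \<in> carrier (Bl r)" for x using that by (auto simp: block_carrier)
  have closed: "\<theta> x \<in> carrier ?T" if "x \<in> carrier (Bl r)" for x
    using rep[OF that] by (auto simp: \<theta> trunc_poly_simps)
  have smult: "\<theta> (c \<odot>\<^bsub>Bl r\<^esub> x) = c \<odot>\<^bsub>?T\<^esub> \<theta> x" if "x \<in> carrier (Bl r)" for c x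
    using rep[OF that] by (auto simp: \<theta> trunc_poly_simps block_simps h_smult pcompose_smult)
  have mult: "\<theta> (x \<otimes>\<^bsub>Bl r\<^esub> y) = \<theta> x \<otimes>\<^bsub>?T\<^esub> \<theta> y"
    and add: "\<theta> (x \<oplus>\<^bsub>Bl r\<^esub> y) = \<theta> x \<oplus>\<^bsub>?T\<^esub> \<theta> y"
    if "x \<in> carrier (Bl r)" "y \<in> carrier (Bl r)" for x y
    using rep[OF that(1)] rep[OF that(2)]
    by (auto simp: \<theta> trunc_poly_simps block_simps h_mult h_add pcompose_mult pcompose_add)
  have one: "\<theta> \<one>\<^bsub>Bl r\<^esub> = \<one>\<^bsub>?T\<^esub>"
  proof -
    have "\<theta> \<one>\<^bsub>Bl r\<^esub> = monom_coset (m r) (?s 1)"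
      unfolding block_one[OF r] \<theta> eq_iff by (subst dvd_diff_commute) (rule idem(2))
    then show ?thesis by (simp add: trunc_poly_simps pcompose_1)
  qed
  have bij: "bij_betw \<theta> (carrier (Bl r)) (carrier ?T)"
    unfolding bij_betw_def
  proof
      show "inj_on \<theta> (carrier (Bl r))"
      proof (rule inj_onI)
        fix x y assume "x \<in> carrier (Bl r)" "y \<in> carrier (Bl r)" and eq: "\<theta> x = \<theta> y"
        then obtain p p' where p: "x = h p" "cofactor r dvd p" "y = h p'" "cofactor r dvd p'"
          by (auto simp: block_carrier)
        then have "lin_factor r ^ m r dvd p - p'" using eq by (simp add: \<theta> eq_iff)
        then show "x = y" unfolding p h_eq' using p(2,4) by (metis DiffI cofactor_dvd_iff dvd_diff singletonD)
      qed
      show "\<theta> ` carrier (Bl r) = carrier ?T"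
      proof
        show "\<theta> ` carrier (Bl r) \<subseteq> carrier ?T"
          by (auto simp: block_carrier \<theta> trunc_poly_simps)
        show "carrier ?T \<subseteq> \<theta> ` carrier (Bl r)"
        proof
          fix Y assume "Y \<in> carrier ?T"
          then obtain p where Y: "Y = monom_coset (m r) p" by (auto simp: trunc_poly_simps)
          let ?p = "pcompose p [:- r, 1:]"
          have "?s ?p = p" by (simp add: pcompose_assoc[symmetric] pcompose_pCons)
          then have "Y = monom_coset (m r) (?s ?p)" using Y by simp
          also have "\<dots> = \<theta> (h (idem r * ?p))"
            unfolding \<theta> eq_iff by (subst dvd_diff_commute) (rule idem_mult_same)
          finally show "Y \<in> \<theta> ` carrier (Bl r)" using idem_part(1)[of r ?p] by (simp add: block_simps)
        qed
      qed
  qed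
  have "\<theta> \<in> alg_iso (Bl r) ?T"
    unfolding alg_iso_def ring_iso_def Ring.ring_hom_def using closed mult add one smult bij by auto
  then show ?thesis by (auto simp: alg_isomorphic_def)
qed

lemma vectorspace_block: "vectorspace class_ring (Bl r)"
proof -
  interpret E: ideal "E r" A by (rule ideal_E)
  have cl: "\<exists>p. x = h p" if "x \<in> E r" for x using that by (auto simp: E_def)
  have ab: "abelian_group (Bl r)"
  proof (rule abelian_groupI)
    show "\<exists>y\<in>carrier (Bl r). y \<oplus>\<^bsub>Bl r\<^esub> x = \<zero>\<^bsub>Bl r\<^esub>" if "x \<in> carrier (Bl r)" for x
      using that E.a_inv_closed[of x] E_subset[of r] by (auto simp: block_simps intro!: bexI[of _ "\<ominus>\<^bsub>A\<^esub> x"] l_neg)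
  qed (use E_subset[of r] in \<open>auto simp: block_simps intro: a_assoc a_comm\<close>)
  have "module class_ring (Bl r)"
  proof (rule moduleI)
    show "cring (class_ring :: 'a ring)" by (rule class_cring.cring_axioms)
    show "abelian_group (Bl r)" by (rule ab)
    show "c \<odot>\<^bsub>Bl r\<^esub> x \<in> carrier (Bl r)" if x: "x \<in> carrier (Bl r)" for c x
    proof -
      obtain p where "x = h p" "cofactor r dvd p" using x by (auto simp: block_carrier)
      then show ?thesis by (simp add: block_simps h_smult h_in_E dvd_smult)
    qed
  qed (auto simp: block_simps h_smult h_add smult_add_left smult_add_right dest!: cl)
  then show ?thesis by (intro vectorspace.intro class_field)
qed

text \<open>The powers of \<open>lin_factor r\<close> with exponents below \<open>m r\<close>, cut
  down to the block by the idempotent, form a basis: the substitution that moves \<open>r\<close> to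
  0 turns them into monomials.\<close>

lemma dim_block:
  assumes r: "r \<in> R"
  shows "vectorspace.fin_dim class_ring (Bl r)" "vectorspace.dim class_ring (Bl r) = m r"
proof -
  interpret V: vectorspace "class_ring :: 'a ring" "Bl r" by (rule vectorspace_block)
  let ?v = "\<lambda>i. h (idem r * lin_factor r ^ i)"
  let ?B = "?v ` {..<m r}"
  have v_E: "?v i \<in> E r" for i by (rule idem_part)
  have lin: "(\<Oplus>\<^bsub>Bl r\<^esub> i\<in>I. c i \<odot>\<^bsub>Bl r\<^esub> ?v i) = h (idem r * (\<Sum>i\<in>I. Polynomial.smult (c i) (lin_factor r ^ i)))"
    if "finite I" for c :: "nat \<Rightarrow> 'a" and I
    using that
  proof (induction I rule: finite_induct)
    case empty
    then show ?case by (simp add: block_simps h_zero)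
  next
    case (insert i I)
    have "c i \<odot>\<^bsub>Bl r\<^esub> ?v i \<in> carrier (Bl r)" for i
      using v_E[of i] by (intro V.smult_closed) (auto simp: block_simps)
    then show ?case using insert by (simp add: V.M.finsum_insert) (simp add: block_simps h_smult h_add algebra_simps)
  qed
  have pow_shift: "pcompose (\<Sum>i<n. Polynomial.smult (c i) (lin_factor r ^ i)) [:r, 1:] = (\<Sum>i<n. monom (c i) i)" for c n
  proof -
    have "pcompose (lin_factor r ^ i) [:r, 1:] = monom 1 i" for i
      by (simp add: pcompose_pow pcompose_pCons monom_altdef)
    then show ?thesis by (simp add: pcompose_sum pcompose_smult smult_monom)
  qed
  have zero: "c i = 0" if "h (idem r * (\<Sum>i<m r. Polynomial.smult (c i) (lin_factor r ^ i))) = h 0" "i < m r" for c i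
  proof -
    let ?p = "\<Sum>i<m r. Polynomial.smult (c i) (lin_factor r ^ i)"
    have "lin_factor r ^ m r dvd idem r * ?p" using that(1) r unfolding h_eq_0 by blast
    then have "lin_factor r ^ m r dvd idem r * ?p - (idem r * ?p - ?p)" using idem_mult_same by (rule dvd_diff)
    then have "monom 1 (m r) dvd (\<Sum>i<m r. monom (c i) i)"
      by (simp add: lin_factor_power_dvd_iff pow_shift)
    then have "coeff (\<Sum>i<m r. monom (c i) i) i = 0" using that(2) by (simp add: monom_1_dvd_iff')
    then show ?thesis using that(2) by (simp add: coeff_sum)
  qed
  have inj: "inj_on ?v {..<m r}"
  proof (rule inj_onI, rule ccontr)
    fix i j assume ij: "i \<in> {..<m r}" "j \<in> {..<m r}" "?v i = ?v j" "i \<noteq> j"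
    \<comment> \<open>The coefficients of the difference of two powers, so that two equal basis
      vectors would contradict independence.\<close>
    let ?c = "\<lambda>k. (if k = i then 1 else 0) - (if k = j then 1 else 0) :: 'a"
    have "(\<Sum>k<m r. Polynomial.smult (?c k) (lin_factor r ^ k)) = lin_factor r ^ i - lin_factor r ^ j"
      using ij by (simp add: smult_diff_left sum_subtractf if_distrib[of "\<lambda>x. Polynomial.smult x _"] cong: if_cong)
    moreover have "h (idem r * (lin_factor r ^ i - lin_factor r ^ j)) = h 0"
      using ij(3) unfolding h_eq by (simp add: algebra_simps)
    ultimately have "?c i = 0" using zero[of ?c i] ij by auto
    then show False using ij by simp
  qed
  have lc: "V.lincomb a ?B = h (idem r * (\<Sum>i<m r. Polynomial.smult (a (?v i)) (lin_factor r ^ i)))" for a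
  proof -
    have "V.lincomb a ?B = (\<Oplus>\<^bsub>Bl r\<^esub> i\<in>{..<m r}. a (?v i) \<odot>\<^bsub>Bl r\<^esub> ?v i)"
      unfolding V.lincomb_def
    proof (rule V.M.finsum_reindex[OF _ inj])
      show "(\<lambda>v. a v \<odot>\<^bsub>Bl r\<^esub> v) \<in> ?v ` {..<m r} \<rightarrow> carrier (Bl r)"
        using v_E by (auto simp: block_simps h_smult h_in_E dvd_smult)
    qed
    then show ?thesis by (simp add: lin)
  qed
  have B: "finite ?B" "?B \<subseteq> carrier (Bl r)" using v_E by (auto simp: block_simps)
  have "V.lin_indpt ?B"
  proof (rule V.finite_lin_indpt2[OF B])
    fix a assume "V.lincomb a ?B = \<zero>\<^bsub>Bl r\<^esub>"
    then have z: "h (idem r * (\<Sum>i<m r. Polynomial.smult (a (?v i)) (lin_factor r ^ i))) = h 0"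
      by (simp add: lc block_simps h_zero)
    show "\<forall>v\<in>?B. a v = \<zero>\<^bsub>class_ring\<^esub>"
    proof
      fix v assume "v \<in> ?B"
      then obtain i where i: "i < m r" "v = ?v i" by auto
      then show "a v = \<zero>\<^bsub>class_ring\<^esub>" using zero[of "\<lambda>i. a (?v i)" i, OF z i(1)] by simp
    qed
  qed
  moreover have gen: "V.gen_set ?B"
  proof
    show "V.span ?B \<subseteq> carrier (Bl r)" by (rule V.span_is_subset2[OF B(2)])
    show "carrier (Bl r) \<subseteq> V.span ?B"
    proof
      fix x assume "x \<in> carrier (Bl r)"
      then obtain p where p: "x = h p" "cofactor r dvd p" by (auto simp: block_carrier)
      let ?c = "\<lambda>i. coeff (pcompose p [:r, 1:]) i"
      \<comment> \<open>The Taylor coefficients of \<open>p\<close> at \<open>r\<close>, attached to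
        the basis vectors through the inverse of their enumeration.\<close>
      define a where "a = (\<lambda>v. ?c (the_inv_into {..<m r} ?v v))"
      have a: "a (?v i) = ?c i" if "i < m r" for i
        using the_inv_into_f_f[OF inj, of i] that by (simp add: a_def)
      let ?q = "\<Sum>i<m r. Polynomial.smult (?c i) (lin_factor r ^ i)"
      have "lin_factor r ^ m r dvd ?q - p"
        unfolding lin_factor_power_dvd_iff pcompose_diff pow_shift
        by (auto simp: monom_1_dvd_iff' coeff_sum)
      then have d: "lin_factor r ^ m r dvd (idem r * ?q - ?q) + (?q - p)" by (intro dvd_add idem_mult_same)
      have "h (idem r * ?q) = x"
        unfolding p(1) h_eq'
      proof
        fix s assume s: "s \<in> R"
        show "lin_factor s ^ m s dvd idem r * ?q - p"
        proof (cases "s = r")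
          case True
          then show ?thesis using d by simp
        next
          case False
          then show ?thesis using p(2) idem_other[OF s] s by (intro dvd_diff dvd_mult2) (auto simp: cofactor_dvd_iff)
        qed
      qed
      then have "x = V.lincomb a ?B" using a by (simp add: lc)
      then show "x \<in> V.span ?B" using B unfolding V.span_def by auto
    qed
  qed
  ultimately have "V.basis ?B" using B by (simp add: V.basis_def)
  then have "V.dim = card ?B" using B(1) by (intro V.dim_basis)
  then show "V.dim = m r" using inj by (simp add: card_image)
  show "V.fin_dim" unfolding V.fin_dim_def using B gen by blast
qed

end

section \<open>The labelled diagram of a partition\<close>

text \<open>Division with remainder by the relation \<open>residue_poly\<close>: the remainder has
  degree at most \<open>card Ad\<close>, and in this range the powers of \<open>jm\<close> are
  linearly independent on \<open>e\<close>.\<close>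

lemma (in labelled_diagram) jm_poly_e_eq_iff:
  assumes two: "(2 :: 'a :: field) \<noteq> 0"
  shows "jm_poly p e = (jm_poly p' e :: _ \<Rightarrow> 'a) \<longleftrightarrow> residue_poly dvd p - p'"
proof -
  have diff: "jm_poly (p - p') e \<tau> = jm_poly p e \<tau> - (jm_poly p' e \<tau> :: 'a)" for \<tau>
    using jm_poly_add[of "p - p'" p' e \<tau>] by simp
  have mult: "jm_poly (k * residue_poly) e = (\<lambda>_. 0 :: 'a)" for k
  proof
    fix \<tau>
    have "jm_poly (k * residue_poly) e \<tau> = (jm_poly k (\<lambda>_. 0) \<tau> :: 'a)"
      by (simp only: jm_poly_mult jm_poly_residue_poly)
    then show "jm_poly (k * residue_poly) e \<tau> = (0 :: 'a)"
      by (simp only: equivariant_zero[OF equivariant_jm_poly])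
  qed
  have "jm_poly d e = (\<lambda>_. 0 :: 'a) \<longleftrightarrow> residue_poly dvd d" for d :: "'a poly"
  proof
    assume z: "jm_poly d e = (\<lambda>_. 0)"
    have nz: "(residue_poly :: 'a poly) \<noteq> 0" using degree_residue_poly[where 'a = 'a] by auto
    have dec: "d = d div residue_poly * residue_poly + d mod residue_poly" by (rule div_mult_mod_eq[symmetric])
    have "jm_poly d e \<tau> = jm_poly (d div residue_poly * residue_poly) e \<tau> + jm_poly (d mod residue_poly) e \<tau>" for \<tau>
      by (subst dec) (rule jm_poly_add)
    then have "jm_poly (d mod residue_poly) e = (\<lambda>_. 0)" by (intro ext) (simp only: z mult add_0)
    moreover have "degree (d mod residue_poly) \<le> card Ad"
      using degree_mod_less[OF nz, of d] by (auto simp: degree_residue_poly)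
    ultimately have "d mod residue_poly = 0" by (rule jm_poly_e_eq_0)
    then show "residue_poly dvd d" by (simp add: dvd_eq_mod_eq_0)
  next
    assume "residue_poly dvd d"
    then obtain k where "d = k * residue_poly" by (metis dvdE mult.commute)
    then show "jm_poly d e = (\<lambda>_. 0)" using mult by simp
  qed
  from this[of "p - p'"] show ?thesis using diff by (auto simp: fun_eq_iff)
qed

text \<open>The column lengths of the diagram. The value at 0 is the one demanded of the fictitious
  column, one more than the number of rows.\<close>

definition height :: "nat list \<Rightarrow> nat \<Rightarrow> nat" where
  "height lam c = (if c = 0 then Suc (length lam) else card {i. i < length lam \<and> c \<le> lam ! i})"

definition width :: "nat list \<Rightarrow> nat" where "width lam = (if lam = [] then 0 else lam ! 0)"

lemma down_closed_eq_lessThan: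
  fixes S :: "nat set"
  assumes "finite S" "\<And>i j. i \<in> S \<Longrightarrow> j < i \<Longrightarrow> j \<in> S"
  shows "S = {..<card S}"
proof -
  have "S \<subseteq> {..<card S}"
  proof
    fix i assume i: "i \<in> S"
    then have "{..i} \<subseteq> S" using assms(2) by (auto simp: le_less)
    then have "card {..i} \<le> card S" by (rule card_mono[OF assms(1)])
    then show "i \<in> {..<card S}" by simp
  qed
  then show ?thesis by (intro card_subset_eq) auto
qed

text \<open>The bound on \<open>n\<close> makes \<open>n - 1\<close> a true subtraction, so that
  \<open>{1..n}\<close> is \<open>{1..n - 1}\<close> with the letter \<open>n\<close> added.\<close>

locale partition =
  fixes lam :: "nat list" and n :: nat
  assumes n: "1 \<le> n" and part: "is_partition lam (n - 1)"
begin

lemma sorted: "i \<le> j \<Longrightarrow> j < length lam \<Longrightarrow> lam ! j \<le> lam ! i"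
  using part by (cases "i = j") (auto simp: is_partition_def sorted_wrt_iff_nth_less)

lemma parts_pos: "i < length lam \<Longrightarrow> 0 < lam ! i"
  using part by (auto simp: is_partition_def)

lemma sum_lam: "sum_list lam = n - 1" using part by (simp add: is_partition_def)

text \<open>The rows reaching column \<open>c\<close> form an initial segment, because the parts are
  weakly decreasing.\<close>

lemma height_iff: "1 \<le> c \<Longrightarrow> i < height lam c \<longleftrightarrow> i < length lam \<and> c \<le> lam ! i"
proof -
  assume c: "1 \<le> c"
  let ?S = "{i. i < length lam \<and> c \<le> lam ! i}"
  have "?S = {..<card ?S}"
  proof (rule down_closed_eq_lessThan)
    fix i j assume "i \<in> ?S" "j < i"
    then show "j \<in> ?S" using sorted[of j i] by auto
  qed simp
  then have "i < card ?S \<longleftrightarrow> i \<in> ?S" by blast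
  then show ?thesis using c by (simp add: height_def)
qed

lemma height_le: "1 \<le> c \<Longrightarrow> height lam c \<le> length lam"
  using height_iff[of c "length lam"] by auto

lemma young_iff: "(i, c) \<in> young lam \<longleftrightarrow> 1 \<le> c \<and> 1 \<le> i \<and> i \<le> height lam c"
proof (cases "1 \<le> c \<and> 1 \<le> i")
  case True
  then have "i \<le> height lam c \<longleftrightarrow> i - 1 < height lam c" by auto
  then show ?thesis using True height_iff[of c "i - 1"] by (auto simp: young_def)
qed (auto simp: young_def)

lemma height_1: "height lam 1 = length lam"
proof -
  have "i < height lam 1 \<longleftrightarrow> i < length lam" for i
    using height_iff[of 1 i] parts_pos[of i] by auto
  then show ?thesis by (metis less_irrefl linorder_neqE_nat)
qed

lemma height_antimono: "c \<le> d \<Longrightarrow> height lam d \<le> height lam c"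
proof -
  assume cd: "c \<le> d"
  show ?thesis
  proof (cases "c = 0 \<or> d = 0")
    case True
    then show ?thesis using cd height_le[of d] by (cases "d = 0") (auto simp: height_def)
  next
    case False
    then have "i < height lam d \<Longrightarrow> i < height lam c" for i
      using height_iff[of d i] height_iff[of c i] cd by auto
    then show ?thesis by (meson leI less_irrefl)
  qed
qed

lemma height_eq_0: "height lam c = 0 \<longleftrightarrow> width lam < c"
proof (cases "c = 0")
  case False
  then have "0 < height lam c \<longleftrightarrow> lam \<noteq> [] \<and> c \<le> lam ! 0" using height_iff[of c 0] by auto
  then show ?thesis using False by (auto simp: width_def)
qed (simp add: height_def)

lemma height_0: "height lam 0 = Suc (height lam 1)"
  unfolding height_1 by (simp add: height_def)

lemma finite_young: "finite (young lam)" and card_young: "card (young lam) = n - 1"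
proof -
  let ?S = "SIGMA i:{..<length lam}. {..<lam ! i}"
  have "(\<lambda>(i, j). (Suc i, Suc j)) ` ?S = young lam"
  proof
    show "young lam \<subseteq> (\<lambda>(i, j). (Suc i, Suc j)) ` ?S"
    proof
      fix x assume x: "x \<in> young lam"
      then show "x \<in> (\<lambda>(i, j). (Suc i, Suc j)) ` ?S"
        by (intro image_eqI[of _ _ "(fst x - 1, snd x - 1)"]) (auto simp: young_def)
    qed
  qed (auto simp: young_def)
  moreover have "inj_on (\<lambda>(i, j). (Suc i, Suc j)) ?S" by (auto simp: inj_on_def)
  ultimately have "bij_betw (\<lambda>(i, j). (Suc i, Suc j)) ?S (young lam)" by (simp add: bij_betw_def)
  moreover have "finite ?S" by simp
  ultimately show "finite (young lam)" using bij_betw_finite by blast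
  have "card (young lam) = card ?S" using \<open>bij_betw _ ?S (young lam)\<close> by (rule bij_betw_same_card[symmetric])
  also have "\<dots> = sum_list lam" by (simp add: sum_list_sum_nth atLeast0LessThan)
  finally show "card (young lam) = n - 1" by (simp add: sum_lam)
qed

lemma tableau_iff: "t \<in> tableaux lam \<longleftrightarrow> bij_betw t (young lam) {1..n - 1}"
  by (simp add: tableaux_def sum_lam)

definition t0 :: tableau where "t0 = (SOME t. t \<in> tableaux lam)"

lemma t0: "t0 \<in> tableaux lam"
proof -
  have "\<exists>t. bij_betw t (young lam) {1..n - 1}"
    using finite_young card_young by (intro finite_same_card_bij) auto
  then show ?thesis unfolding t0_def tableau_iff by (rule someI_ex)
qed

text \<open>Read from the tableau on \<open>1, \<dots>, n - 1\<close>; the letter \<open>n\<close>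
  gets the row of the additional cell, and all other numbers the default 0 required outside the
  letter set.\<close>

definition t_row :: "tableau \<Rightarrow> nat \<Rightarrow> nat" where
  "t_row t y = (if y \<in> {1..n - 1} then fst (the_inv_into (young lam) t y) else if y = n then height lam 0 else 0)"

definition t_col :: "tableau \<Rightarrow> nat \<Rightarrow> nat" where
  "t_col t y = (if y \<in> {1..n - 1} then snd (the_inv_into (young lam) t y) else 0)"

lemma t_row_col:
  assumes "t \<in> tableaux lam" "(i, j) \<in> young lam"
  shows "t_row t (t (i, j)) = i" "t_col t (t (i, j)) = j" "t (i, j) \<in> {1..n - 1}"
proof -
  have b: "bij_betw t (young lam) {1..n - 1}" using assms by (simp add: tableau_iff)
  then show r: "t (i, j) \<in> {1..n - 1}" using assms(2) by (rule bij_betwE[rule_format])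
  have "the_inv_into (young lam) t (t (i, j)) = (i, j)"
    using b assms(2) by (intro the_inv_into_f_f) (auto simp: bij_betw_def)
  then show "t_row t (t (i, j)) = i" "t_col t (t (i, j)) = j" using r by (simp_all add: t_row_def t_col_def)
qed

lemma tableau_surj:
  assumes "t \<in> tableaux lam" "y \<in> {1..n - 1}"
  obtains i j where "(i, j) \<in> young lam" "y = t (i, j)"
  using assms unfolding tableau_iff bij_betw_def by (metis imageE surj_pair)

lemma labelled_diagram: "t \<in> tableaux lam \<Longrightarrow> labelled_diagram (height lam) (width lam) {1..n} n (t_row t) (t_col t)"
proof
  assume t: "t \<in> tableaux lam"
  show "bij_betw (\<lambda>y. (t_row t y, t_col t y)) ({1..n} - {n}) {(i, c). 1 \<le> c \<and> 1 \<le> i \<and> i \<le> height lam c}"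
  proof (rule bij_betwI[where g = t])
    have eq: "{1..n} - {n} = {1..n - 1}" by auto
    show "(\<lambda>y. (t_row t y, t_col t y)) \<in> {1..n} - {n} \<rightarrow> {(i, c). 1 \<le> c \<and> 1 \<le> i \<and> i \<le> height lam c}"
      unfolding eq by (auto simp: t_row_col[OF t] young_iff elim!: tableau_surj[OF t, simplified])
    show "t \<in> {(i, c). 1 \<le> c \<and> 1 \<le> i \<and> i \<le> height lam c} \<rightarrow> {1..n} - {n}"
      unfolding eq using t_row_col(3)[OF t] by (auto simp: young_iff)
    show "t (t_row t y, t_col t y) = y" if "y \<in> {1..n} - {n}" for y
      using that tableau_surj[OF t, of y] t_row_col[OF t] unfolding eq by metis
    show "(t_row t (t x), t_col t (t x)) = x" if "x \<in> {(i, c). 1 \<le> c \<and> 1 \<le> i \<and> i \<le> height lam c}" for x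
      using that t_row_col[OF t] by (auto simp: young_iff)
  qed
qed (use n in \<open>auto simp: height_antimono height_0 height_eq_0 t_row_def t_col_def\<close>)

sublocale D: labelled_diagram "height lam" "width lam" "{1..n}" n "t_row t0" "t_col t0"
  by (rule labelled_diagram[OF t0])

lemma young_down_closed:
  assumes "is_partition mu k" "(i, j) \<in> young mu" "1 \<le> i'" "i' \<le> i" "1 \<le> j'" "j' \<le> j"
  shows "(i', j') \<in> young mu"
proof -
  have "mu ! (i - 1) \<le> mu ! (i' - 1)"
    using assms by (cases "i = i'") (auto simp: is_partition_def sorted_wrt_iff_nth_less young_def)
  then show ?thesis using assms by (auto simp: young_def)
qed

text \<open>An addable node lies directly below its column, and the column to its left must be
  longer; the convention for column 0 makes this true in the first column as well.\<close>

lemma addable_eq: "addable lam = (\<lambda>c. (Suc (height lam c), c)) ` D.addable_cols"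
proof
  show "addable lam \<subseteq> (\<lambda>c. (Suc (height lam c), c)) ` D.addable_cols"
  proof
    fix x assume "x \<in> addable lam"
    then obtain i c mu k where x: "x = (i, c)" "(i, c) \<notin> young lam"
      and mu: "is_partition mu k" "young mu = insert (i, c) (young lam)"
      unfolding addable_def by (cases x) auto
    have ic: "(i, c) \<in> young mu" using mu by simp
    then have pos: "1 \<le> i" "1 \<le> c" by (auto simp: young_def)
    then have gt: "height lam c < i" using x(2) by (auto simp: young_iff)
    have i: "i = Suc (height lam c)"
    proof (rule ccontr)
      assume "i \<noteq> Suc (height lam c)"
      then have "(Suc (height lam c), c) \<in> young mu"
        using young_down_closed[OF mu(1) ic, of "Suc (height lam c)" c] gt pos by auto
      then have "(Suc (height lam c), c) \<in> young lam" using mu(2) \<open>i \<noteq> Suc (height lam c)\<close> by auto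
      then show False by (simp add: young_iff)
    qed
    have "height lam c < height lam (c - 1)"
    proof (cases "c = 1")
      case True
      then show ?thesis using height_0 by simp
    next
      case False
      then have "(i, c - 1) \<in> young mu" using young_down_closed[OF mu(1) ic, of i "c - 1"] pos by auto
      then have "(i, c - 1) \<in> young lam" using mu(2) pos by auto
      then show ?thesis using i by (simp add: young_iff)
    qed
    then show "x \<in> (\<lambda>c. (Suc (height lam c), c)) ` D.addable_cols"
      using pos x(1) i by (auto simp: D.addable_cols_iff)
  qed
  show "(\<lambda>c. (Suc (height lam c), c)) ` D.addable_cols \<subseteq> addable lam"
  proof clarify
    fix c assume "c \<in> D.addable_cols"
    then have c: "1 \<le> c" "height lam c < height lam (c - 1)" by (auto simp: D.addable_cols_iff)
    let ?r = "height lam c"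
    have notin: "(Suc ?r, c) \<notin> young lam" by (simp add: young_iff)
    have above: "c \<le> lam ! i" if "i < ?r" for i using that height_iff[OF c(1)] by blast
    have "\<exists>mu k. is_partition mu k \<and> young mu = insert (Suc ?r, c) (young lam)"
    proof (cases "?r < length lam")
      \<comment> \<open>The node extends an existing row, whose length must be
        \<open>c - 1\<close>.\<close>
      case True
      then have "c \<noteq> 1" using height_1 by auto
      then have "?r < length lam \<and> c - 1 \<le> lam ! ?r" using c height_iff[of "c - 1" ?r] by auto
      moreover have "\<not> c \<le> lam ! ?r" using True height_iff[OF c(1), of ?r] by auto
      ultimately have lr: "Suc (lam ! ?r) = c" using c by linarith
      let ?mu = "lam[?r := c]"
      have "?mu ! j \<le> ?mu ! i" if "i < j" "j < length lam" for i j
        using that above[of i] sorted[of i j] lr True by (cases "j = ?r"; cases "i = ?r") auto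
      then have "sorted_wrt (\<ge>) ?mu" by (auto simp: sorted_wrt_iff_nth_less)
      moreover have "0 < k" if "k \<in> set ?mu" for k
        using that set_update_subset_insert[of lam ?r c] part c by (auto simp: is_partition_def)
      ultimately have "is_partition ?mu (sum_list ?mu)" by (simp add: is_partition_def)
      moreover have "young ?mu = insert (Suc ?r, c) (young lam)"
      proof -
        have "(i, j) \<in> young ?mu \<longleftrightarrow> (i, j) = (Suc ?r, c) \<or> (i, j) \<in> young lam" for i j
        proof (cases "i = Suc ?r")
          case True
          then show ?thesis using lr \<open>?r < length lam\<close> c by (auto simp: young_def)
        next
          case False
          then have "1 \<le> i \<Longrightarrow> ?mu ! (i - 1) = lam ! (i - 1)" by (intro nth_list_update_neq) auto
          then show ?thesis using False by (auto simp: young_def)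
        qed
        then show ?thesis by (intro Set.set_eqI) (metis insert_iff surj_pair)
      qed
      ultimately show ?thesis by blast
    next
      \<comment> \<open>The node starts a new row, which forces it into the first column.\<close>
      case False
      then have r: "?r = length lam" using height_le[OF c(1)] by simp
      then have "\<not> 1 \<le> c - 1" using c height_le[of "c - 1"] by auto
      then have "c = 1" using c(1) by linarith
      let ?mu = "lam @ [1]"
      have "is_partition ?mu (sum_list ?mu)"
        using part by (auto simp: is_partition_def sorted_wrt_append Suc_le_eq)
      moreover have "(i, j) \<in> young ?mu \<longleftrightarrow> (i, j) = (Suc (length lam), 1) \<or> (i, j) \<in> young lam" for i j
        by (cases "i = Suc (length lam)") (auto simp: young_def nth_append)
      then have "young ?mu = insert (Suc ?r, c) (young lam)"
        unfolding r \<open>c = 1\<close>[symmetric] by (intro Set.set_eqI) (metis insert_iff surj_pair)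
      ultimately show ?thesis by blast
    qed
    then show "(Suc ?r, c) \<in> addable lam" using notin by (auto simp: addable_def)
  qed
qed

lemma finite_addable: "finite (addable lam)"
  by (simp add: addable_eq D.finite_addable_cols)

text \<open>Grouping the linear factors by their value in the field is what produces the
  multiplicities: distinct integral residues may have the same image.\<close>

lemma residue_poly_eq:
  "D.residue_poly = (\<Prod>r\<in>addable_residues lam. lin_factor r ^ addable_mult lam (r :: 'a :: field))"
proof -
  have inj: "inj_on (\<lambda>c. (Suc (height lam c), c)) D.addable_cols" by (auto simp: inj_on_def)
  have "(\<Prod>r\<in>addable_residues lam. lin_factor r ^ addable_mult lam (r :: 'a)) =
      (\<Prod>r\<in>addable_residues lam. \<Prod>x | x \<in> addable lam \<and> residue x = (r :: 'a). lin_factor (residue x :: 'a))"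
    by (intro prod.cong refl) (simp add: addable_mult_def)
  also have "\<dots> = (\<Prod>x\<in>addable lam. lin_factor (residue x :: 'a))"
    unfolding addable_residues_def by (rule prod.image_gen[OF finite_addable, symmetric])
  also have "\<dots> = (\<Prod>c\<in>D.addable_cols. lin_factor (of_int (D.residue_of_col c) :: 'a))"
    unfolding addable_eq by (subst prod.reindex[OF inj]) (simp add: residue_def D.residue_of_col_def algebra_simps)
  finally show ?thesis by (simp add: D.residue_poly_def)
qed

end

section \<open>Specht modules as function spaces\<close>

text \<open>Conjugation by \<open>g\<close> identifies the column groups of the two labellings and
  preserves signs.\<close>

lemma polytab_relabel:
  assumes X: "finite X" and g: "g permutes X"
  shows "polytab X (cl \<circ> Hilbert_Choice.inv g) (rw \<circ> Hilbert_Choice.inv g) \<tau> = (polytab X cl rw (\<tau> \<circ> g) :: 'a :: comm_ring_1)"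
proof -
  let ?i = "Hilbert_Choice.inv g"
  have ig: "?i \<circ> g = id" "g \<circ> ?i = id" using permutes_inv_o[OF g] by auto
  have ip: "?i permutes X" by (rule permutes_inv[OF g])
  show ?thesis
    unfolding polytab_def
  proof (rule sum.reindex_bij_witness[where i = "\<lambda>s. g \<circ> s \<circ> ?i" and j = "\<lambda>s. ?i \<circ> s \<circ> g"])
    fix s assume s: "s \<in> col_group X (cl \<circ> ?i)"
    show "g \<circ> (?i \<circ> s \<circ> g) \<circ> ?i = s"
      using ig by (metis comp_assoc comp_id id_comp)
    have sp: "s permutes X" and sc: "\<And>y. cl (?i (s y)) = cl (?i y)" using s by (auto simp: col_group_def)
    have "cl ((?i \<circ> s \<circ> g) y) = cl y" for y using sc[of "g y"] fun_cong[OF ig(1), of y] by simp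
    then show "?i \<circ> s \<circ> g \<in> col_group X cl"
      using permutes_compose[OF permutes_compose[OF g sp] ip] by (simp add: col_group_def comp_assoc)
    have "sign (?i \<circ> s \<circ> g) = sign ?i * sign s * sign g"
      using sign_comp_permutes[OF X permutes_compose[OF sp ip, folded comp_assoc] g] sign_comp_permutes[OF X ip sp] by simp
    moreover have "sign ?i = sign g" using g X by (meson permutation_permutes sign_inverse)
    ultimately have sgn: "sign (?i \<circ> s \<circ> g) = sign s" by (simp add: sign_def)
    have "\<tau> \<circ> g \<circ> (?i \<circ> s \<circ> g) = \<tau> \<circ> s \<circ> g" using ig by (metis comp_assoc comp_id)
    moreover have "\<tau> \<circ> s \<circ> g = rw \<longleftrightarrow> \<tau> \<circ> s = rw \<circ> ?i"
      using ig by (metis comp_assoc comp_id)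
    ultimately show "(if \<tau> \<circ> g \<circ> (?i \<circ> s \<circ> g) = rw then of_int (sign (?i \<circ> s \<circ> g)) else 0) =
        (if \<tau> \<circ> s = rw \<circ> ?i then of_int (sign s) else (0 :: 'a))" by (simp only: sgn)
  next
    fix s assume s: "s \<in> col_group X cl"
    show "?i \<circ> (g \<circ> s \<circ> ?i) \<circ> g = s"
      using ig by (metis comp_assoc comp_id id_comp)
    have sp: "s permutes X" and sc: "\<And>y. cl (s y) = cl y" using s by (auto simp: col_group_def)
    have "cl (?i ((g \<circ> s \<circ> ?i) y)) = cl (?i y)" for y using sc[of "?i y"] fun_cong[OF ig(1)] by simp
    then show "g \<circ> s \<circ> ?i \<in> col_group X (cl \<circ> ?i)"
      using permutes_compose[OF permutes_compose[OF ip sp] g] by (simp add: col_group_def comp_assoc)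
  qed
qed

lemma perm_module_simps:
  "carrier (perm_module lam) = {f. \<forall>T. T \<notin> tabloids lam \<longrightarrow> f T = 0}"
  "f \<oplus>\<^bsub>perm_module lam\<^esub> g = (\<lambda>T. f T + g T)" "\<zero>\<^bsub>perm_module lam\<^esub> = (\<lambda>T. 0)"
  "c \<odot>\<^bsub>perm_module lam\<^esub> f = (\<lambda>T. c * f T)"
  by (simp_all add: perm_module_def)

lemma module_perm_module: "module class_ring (perm_module lam :: ('a :: field, tabloid \<Rightarrow> 'a) module)"
proof (rule moduleI)
  show "cring (class_ring :: 'a ring)" by (rule class_cring.cring_axioms)
  show "abelian_group (perm_module lam :: ('a, tabloid \<Rightarrow> 'a) module)"
  proof (rule abelian_groupI)
    fix f :: "tabloid \<Rightarrow> 'a" assume "f \<in> carrier (perm_module lam)"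
    then show "\<exists>g\<in>carrier (perm_module lam). g \<oplus>\<^bsub>perm_module lam\<^esub> f = \<zero>\<^bsub>perm_module lam\<^esub>"
      by (intro bexI[of _ "\<lambda>T. - f T"]) (auto simp: perm_module_simps)
  qed (auto simp: perm_module_simps algebra_simps)
qed (auto simp: perm_module_simps algebra_simps)

lemma specht_simps:
  "f \<oplus>\<^bsub>specht lam\<^esub> g = (\<lambda>T. f T + g T)" "\<zero>\<^bsub>specht lam\<^esub> = (\<lambda>T. 0)"
  "c \<odot>\<^bsub>specht lam\<^esub> f = (\<lambda>T. c * f T)"
  by (simp_all add: specht_def perm_module_simps)

lemma polytabloid_in_perm_module: "t \<in> tableaux lam \<Longrightarrow> (\<And>p T. p \<in> column_stabilizer lam t \<Longrightarrow> T \<in> tabloids lam \<Longrightarrow> tabloid_act p T \<in> tabloids lam) \<Longrightarrow>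
  (polytabloid lam t :: tabloid \<Rightarrow> 'a :: field) \<in> carrier (perm_module lam)"
  by (auto simp: perm_module_simps polytabloid_def tabloids_def intro!: sum.neutral)

context partition
begin

text \<open>The tabloid in which each letter \<open>y\<close> lies in row \<open>\<tau> y\<close>,
  as a set of tableaux. The set is empty when \<open>\<tau>\<close> assigns a wrong number of
  letters to some row.\<close>

definition tab :: "(nat \<Rightarrow> nat) \<Rightarrow> tabloid" where
  "tab \<tau> = {s \<in> tableaux lam. \<forall>(i, j)\<in>young lam. \<tau> (s (i, j)) = i}"

lemma tabD: "s \<in> tab \<tau> \<Longrightarrow> (i, j) \<in> young lam \<Longrightarrow> \<tau> (s (i, j)) = i"
  by (auto simp: tab_def)

lemma row_tab: "s \<in> tab \<tau> \<Longrightarrow> row lam s i = {y \<in> {1..n - 1}. \<tau> y = i}"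
proof -
  assume "s \<in> tab \<tau>"
  then have s: "s \<in> tableaux lam" "\<And>i j. (i, j) \<in> young lam \<Longrightarrow> \<tau> (s (i, j)) = i" by (auto simp: tab_def)
  show ?thesis
  proof
    show "row lam s i \<subseteq> {y \<in> {1..n - 1}. \<tau> y = i}"
    proof
      fix y assume "y \<in> row lam s i"
      then obtain j where "(i, j) \<in> young lam" "y = s (i, j)" by (auto simp: row_def)
      then show "y \<in> {y \<in> {1..n - 1}. \<tau> y = i}" using s(2) t_row_col(3)[OF s(1)] by blast
    qed
    show "{y \<in> {1..n - 1}. \<tau> y = i} \<subseteq> row lam s i"
    proof
      fix y assume y: "y \<in> {y \<in> {1..n - 1}. \<tau> y = i}"
      then obtain i' j where "(i', j) \<in> young lam" "y = s (i', j)" using tableau_surj[OF s(1), of y] by auto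
      then show "y \<in> row lam s i" using s(2)[of i' j] y by (auto simp: row_def)
    qed
  qed
qed

lemma tabloid_of_eq_tab:
  assumes t: "t \<in> tab \<tau>" shows "tabloid_of lam t = tab \<tau>"
proof
  show "tab \<tau> \<subseteq> tabloid_of lam t"
    using row_tab row_tab[OF t] by (auto simp: tabloid_of_def tab_def)
  show "tabloid_of lam t \<subseteq> tab \<tau>"
  proof
    fix s assume s: "s \<in> tabloid_of lam t"
    have "\<tau> (s (i, j)) = i" if "(i, j) \<in> young lam" for i j
    proof -
      have "s (i, j) \<in> row lam s i" using that by (auto simp: row_def)
      moreover have "row lam s i = row lam t i" using s by (simp add: tabloid_of_def)
      ultimately have "s (i, j) \<in> row lam t i" by simp
      then show ?thesis unfolding row_tab[OF t] by blast
    qed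
    then show "s \<in> tab \<tau>" using s by (auto simp: tab_def tabloid_of_def)
  qed
qed

lemma t_in_tab_row: "t \<in> tableaux lam \<Longrightarrow> t \<in> tab (t_row t)"
  by (auto simp: tab_def t_row_col)

lemma tabloid_of_eq: "t \<in> tableaux lam \<Longrightarrow> tabloid_of lam t = tab (t_row t)"
  by (rule tabloid_of_eq_tab[OF t_in_tab_row])

lemma tab_inject:
  assumes "tab \<tau> = tab \<tau>'" "s \<in> tab \<tau>" "y \<in> {1..n - 1}"
  shows "\<tau> y = \<tau>' y"
proof -
  have s: "s \<in> tab \<tau>" "s \<in> tab \<tau>'" "s \<in> tableaux lam" using assms by (auto simp: tab_def)
  obtain i j where "(i, j) \<in> young lam" "y = s (i, j)" using tableau_surj[OF s(3) assms(3)] .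
  then show ?thesis using tabD[OF s(1)] tabD[OF s(2)] by simp
qed

lemma tableaux_comp: "p permutes {1..n - 1} \<Longrightarrow> s \<in> tableaux lam \<Longrightarrow> p \<circ> s \<in> tableaux lam"
  unfolding tableau_iff by (rule bij_betw_trans[OF _ permutes_imp_bij])

lemma tabloid_act_tab:
  assumes p: "p permutes {1..n - 1}"
  shows "tabloid_act p (tab \<tau>) = tab (\<tau> \<circ> Hilbert_Choice.inv p)"
proof
  show "tabloid_act p (tab \<tau>) \<subseteq> tab (\<tau> \<circ> Hilbert_Choice.inv p)"
    using tableaux_comp[OF p] p by (auto simp: tabloid_act_def tab_def permutes_inverses)
  show "tab (\<tau> \<circ> Hilbert_Choice.inv p) \<subseteq> tabloid_act p (tab \<tau>)"
  proof
    fix s assume s: "s \<in> tab (\<tau> \<circ> Hilbert_Choice.inv p)"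
    then have "Hilbert_Choice.inv p \<circ> s \<in> tab \<tau>"
      using tableaux_comp[OF permutes_inv[OF p]] by (auto simp: tab_def)
    moreover have "s = p \<circ> (Hilbert_Choice.inv p \<circ> s)" by (simp add: comp_assoc[symmetric] permutes_inv_o[OF p])
    ultimately show "s \<in> tabloid_act p (tab \<tau>)" unfolding tabloid_act_def by blast
  qed
qed

lemma tabloids_eq: "tabloids lam = {tab \<tau> |\<tau>. tab \<tau> \<noteq> {}}"
proof
  show "tabloids lam \<subseteq> {tab \<tau> |\<tau>. tab \<tau> \<noteq> {}}"
    using t_in_tab_row tabloid_of_eq unfolding tabloids_def by blast
  show "{tab \<tau> |\<tau>. tab \<tau> \<noteq> {}} \<subseteq> tabloids lam"
  proof clarify
    fix \<tau> assume "tab \<tau> \<noteq> {}"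
    then obtain s where s: "s \<in> tab \<tau>" by blast
    then show "tab \<tau> \<in> tabloids lam"
      using tabloid_of_eq_tab[OF s] unfolding tabloids_def by (intro image_eqI[of _ _ s]) (auto simp: tab_def)
  qed
qed

lemma tabloid_act_tabloids:
  assumes p: "p permutes {1..n - 1}" and T: "T \<in> tabloids lam"
  shows "tabloid_act p T \<in> tabloids lam"
proof -
  obtain \<tau> where \<tau>: "T = tab \<tau>" "tab \<tau> \<noteq> {}" using T by (auto simp: tabloids_eq)
  have "tabloid_act p T \<noteq> {}" using \<tau> by (simp add: tabloid_act_def)
  then show ?thesis unfolding \<tau>(1) tabloid_act_tab[OF p] tabloids_eq by blast
qed

lemma tabloid_act_inverse:
  assumes p: "p permutes {1..n - 1}" shows "tabloid_act p (tabloid_act (Hilbert_Choice.inv p) T) = T"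
  by (simp add: tabloid_act_def image_image comp_assoc[symmetric] permutes_inv_o[OF p])

lemma perm_act_carrier:
  assumes p: "p permutes {1..n - 1}" and v: "v \<in> carrier (perm_module lam)"
  shows "perm_act p v \<in> carrier (perm_module lam)"
proof -
  have "tabloid_act (Hilbert_Choice.inv p) T \<notin> tabloids lam" if "T \<notin> tabloids lam" for T
    using tabloid_act_tabloids[OF p, of "tabloid_act (Hilbert_Choice.inv p) T"] tabloid_act_inverse[OF p, of T] that by auto
  then show ?thesis using v by (simp add: perm_module_simps perm_act_def)
qed

text \<open>A function on tabloids is regarded as a function on assignments of rows to the letters
  \<open>1, \<dots>, n\<close> in which only \<open>n\<close> lies in the additional row.\<close>

definition supp :: "(nat \<Rightarrow> nat) \<Rightarrow> bool" where
  "supp \<tau> \<longleftrightarrow> \<tau> n = height lam 0 \<and> (\<forall>y. y \<notin> {1..n} \<longrightarrow> \<tau> y = 0)"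

definition emb :: "(tabloid \<Rightarrow> 'a :: field) \<Rightarrow> (nat \<Rightarrow> nat) \<Rightarrow> 'a" where
  "emb v \<tau> = (if supp \<tau> then v (tab \<tau>) else 0)"

lemma permutes_n: "p permutes {1..n - 1} \<Longrightarrow> p n = n \<and> p permutes {1..n}"
proof
  assume p: "p permutes {1..n - 1}"
  show "p n = n" using n by (intro permutes_not_in[OF p]) auto
  show "p permutes {1..n}" by (rule permutes_subset[OF p]) auto
qed

lemma supp_comp: "p permutes {1..n - 1} \<Longrightarrow> supp (\<tau> \<circ> p) \<longleftrightarrow> supp \<tau>"
proof -
  assume p: "p permutes {1..n - 1}"
  have "p y = y" if "y \<notin> {1..n}" for y using permutes_n[OF p] that by (auto intro: permutes_not_in)
  then show ?thesis using permutes_n[OF p] by (auto simp: supp_def)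
qed

lemma emb_act:
  assumes p: "p permutes {1..n - 1}" shows "emb (perm_act p v) \<tau> = emb v (\<tau> \<circ> p)"
proof -
  have "tabloid_act (Hilbert_Choice.inv p) (tab \<tau>) = tab (\<tau> \<circ> p)"
    using tabloid_act_tab[OF permutes_inv[OF p], of \<tau>] p by (simp add: permutes_inv_inv)
  then show ?thesis by (simp add: emb_def perm_act_def supp_comp[OF p])
qed

lemma emb_inject:
  assumes "v \<in> carrier (perm_module lam)" "v' \<in> carrier (perm_module lam)" "emb v = emb v'"
  shows "v = v'"
proof
  fix T
  show "v T = v' T"
  proof (cases "T \<in> tabloids lam")
    case True
    then obtain \<tau> where \<tau>: "T = tab \<tau>" by (auto simp: tabloids_eq)
    \<comment> \<open>The same tabloid, with the values at \<open>n\<close> and outside the letters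
      chosen as \<open>supp\<close> demands.\<close>
    define \<tau>' where "\<tau>' = (\<lambda>y. if y \<in> {1..n - 1} then \<tau> y else if y = n then height lam 0 else 0)"
    have "tab \<tau>' = tab \<tau>" using t_row_col(3) by (auto simp: tab_def \<tau>'_def)
    moreover have "supp \<tau>'" using n by (auto simp: supp_def \<tau>'_def)
    ultimately show ?thesis using fun_cong[OF assms(3), of \<tau>'] \<tau> by (simp add: emb_def)
  next
    case False
    then show ?thesis using assms by (simp add: perm_module_simps)
  qed
qed

lemma column_eq: "t \<in> tableaux lam \<Longrightarrow> column lam t j = (if j = 0 then {} else {y \<in> {1..n}. t_col t y = j})"
proof -
  assume t: "t \<in> tableaux lam"
  have "y \<in> column lam t j \<longleftrightarrow> j \<noteq> 0 \<and> y \<in> {1..n} \<and> t_col t y = j" for y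
  proof
    assume "y \<in> column lam t j"
    then obtain i where "(i, j) \<in> young lam" "y = t (i, j)" by (auto simp: column_def)
    then show "j \<noteq> 0 \<and> y \<in> {1..n} \<and> t_col t y = j" using t_row_col[OF t, of i j] by (auto simp: young_def)
  next
    assume y: "j \<noteq> 0 \<and> y \<in> {1..n} \<and> t_col t y = j"
    then have "y \<in> {1..n - 1}" by (auto simp: t_col_def split: if_splits)
    then obtain i j' where "(i, j') \<in> young lam" "y = t (i, j')" using tableau_surj[OF t] by blast
    then show "y \<in> column lam t j" using y t_row_col[OF t] by (auto simp: column_def)
  qed
  then show ?thesis by auto
qed

text \<open>The letter \<open>n\<close> is alone in column 0, so a column permutation of
  \<open>1, \<dots>, n\<close> fixes it and comes from the smaller symmetric group.\<close>

lemma column_stabilizer_eq: "t \<in> tableaux lam \<Longrightarrow> column_stabilizer lam t = col_group {1..n} (t_col t)"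
proof -
  assume t: "t \<in> tableaux lam"
  interpret T: labelled_diagram "height lam" "width lam" "{1..n}" n "t_row t" "t_col t"
    by (rule labelled_diagram[OF t])
  have "p \<in> column_stabilizer lam t" if p: "p \<in> col_group {1..n} (t_col t)" for p
  proof -
    have pp: "p permutes {1..n}" "\<And>y. t_col t (p y) = t_col t y" using p by (auto simp: col_group_def)
    have "p n \<in> {1..n}" using permutes_in_image[OF pp(1), of n] n by simp
    then have pn: "p n = n" using T.cl_eq_0[of "p n"] pp(2)[of n] T.cl_x0 by simp
    have "p permutes {1..n - 1}" using pp(1)
    proof (rule permutes_superset)
      show "p x = x" if "x \<in> {1..n} - {1..n - 1}" for x
      proof -
        have "x = n" using that by auto
        then show ?thesis using pn by simp
      qed
    qed
    moreover have "p ` column lam t j = column lam t j" for j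
      unfolding column_eq[OF t] using col_group_image[OF p, of j] by simp
    ultimately show ?thesis by (simp add: column_stabilizer_def sym_group_carrier sum_lam)
  qed
  moreover have "p \<in> col_group {1..n} (t_col t)" if p: "p \<in> column_stabilizer lam t" for p
  proof -
    have pp: "p permutes {1..n - 1}" "\<And>j. p ` column lam t j = column lam t j"
      using p by (auto simp: column_stabilizer_def sym_group_carrier sum_lam)
    have "t_col t (p y) = t_col t y" for y
    proof (cases "y \<in> {1..n - 1}")
      case True
      then have y: "y \<in> {1..n}" "y \<noteq> n" using n by auto
      then have "t_col t y \<noteq> 0" using T.cl_eq_0[of y] by blast
      with y have "p y \<in> p ` column lam t (t_col t y)" unfolding column_eq[OF t] by auto
      then show ?thesis unfolding pp(2) unfolding column_eq[OF t] by (auto split: if_splits)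
    next
      case False
      then show ?thesis using pp(1) by (simp add: permutes_not_in)
    qed
    then show ?thesis using permutes_n[OF pp(1)] by (simp add: col_group_def)
  qed
  ultimately show ?thesis by blast
qed

lemma column_stabilizer_permutes: "p \<in> column_stabilizer lam t \<Longrightarrow> p permutes {1..n - 1}"
  by (simp add: column_stabilizer_def sym_group_carrier sum_lam)

lemma polytabloid_carrier: "t \<in> tableaux lam \<Longrightarrow> polytabloid lam t \<in> carrier (perm_module lam)"
  using tabloid_act_tabloids column_stabilizer_permutes by (intro polytabloid_in_perm_module) auto

text \<open>Among the assignments satisfying \<open>supp\<close>, a tabloid determines its
  assignment, so both sums have the same terms. Elsewhere \<open>polytab\<close> vanishes, because
  column permutations preserve \<open>supp\<close>.\<close>

lemma emb_polytabloid:
  assumes t: "t \<in> tableaux lam"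
  shows "emb (polytabloid lam t) = polytab {1..n} (t_col t) (t_row t)"
proof
  fix \<tau>
  show "emb (polytabloid lam t) \<tau> = (polytab {1..n} (t_col t) (t_row t) \<tau> :: 'a)"
  proof (cases "supp \<tau>")
    case True
    have "tab \<tau> = tabloid_act p (tabloid_of lam t) \<longleftrightarrow> \<tau> \<circ> p = t_row t" if p: "p \<in> column_stabilizer lam t" for p
    proof -
      have pp: "p permutes {1..n - 1}" by (rule column_stabilizer_permutes[OF p])
      let ?\<rho> = "t_row t \<circ> Hilbert_Choice.inv p"
      have act: "tabloid_act p (tabloid_of lam t) = tab ?\<rho>"
        unfolding tabloid_of_eq[OF t] by (rule tabloid_act_tab[OF pp])
      have "supp (t_row t)" using n by (auto simp: supp_def t_row_def)
      then have sr: "supp ?\<rho>" by (simp add: supp_comp[OF permutes_inv[OF pp]])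
      have mem: "p \<circ> t \<in> tab ?\<rho>"
        unfolding act[symmetric] tabloid_of_eq[OF t] tabloid_act_def using t_in_tab_row[OF t] by blast
      have "tab \<tau> = tab ?\<rho> \<longleftrightarrow> \<tau> = ?\<rho>"
      proof
        assume eq: "tab \<tau> = tab ?\<rho>"
        show "\<tau> = ?\<rho>"
        proof
          fix y
          consider "y \<in> {1..n - 1}" | "y = n" | "y \<notin> {1..n}" by fastforce
          then show "\<tau> y = ?\<rho> y"
          proof cases
            case 1
            then show ?thesis using tab_inject[OF eq, of "p \<circ> t" y] mem eq by simp
          qed (use True sr in \<open>simp_all add: supp_def\<close>)
        qed
      qed simp
      also have "\<tau> = ?\<rho> \<longleftrightarrow> \<tau> \<circ> p = t_row t"
        using permutes_inv_o[OF pp] by (metis comp_assoc comp_id)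
      finally show ?thesis unfolding act .
    qed
    then have "polytabloid lam t (tab \<tau>) = (polytab {1..n} (t_col t) (t_row t) \<tau> :: 'a)"
      unfolding polytabloid_def polytab_def column_stabilizer_eq[OF t] by (intro sum.cong refl) simp
    then show ?thesis using True by (simp add: emb_def)
  next
    case False
    have "polytab {1..n} (t_col t) (t_row t) \<tau> = (0 :: 'a)"
    proof (rule ccontr)
      assume "polytab {1..n} (t_col t) (t_row t) \<tau> \<noteq> (0 :: 'a)"
      then obtain s where s: "s \<in> col_group {1..n} (t_col t)" "\<tau> = t_row t \<circ> s" by (rule polytab_support)
      then have "s permutes {1..n - 1}" using column_stabilizer_permutes column_stabilizer_eq[OF t] by blast
      moreover have "supp (t_row t)" using n by (auto simp: supp_def t_row_def)
      ultimately show False using False s(2) supp_comp by blast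
    qed
    then show ?thesis using False by (simp add: emb_def)
  qed
qed

text \<open>Together with \<open>polytab_relabel\<close> this makes every polytabloid a translate of
  the one belonging to \<open>t0\<close>, which serves as the generator.\<close>

lemma tableau_relabel:
  assumes t: "t \<in> tableaux lam"
  obtains g where "g permutes {1..n - 1}" "t_row t = t_row t0 \<circ> Hilbert_Choice.inv g" "t_col t = t_col t0 \<circ> Hilbert_Choice.inv g"
    "\<And>x. x \<in> young lam \<Longrightarrow> t x = g (t0 x)"
proof -
  define g where "g y = (if y \<in> {1..n - 1} then t (the_inv_into (young lam) t0 y) else y)" for y
  have b0: "bij_betw t0 (young lam) {1..n - 1}" and b: "bij_betw t (young lam) {1..n - 1}"
    using t0 t by (simp_all add: tableau_iff)
  have gt: "g (t0 x) = t x" if "x \<in> young lam" for x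
    using b0 that bij_betwE[OF b0] by (auto simp: g_def bij_betw_def the_inv_into_f_f)
  have "bij_betw (t \<circ> the_inv_into (young lam) t0) {1..n - 1} {1..n - 1}"
    by (rule bij_betw_trans[OF bij_betw_the_inv_into[OF b0] b])
  then have "bij_betw g {1..n - 1} {1..n - 1}" by (rule bij_betw_cong[THEN iffD1, rotated]) (simp add: g_def)
  then have g: "g permutes {1..n - 1}" by (rule bij_imp_permutes) (auto simp: g_def)
  have eq: "t_row t (g y) = t_row t0 y \<and> t_col t (g y) = t_col t0 y" for y
  proof (cases "y \<in> {1..n - 1}")
    case True
    then obtain i j where "(i, j) \<in> young lam" "y = t0 (i, j)" using tableau_surj[OF t0] by blast
    then show ?thesis using gt t_row_col[OF t] t_row_col[OF t0] by simp
  next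
    case False
    show ?thesis by (simp only: g_def t_row_def t_col_def False if_False simp_thms)
  qed
  have "t_row t y = t_row t0 (Hilbert_Choice.inv g y)" "t_col t y = t_col t0 (Hilbert_Choice.inv g y)" for y
    using eq[of "Hilbert_Choice.inv g y"] g by (simp_all add: permutes_inverses)
  then show ?thesis using that[OF g] gt by (simp add: fun_eq_iff)
qed

lemma emb_polytabloid_relabel:
  assumes t: "t \<in> tableaux lam"
  obtains g where "g permutes {1..n - 1}" "\<And>\<tau>. emb (polytabloid lam t) \<tau> = (D.e (\<tau> \<circ> g) :: 'a :: field)"
proof -
  from tableau_relabel[OF t] obtain g where g: "g permutes {1..n - 1}"
    "t_row t = t_row t0 \<circ> Hilbert_Choice.inv g" "t_col t = t_col t0 \<circ> Hilbert_Choice.inv g" by metis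
  have "emb (polytabloid lam t) \<tau> = (D.e (\<tau> \<circ> g) :: 'a)" for \<tau>
    unfolding emb_polytabloid[OF t] g(2,3) using permutes_n[OF g(1)] by (intro polytab_relabel) auto
  then show ?thesis using that g(1) by blast
qed

lemma perm_act_polytabloid:
  assumes t: "t \<in> tableaux lam" and p: "p permutes {1..n - 1}"
  shows "perm_act p (polytabloid lam t :: tabloid \<Rightarrow> 'a :: field) = polytabloid lam (p \<circ> t)"
proof (rule emb_inject)
  have pt: "p \<circ> t \<in> tableaux lam" by (rule tableaux_comp[OF p t])
  show "perm_act p (polytabloid lam t :: tabloid \<Rightarrow> 'a) \<in> carrier (perm_module lam)"
    by (rule perm_act_carrier[OF p polytabloid_carrier[OF t]])
  show "polytabloid lam (p \<circ> t) \<in> carrier (perm_module lam)" by (rule polytabloid_carrier[OF pt])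
  have eq: "t_row (p \<circ> t) (p y) = t_row t y \<and> t_col (p \<circ> t) (p y) = t_col t y" for y
  proof (cases "y \<in> {1..n - 1}")
    case True
    then obtain i j where "(i, j) \<in> young lam" "y = t (i, j)" using tableau_surj[OF t] by blast
    then show ?thesis using t_row_col[OF t] t_row_col[OF pt] by simp
  next
    case False
    have py: "p y = y" by (rule permutes_not_in[OF p False])
    show ?thesis unfolding py using False by (auto simp: t_row_def t_col_def)
  qed
  have "t_row (p \<circ> t) = t_row t \<circ> Hilbert_Choice.inv p" "t_col (p \<circ> t) = t_col t \<circ> Hilbert_Choice.inv p"
    using eq[of "Hilbert_Choice.inv p _"] p by (simp_all add: fun_eq_iff permutes_inverses)
  then show "emb (perm_act p (polytabloid lam t)) = emb (polytabloid lam (p \<circ> t) :: tabloid \<Rightarrow> 'a)"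
    using permutes_n[OF p]
    by (intro ext) (simp add: emb_act[OF p] emb_polytabloid t pt polytab_relabel)
qed

section \<open>The Specht module as a span\<close>

lemma specht_carrier: "carrier (specht lam :: ('a :: field, tabloid \<Rightarrow> 'a) module) =
  LinearCombinations.module.span class_ring (perm_module lam) (polytabloid lam ` tableaux lam)"
  by (simp add: specht_def)

lemma submodule_specht: "submodule class_ring (carrier (specht lam :: ('a :: field, tabloid \<Rightarrow> 'a) module)) (perm_module lam)"
  unfolding specht_carrier using polytabloid_carrier
  by (intro LinearCombinations.module.span_is_submodule[OF module_perm_module]) auto

lemma specht_closed:
  fixes v w :: "tabloid \<Rightarrow> 'a :: field"
  assumes "v \<in> carrier (specht lam)"
  shows "w \<in> carrier (specht lam) \<Longrightarrow> (\<lambda>T. v T + w T) \<in> carrier (specht lam)"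
    and "(\<lambda>T. c * v T) \<in> carrier (specht lam)" and "v \<in> carrier (perm_module lam)"
  using submodule.m_closed[OF submodule_specht[where 'a = 'a], of v w]
    submodule.smult_closed[OF submodule_specht[where 'a = 'a], of c v]
    submodule.subset[OF submodule_specht[where 'a = 'a]] assms
  by (auto simp: perm_module_simps)

lemma zero_specht: "(\<lambda>T. 0 :: 'a :: field) \<in> carrier (specht lam)"
  using submodule.zero_closed[OF submodule_specht[where 'a = 'a]] by (simp add: perm_module_simps)

text \<open>The elements with the property \<open>P\<close> form a submodule that contains the
  polytabloids.\<close>

lemma specht_induct:
  fixes v :: "tabloid \<Rightarrow> 'a :: field"
  assumes v: "v \<in> carrier (specht lam)"
    and zero: "P (\<lambda>T. 0)" and poly: "\<And>t. t \<in> tableaux lam \<Longrightarrow> P (polytabloid lam t)"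
    and add: "\<And>v w. P v \<Longrightarrow> P w \<Longrightarrow> P (\<lambda>T. v T + w T)" and smult: "\<And>c v. P v \<Longrightarrow> P (\<lambda>T. c * v T)"
  shows "P v"
proof -
  let ?N = "{v \<in> carrier (perm_module lam). P v}"
  have "submodule class_ring ?N (perm_module lam)"
  proof (rule LinearCombinations.submodule.intro[OF module_perm_module])
    show "?N \<subseteq> carrier (perm_module lam)" by blast
    show "\<zero>\<^bsub>perm_module lam\<^esub> \<in> ?N" using zero by (simp add: perm_module_simps)
    show "f \<oplus>\<^bsub>perm_module lam\<^esub> g \<in> ?N" if "f \<in> ?N" "g \<in> ?N" for f g
      using that add[of f g] by (simp add: perm_module_simps)
    show "a \<odot>\<^bsub>perm_module lam\<^esub> f \<in> ?N" if "f \<in> ?N" for a f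
      using that smult[of f a] by (simp add: perm_module_simps)
  qed
  then have "carrier (specht lam) \<subseteq> ?N"
    unfolding specht_carrier using poly polytabloid_carrier
    by (intro LinearCombinations.module.span_is_subset[OF module_perm_module]) auto
  then show ?thesis using v by blast
qed

lemma polytabloid_in_specht: "t \<in> tableaux lam \<Longrightarrow> (polytabloid lam t :: tabloid \<Rightarrow> 'a :: field) \<in> carrier (specht lam)"
  unfolding specht_carrier
  using LinearCombinations.module.in_own_span[OF module_perm_module, of "polytabloid lam ` tableaux lam" lam] polytabloid_carrier
  by blast

lemma perm_act_specht:
  fixes v :: "tabloid \<Rightarrow> 'a :: field"
  assumes "v \<in> carrier (specht lam)" and p: "p permutes {1..n - 1}"
  shows "perm_act p v \<in> carrier (specht lam)"
  using assms(1)
proof (rule specht_induct)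
  show "perm_act p (polytabloid lam t) \<in> carrier (specht lam)" if "t \<in> tableaux lam" for t
    unfolding perm_act_polytabloid[OF that p] by (rule polytabloid_in_specht[OF tableaux_comp[OF p that]])
qed (simp_all add: perm_act_def zero_specht specht_closed)

lemma emb_add: "emb (\<lambda>T. v T + w T) \<tau> = emb v \<tau> + emb w \<tau>" and emb_smult: "emb (\<lambda>T. c * v T) \<tau> = c * emb v \<tau>"
  and emb_zero: "emb (\<lambda>T. 0) \<tau> = 0"
  by (simp_all add: emb_def)

lemma emb_specht:
  fixes v :: "tabloid \<Rightarrow> 'a :: field"
  shows "v \<in> carrier (specht lam) \<Longrightarrow> emb v \<in> D.ind_space"
proof (rule specht_induct[where P = "\<lambda>v. emb v \<in> D.ind_space"])
  show "emb (polytabloid lam t :: tabloid \<Rightarrow> 'a) \<in> D.ind_space" if "t \<in> tableaux lam" for t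
  proof -
    from emb_polytabloid_relabel[OF that] obtain g where g: "g permutes {1..n - 1}"
      "\<And>\<tau>. emb (polytabloid lam t) \<tau> = (D.e (\<tau> \<circ> g) :: 'a)" by blast
    have "emb (polytabloid lam t) = (\<lambda>\<tau>. D.e (\<tau> \<circ> g) :: 'a)" by (rule ext) (rule g(2))
    also have "\<dots> \<in> D.ind_space"
      by (rule D.ind_space_act[OF D.e_in_ind_space]) (use permutes_n[OF g(1)] in blast)
    finally show ?thesis .
  qed
next
  show "emb (\<lambda>T. 0 :: 'a) \<in> D.ind_space"
    unfolding emb_zero[abs_def] by (rule D.ind_space.zero)
  show "emb (\<lambda>T. v T + w T) \<in> D.ind_space" if "emb v \<in> D.ind_space" "emb w \<in> D.ind_space" for v w :: "tabloid \<Rightarrow> 'a"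
    unfolding emb_add[abs_def] by (rule D.ind_space_add[OF that])
  show "emb (\<lambda>T. c * v T) \<in> D.ind_space" if "emb v \<in> D.ind_space" for c and v :: "tabloid \<Rightarrow> 'a"
    unfolding emb_smult[abs_def] by (rule D.ind_space_scale[OF that])
qed

end

section \<open>The induced module as a function space\<close>

context partition
begin

section \<open>The tensor space before the relations are factored out\<close>

abbreviation Perms :: "(nat \<Rightarrow> nat) set" where "Perms \<equiv> {p. p permutes {1..n}}"

abbreviation TS :: "('a :: field, (nat \<Rightarrow> nat) \<Rightarrow> tabloid \<Rightarrow> 'a) module" where
  "TS \<equiv> tensor_space (sym_group n) (specht lam)"

abbreviation rel :: "((nat \<Rightarrow> nat) \<Rightarrow> tabloid \<Rightarrow> 'a :: field) set" where
  "rel \<equiv> tensor_relations (sym_group n) (carrier (sym_group (n - 1))) (specht lam) perm_act"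

abbreviation pure :: "(nat \<Rightarrow> nat) \<Rightarrow> (tabloid \<Rightarrow> 'a :: field) \<Rightarrow> (nat \<Rightarrow> nat) \<Rightarrow> tabloid \<Rightarrow> 'a" where
  "pure \<equiv> pure_tensor (sym_group n) (specht lam)"

lemma carrier_sym_group: "carrier (sym_group n) = Perms"
  by (auto simp: sym_group_carrier)

lemma finite_Perms: "finite Perms"
  by (rule finite_permutations) simp

lemma TS_simps:
  "carrier TS = Perms \<rightarrow>\<^sub>E carrier (specht lam)"
  "f \<oplus>\<^bsub>TS\<^esub> g = (\<lambda>p\<in>Perms. \<lambda>T. f p T + g p T)"
  "\<zero>\<^bsub>TS\<^esub> = (\<lambda>p\<in>Perms. \<lambda>T. 0)"
  "c \<odot>\<^bsub>TS\<^esub> f = (\<lambda>p\<in>Perms. \<lambda>T. c * f p T)"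
  by (simp_all add: tensor_space_def specht_simps carrier_sym_group)

lemma pure_eq: "pure g v = (\<lambda>p\<in>Perms. if p = g then v else (\<lambda>T. 0))"
  unfolding pure_tensor_def specht_simps carrier_sym_group ..

lemma TS_D: "f \<in> carrier TS \<Longrightarrow> p permutes {1..n} \<Longrightarrow> f p \<in> carrier (specht lam)"
  by (auto simp: TS_simps)

lemma TS_eqI:
  assumes "f \<in> carrier TS" "g \<in> carrier TS" "\<And>p T. p permutes {1..n} \<Longrightarrow> f p T = g p T"
  shows "f = g"
  using assms(1,2) unfolding TS_simps by (rule PiE_ext) (use assms(3) in blast)

lemma TS_closed:
  fixes f g :: "(nat \<Rightarrow> nat) \<Rightarrow> tabloid \<Rightarrow> 'a :: field"
  assumes "f \<in> carrier TS"
  shows "g \<in> carrier TS \<Longrightarrow> f \<oplus>\<^bsub>TS\<^esub> g \<in> carrier TS" and "c \<odot>\<^bsub>TS\<^esub> f \<in> carrier TS"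
  using TS_D[OF assms] TS_D[of g] by (auto simp: TS_simps(1) TS_simps(2)[of f g] TS_simps(4) intro!: specht_closed)

lemma zero_TS: "\<zero>\<^bsub>TS\<^esub> \<in> carrier (TS :: ('a :: field, _) module)"
  by (auto simp: TS_simps zero_specht)

lemma pure_closed: "v \<in> carrier (specht lam) \<Longrightarrow> pure g v \<in> carrier TS"
  by (auto simp: TS_simps pure_eq zero_specht)

lemma module_TS: "module class_ring (TS :: ('a :: field, _) module)"
proof (rule moduleI)
  show "cring (class_ring :: 'a ring)" by (rule class_cring.cring_axioms)
  show "abelian_group (TS :: ('a, _) module)"
  proof (rule abelian_groupI)
    fix f g h :: "(nat \<Rightarrow> nat) \<Rightarrow> tabloid \<Rightarrow> 'a"
    assume f: "f \<in> carrier TS" and g: "g \<in> carrier TS" and h: "h \<in> carrier TS"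
    show "f \<oplus>\<^bsub>TS\<^esub> g \<in> carrier TS" by (rule TS_closed(1)[OF f g])
    show "f \<oplus>\<^bsub>TS\<^esub> g \<oplus>\<^bsub>TS\<^esub> h = f \<oplus>\<^bsub>TS\<^esub> (g \<oplus>\<^bsub>TS\<^esub> h)"
      unfolding TS_simps(2) by (rule restrict_ext, rule ext) (simp add: add.assoc)
    show "f \<oplus>\<^bsub>TS\<^esub> g = g \<oplus>\<^bsub>TS\<^esub> f"
      unfolding TS_simps(2) by (rule restrict_ext, rule ext) (simp add: add.commute)
  next
    fix f :: "(nat \<Rightarrow> nat) \<Rightarrow> tabloid \<Rightarrow> 'a"
    assume f: "f \<in> carrier TS"
    show "\<zero>\<^bsub>TS\<^esub> \<oplus>\<^bsub>TS\<^esub> f = f"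
      by (rule TS_eqI[OF TS_closed(1)[OF zero_TS f] f]) (simp add: TS_simps)
    show "\<exists>g\<in>carrier TS. g \<oplus>\<^bsub>TS\<^esub> f = \<zero>\<^bsub>TS\<^esub>"
      by (rule bexI[OF _ TS_closed(2)[OF f, of "- 1"]]) (auto simp: TS_simps)
  qed (rule zero_TS)
next
  fix a b and f g :: "(nat \<Rightarrow> nat) \<Rightarrow> tabloid \<Rightarrow> 'a"
  assume f: "f \<in> carrier TS" and g: "g \<in> carrier TS"
  show "a \<odot>\<^bsub>TS\<^esub> f \<in> carrier TS" by (rule TS_closed(2)[OF f])
  show "(a \<oplus>\<^bsub>class_ring\<^esub> b) \<odot>\<^bsub>TS\<^esub> f = a \<odot>\<^bsub>TS\<^esub> f \<oplus>\<^bsub>TS\<^esub> b \<odot>\<^bsub>TS\<^esub> f"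
    "a \<odot>\<^bsub>TS\<^esub> (f \<oplus>\<^bsub>TS\<^esub> g) = a \<odot>\<^bsub>TS\<^esub> f \<oplus>\<^bsub>TS\<^esub> a \<odot>\<^bsub>TS\<^esub> g"
    "(a \<otimes>\<^bsub>class_ring\<^esub> b) \<odot>\<^bsub>TS\<^esub> f = a \<odot>\<^bsub>TS\<^esub> (b \<odot>\<^bsub>TS\<^esub> f)"
    unfolding TS_simps(2,4) class_ring_simps by (rule restrict_ext, rule ext, simp add: algebra_simps)+
  show "\<one>\<^bsub>class_ring\<^esub> \<odot>\<^bsub>TS\<^esub> f = f"
    by (rule TS_eqI[OF TS_closed(2)[OF f] f]) (simp add: TS_simps(4) class_ring_simps)
qed

lemma minus_TS:
  fixes f g :: "(nat \<Rightarrow> nat) \<Rightarrow> tabloid \<Rightarrow> 'a :: field"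
  assumes f: "f \<in> carrier TS" and g: "g \<in> carrier TS"
  shows "f \<ominus>\<^bsub>TS\<^esub> g = (\<lambda>p\<in>Perms. \<lambda>T. f p T - g p T)" and "f \<ominus>\<^bsub>TS\<^esub> g \<in> carrier TS"
proof -
  have ab: "abelian_group (TS :: ('a, _) module)" by (rule module.axioms(2)[OF module_TS])
  have "\<ominus>\<^bsub>TS\<^esub> g = (- 1) \<odot>\<^bsub>TS\<^esub> g"
    by (rule abelian_group.minus_equality[OF ab _ g TS_closed(2)[OF g]]) (auto simp: TS_simps)
  then show "f \<ominus>\<^bsub>TS\<^esub> g = (\<lambda>p\<in>Perms. \<lambda>T. f p T - g p T)"
    unfolding a_minus_def by (auto simp: TS_simps)
  show "f \<ominus>\<^bsub>TS\<^esub> g \<in> carrier TS" by (rule abelian_group.minus_closed[OF ab f g])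
qed

text \<open>The image of \<open>\<Sum>g \<otimes> f g\<close> in the model of the induced module.\<close>

definition total :: "((nat \<Rightarrow> nat) \<Rightarrow> tabloid \<Rightarrow> 'a :: field) \<Rightarrow> (nat \<Rightarrow> nat) \<Rightarrow> 'a" where
  "total f \<tau> = (\<Sum>g\<in>Perms. emb (f g) (\<tau> \<circ> g))"

lemma total_add: "total (f \<oplus>\<^bsub>TS\<^esub> g) \<tau> = total f \<tau> + total g \<tau>"
  unfolding total_def sum.distrib[symmetric] by (rule sum.cong) (simp_all add: TS_simps emb_add)

lemma total_smult: "total (c \<odot>\<^bsub>TS\<^esub> f) \<tau> = c * total f \<tau>"
  unfolding total_def sum_distrib_left by (rule sum.cong) (simp_all add: TS_simps emb_smult)

lemma total_zero: "total (\<zero>\<^bsub>TS\<^esub>) \<tau> = 0"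
  unfolding total_def by (rule sum.neutral) (simp add: TS_simps emb_zero)

lemma emb_diff: "emb (\<lambda>T. v T - w T) \<tau> = emb v \<tau> - emb w \<tau>"
  by (simp add: emb_def)

lemma total_minus:
  assumes "f \<in> carrier TS" "g \<in> carrier TS"
  shows "total (f \<ominus>\<^bsub>TS\<^esub> g) \<tau> = total f \<tau> - total g \<tau>"
  unfolding total_def minus_TS(1)[OF assms] sum_subtractf[symmetric]
  by (rule sum.cong) (simp_all add: emb_diff)

lemma total_pure: "g permutes {1..n} \<Longrightarrow> total (pure g v) \<tau> = emb v (\<tau> \<circ> g)"
proof -
  assume g: "g permutes {1..n}"
  have "total (pure g v) \<tau> = (\<Sum>p\<in>Perms. if p = g then emb v (\<tau> \<circ> p) else 0)"
    unfolding total_def by (rule sum.cong) (simp_all add: pure_eq emb_zero)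
  then show ?thesis using g finite_Perms by simp
qed

lemma total_ind_space:
  fixes f :: "(nat \<Rightarrow> nat) \<Rightarrow> tabloid \<Rightarrow> 'a :: field"
  assumes f: "f \<in> carrier TS"
  shows "total f \<in> D.ind_space"
  unfolding total_def[abs_def]
proof (rule D.ind_space_sum)
  fix g assume "g \<in> Perms"
  then have g: "g permutes {1..n}" by simp
  show "(\<lambda>\<tau>. emb (f g) (\<tau> \<circ> g)) \<in> D.ind_space"
    by (rule D.ind_space_act[OF emb_specht[OF TS_D[OF f g]] g])
qed

lemma total_surj:
  fixes F :: "(nat \<Rightarrow> nat) \<Rightarrow> 'a :: field"
  assumes "F \<in> D.ind_space"
  shows "\<exists>f\<in>carrier TS. total f = F"
  using assms
proof (induction rule: D.ind_space.induct)
  case zero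
  show ?case by (rule bexI[OF _ zero_TS]) (rule ext, rule total_zero)
next
  case (step F g c)
  from step.IH obtain f where f: "f \<in> carrier TS" "total f = F" by blast
  let ?f = "f \<oplus>\<^bsub>TS\<^esub> (c \<odot>\<^bsub>TS\<^esub> pure g (polytabloid lam t0))"
  have "total ?f = (\<lambda>\<tau>. F \<tau> + c * D.e (\<tau> \<circ> g))"
    by (rule ext) (simp only: total_add total_smult total_pure[OF step.hyps(2)] f(2) emb_polytabloid[OF t0])
  moreover have "?f \<in> carrier TS"
    by (intro TS_closed f pure_closed polytabloid_in_specht t0)
  ultimately show ?case by blast
qed

section \<open>The relations as a kernel\<close>

lemma rel_generators:
  "rel = LinearCombinations.module.span class_ring TS
    {pure (g \<circ> h) v \<ominus>\<^bsub>TS\<^esub> pure g (perm_act h v) |g h v.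
      g permutes {1..n} \<and> h permutes {1..n - 1} \<and> v \<in> carrier (specht lam)}"
  unfolding tensor_relations_def sym_group_carrier sym_group_mult ..

lemma rel_generators_subset:
  "{pure (g \<circ> h) v \<ominus>\<^bsub>TS\<^esub> pure g (perm_act h v) |g h v.
      g permutes {1..n} \<and> h permutes {1..n - 1} \<and> v \<in> carrier (specht lam)} \<subseteq> carrier (TS :: ('a :: field, _) module)"
  using minus_TS(2)[OF pure_closed pure_closed[OF perm_act_specht]] by blast

lemma submodule_rel: "LinearCombinations.submodule class_ring rel (TS :: ('a :: field, _) module)"
proof -
  have "submodule class_ring rel (TS :: ('a, _) module)"
    unfolding rel_generators
    by (rule LinearCombinations.module.span_is_submodule[OF module_TS rel_generators_subset])
  then show ?thesis .
qed

text \<open>The two sides of a generating relation have the same total, because \<open>emb\<close>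
  turns the action of \<open>h\<close> into composition with \<open>h\<close>.\<close>

lemma rel_subset: "rel \<subseteq> {f \<in> carrier TS. total f = (\<lambda>\<tau>. 0 :: 'a :: field)}"
proof -
  let ?N = "{f \<in> carrier TS. total f = (\<lambda>\<tau>. 0 :: 'a)}"
  have "LinearCombinations.submodule class_ring ?N TS"
  proof (rule LinearCombinations.submodule.intro[OF module_TS])
    show "\<zero>\<^bsub>TS\<^esub> \<in> ?N" using zero_TS by (simp add: fun_eq_iff total_zero)
  qed (auto simp: fun_eq_iff total_add total_smult TS_closed)
  then show ?thesis
    unfolding rel_generators
  proof (rule LinearCombinations.module.span_is_subset[OF module_TS, rotated], intro subsetI)
    fix f :: "(nat \<Rightarrow> nat) \<Rightarrow> tabloid \<Rightarrow> 'a"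
    assume "f \<in> {pure (g \<circ> h) v \<ominus>\<^bsub>TS\<^esub> pure g (perm_act h v) |g h v.
      g permutes {1..n} \<and> h permutes {1..n - 1} \<and> v \<in> carrier (specht lam)}"
    then obtain g h v where f: "f = pure (g \<circ> h) v \<ominus>\<^bsub>TS\<^esub> pure g (perm_act h v)"
      and g: "g permutes {1..n}" and h: "h permutes {1..n - 1}" and v: "v \<in> carrier (specht lam)" by blast
    have gh: "g \<circ> h permutes {1..n}" using permutes_compose[OF _ g] permutes_n[OF h] by blast
    note cl = pure_closed[OF v, of "g \<circ> h"] pure_closed[OF perm_act_specht[OF v h], of g]
    have "total f \<tau> = 0" for \<tau>
      unfolding f total_minus[OF cl] total_pure[OF gh] total_pure[OF g] emb_act[OF h] by (simp only: comp_assoc diff_self)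
    then show "f \<in> ?N" using minus_TS(2)[OF cl] f by auto
  qed
qed

lemma TS_induct:
  fixes f :: "(nat \<Rightarrow> nat) \<Rightarrow> tabloid \<Rightarrow> 'a :: field"
  assumes f: "f \<in> carrier TS" and zero: "P (\<zero>\<^bsub>TS\<^esub>)"
    and pure: "\<And>g v. g permutes {1..n} \<Longrightarrow> v \<in> carrier (specht lam) \<Longrightarrow> P (pure g v)"
    and add: "\<And>f g. P f \<Longrightarrow> P g \<Longrightarrow> P (f \<oplus>\<^bsub>TS\<^esub> g)"
  shows "P f"
proof -
  have "P (\<lambda>p\<in>Perms. if p \<in> Q then f p else (\<lambda>T. 0))" if "Q \<subseteq> Perms" for Q
    using finite_subset[OF that finite_Perms] that
  proof (induction rule: finite_subset_induct')
    case empty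
    have "(\<lambda>p\<in>Perms. if p \<in> {} then f p else (\<lambda>T. 0)) = \<zero>\<^bsub>TS\<^esub>"
      unfolding TS_simps(3) by (rule restrict_ext) simp
    then show ?case using zero by (simp only:)
  next
    case (insert g Q)
    have "P (pure g (f g))" using insert.hyps(2) by (intro pure TS_D[OF f]) auto
    from add[OF this insert.IH]
    have "P (pure g (f g) \<oplus>\<^bsub>TS\<^esub> (\<lambda>p\<in>Perms. if p \<in> Q then f p else (\<lambda>T. 0)))" .
    also have "pure g (f g) \<oplus>\<^bsub>TS\<^esub> (\<lambda>p\<in>Perms. if p \<in> Q then f p else (\<lambda>T. 0)) =
        (\<lambda>p\<in>Perms. if p \<in> insert g Q then f p else (\<lambda>T. 0))"
      unfolding TS_simps pure_eq using insert.hyps(4) by (intro restrict_ext ext) auto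
    finally show ?case .
  qed
  from this[of Perms] have "P (restrict f Perms)" by (simp cong: restrict_cong)
  moreover have "restrict f Perms = f" using f unfolding TS_simps by (rule PiE_restrict)
  ultimately show ?thesis by simp
qed

lemma rel_closed:
  shows "f \<in> rel \<Longrightarrow> g \<in> rel \<Longrightarrow> f \<oplus>\<^bsub>TS\<^esub> g \<in> (rel :: ((nat \<Rightarrow> nat) \<Rightarrow> tabloid \<Rightarrow> 'a :: field) set)"
    and "\<zero>\<^bsub>TS\<^esub> \<in> (rel :: ((nat \<Rightarrow> nat) \<Rightarrow> tabloid \<Rightarrow> 'a :: field) set)"
  using LinearCombinations.submodule.m_closed[OF submodule_rel] LinearCombinations.submodule.zero_closed[OF submodule_rel]
  by blast+

lemma in_rel: "g permutes {1..n} \<Longrightarrow> h permutes {1..n - 1} \<Longrightarrow> v \<in> carrier (specht lam) \<Longrightarrow>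
  pure (g \<circ> h) v \<ominus>\<^bsub>TS\<^esub> pure g (perm_act h v) \<in> (rel :: ((nat \<Rightarrow> nat) \<Rightarrow> tabloid \<Rightarrow> 'a :: field) set)"
  unfolding rel_generators
  by (rule subsetD[OF LinearCombinations.module.in_own_span[OF module_TS rel_generators_subset]]) blast

text \<open>The transpositions \<open>(x n)\<close> represent the cosets of the subgroup fixing \<open>n\<close>.\<close>

lemma coset_normal_form:
  fixes f :: "(nat \<Rightarrow> nat) \<Rightarrow> tabloid \<Rightarrow> 'a :: field"
  assumes "f \<in> carrier TS"
  shows "\<exists>k\<in>rel. \<exists>f'\<in>carrier TS. f = k \<oplus>\<^bsub>TS\<^esub> f' \<and>
    (\<forall>g\<in>Perms. g \<notin> (\<lambda>x. Transposition.transpose x n) ` {1..n} \<longrightarrow> f' g = (\<lambda>T. 0))"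
    (is "?P f")
  using assms
proof (rule TS_induct)
  show "?P (\<zero>\<^bsub>TS\<^esub>)"
    by (rule bexI[OF _ rel_closed(2)], rule bexI[OF _ zero_TS]) (simp add: TS_simps cong: restrict_cong)
next
  fix g :: "nat \<Rightarrow> nat" and v :: "tabloid \<Rightarrow> 'a"
  assume g: "g permutes {1..n}" and v: "v \<in> carrier (specht lam)"
  \<comment> \<open>\<open>h\<close> fixes \<open>n\<close>, so \<open>g\<close> is the coset
    representative \<open>?r\<close> followed on the right by an element of the subgroup, and one
    generating relation carries \<open>pure g v\<close> to the representative.\<close>
  let ?r = "Transposition.transpose (g n) n"
  define h where "h = ?r \<circ> g"
  have gn: "g n \<in> {1..n}" using permutes_in_image[OF g, of n] n by simp
  have r: "?r permutes {1..n}" by (rule permutes_swap_id) (use gn n in auto)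
  have h': "h permutes {1..n}" unfolding h_def by (rule permutes_compose[OF g r])
  have hn: "h n = n" by (simp add: h_def)
  have h: "h permutes {1..n - 1}"
  proof (rule permutes_superset[OF h'])
    show "h x = x" if "x \<in> {1..n} - {1..n - 1}" for x
    proof -
      have "x = n" using that by auto
      then show ?thesis using hn by simp
    qed
  qed
  have gr: "g = ?r \<circ> h" by (simp add: h_def comp_assoc[symmetric])
  let ?f = "pure ?r (perm_act h v)"
  let ?k = "pure g v \<ominus>\<^bsub>TS\<^esub> ?f"
  note cl = pure_closed[OF v, of g] pure_closed[OF perm_act_specht[OF v h], of ?r]
  have "pure g v = ?k \<oplus>\<^bsub>TS\<^esub> ?f"
    by (rule TS_eqI[OF cl(1) TS_closed(1)[OF minus_TS(2)[OF cl] cl(2)]]) (simp add: minus_TS(1)[OF cl] TS_simps(2))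
  moreover have "?k \<in> rel" using in_rel[OF r h v] unfolding gr[symmetric] .
  moreover have "?f p = (\<lambda>T. 0)" if "p \<in> Perms" "p \<notin> (\<lambda>x. Transposition.transpose x n) ` {1..n}" for p
    using that gn by (auto simp: pure_eq)
  ultimately show "?P (pure g v)" using cl(2) by blast
next
  fix f g :: "(nat \<Rightarrow> nat) \<Rightarrow> tabloid \<Rightarrow> 'a"
  assume "?P f" "?P g"
  then obtain k f' l g' where kl: "k \<in> rel" "f' \<in> carrier TS" "f = k \<oplus>\<^bsub>TS\<^esub> f'"
    "\<And>p. p \<in> Perms \<Longrightarrow> p \<notin> (\<lambda>x. Transposition.transpose x n) ` {1..n} \<Longrightarrow> f' p = (\<lambda>T. 0)"
    "l \<in> rel" "g' \<in> carrier TS" "g = l \<oplus>\<^bsub>TS\<^esub> g'"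
    "\<And>p. p \<in> Perms \<Longrightarrow> p \<notin> (\<lambda>x. Transposition.transpose x n) ` {1..n} \<Longrightarrow> g' p = (\<lambda>T. 0)"
    by blast
  have "f \<oplus>\<^bsub>TS\<^esub> g = (k \<oplus>\<^bsub>TS\<^esub> l) \<oplus>\<^bsub>TS\<^esub> (f' \<oplus>\<^bsub>TS\<^esub> g')"
    unfolding kl(3,7) TS_simps(2) by (rule restrict_ext, rule ext) (simp add: algebra_simps)
  moreover have "(f' \<oplus>\<^bsub>TS\<^esub> g') p = (\<lambda>T. 0)"
    if "p \<in> Perms" "p \<notin> (\<lambda>x. Transposition.transpose x n) ` {1..n}" for p
    using kl(4,8)[OF that] that(1) by (simp add: TS_simps(2))
  ultimately show "?P (f \<oplus>\<^bsub>TS\<^esub> g)"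
    using rel_closed(1)[OF kl(1,5)] TS_closed(1)[OF kl(2,6)] by blast
qed

text \<open>On the support of an embedded element \<open>n\<close> is the only letter with the
  additional label, so translates by different coset representatives have disjoint supports.\<close>

lemma emb_nonzero_label:
  assumes w: "w \<in> carrier (specht lam)" "emb w \<tau> \<noteq> 0" and y: "y \<in> {1..n}" "y \<noteq> n"
  shows "\<tau> y \<noteq> height lam 0"
proof -
  have "tab \<tau> \<in> tabloids lam"
    using specht_closed(3)[OF w(1)] w(2) by (auto simp: emb_def perm_module_simps split: if_splits)
  then obtain s where s: "s \<in> tab \<tau>" by (auto simp: tabloids_eq)
  have "y \<in> {1..n - 1}" using y by auto
  moreover have "s \<in> tableaux lam" using s by (simp add: tab_def)
  ultimately obtain i j where ij: "(i, j) \<in> young lam" "y = s (i, j)" using tableau_surj by blast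
  then have "\<tau> y = i" using tabD[OF s] by simp
  then show ?thesis using ij(1) by (auto simp: young_def height_def)
qed

text \<open>Modulo the relations only the coset representatives carry values, and the corresponding
  summands of \<open>total\<close> have disjoint supports, so a zero total makes each of them
  vanish. Hence the induced module is isomorphic to its model \<open>D.ind_space\<close>.\<close>

lemma rel_eq: "rel = {f \<in> carrier TS. total f = (\<lambda>\<tau>. 0 :: 'a :: field)}"
proof (rule antisym[OF rel_subset], clarify)
  fix f :: "(nat \<Rightarrow> nat) \<Rightarrow> tabloid \<Rightarrow> 'a"
  assume f: "f \<in> carrier TS" and f0: "total f = (\<lambda>\<tau>. 0)"
  let ?r = "\<lambda>x. Transposition.transpose x n"
  from coset_normal_form[OF f] obtain k f' where kf: "k \<in> rel" "f' \<in> carrier TS" "f = k \<oplus>\<^bsub>TS\<^esub> f'"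
    and out: "\<And>p. p \<in> Perms \<Longrightarrow> p \<notin> ?r ` {1..n} \<Longrightarrow> f' p = (\<lambda>T. 0)" by blast
  have k: "k \<in> carrier TS" "total k = (\<lambda>\<tau>. 0)" using rel_subset kf(1) by blast+
  have tot: "total f' \<tau> = 0" for \<tau>
    using fun_cong[OF f0, of \<tau>] total_add[of k f' \<tau>] k(2) kf(3) by simp
  have "f' p = (\<lambda>T. 0)" if p: "p \<in> Perms" for p
  proof (cases "p \<in> ?r ` {1..n}")
    case True
    then obtain x where x: "x \<in> {1..n}" "p = ?r x" by blast
    have fp: "f' p \<in> carrier (specht lam)" using p by (intro TS_D[OF kf(2)]) simp
    have "emb (f' p) \<tau> = 0" for \<tau>
    proof (rule ccontr)
      assume nz: "emb (f' p) \<tau> \<noteq> 0"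
      have "emb (f' q) (\<tau> \<circ> p \<circ> q) = 0" if q: "q \<in> Perms - {p}" for q
      proof (cases "q \<in> ?r ` {1..n}")
        case True
        then obtain x' where x': "x' \<in> {1..n}" "q = ?r x'" by blast
        have "x' \<noteq> x" using q x x' by auto
        then have "p x' \<noteq> n" unfolding x(2) by (auto simp: Transposition.transpose_def split: if_splits)
        moreover have "p x' \<in> {1..n}" using permutes_in_image[of p "{1..n}" x'] p x'(1) by simp
        ultimately have "\<tau> (p x') \<noteq> height lam 0" using emb_nonzero_label[OF fp nz] by blast
        moreover have "q n = x'" using x'(2) by simp
        ultimately show ?thesis by (simp add: emb_def supp_def)
      qed (use out q in \<open>simp add: emb_zero\<close>)
      then have "total f' (\<tau> \<circ> p) = emb (f' p) (\<tau> \<circ> p \<circ> p)"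
        unfolding total_def using sum.mono_neutral_right[OF finite_Perms, of "{p}" "\<lambda>q. emb (f' q) (\<tau> \<circ> p \<circ> q)"] p by simp
      also have "\<tau> \<circ> p \<circ> p = \<tau>" unfolding x(2) by (simp add: comp_assoc)
      finally show False using nz tot by simp
    qed
    then have "emb (f' p) = emb (\<lambda>T. 0)" by (intro ext) (simp only: emb_zero)
    then show ?thesis by (rule emb_inject[OF specht_closed(3)[OF fp] specht_closed(3)[OF zero_specht]])
  qed (use out p in blast)
  then have "f' = \<zero>\<^bsub>TS\<^esub>" by (intro TS_eqI[OF kf(2) zero_TS]) (simp add: TS_simps(3))
  moreover have "k \<oplus>\<^bsub>TS\<^esub> \<zero>\<^bsub>TS\<^esub> = k"
    by (rule TS_eqI[OF TS_closed(1)[OF k(1) zero_TS] k(1)]) (simp add: TS_simps(2,3))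
  ultimately have "f = k" using kf(3) by simp
  then show "f \<in> rel" using kf(1) by simp
qed

end

section \<open>The endomorphism algebra\<close>

context partition
begin

declare One_nat_def [simp del]

section \<open>Elements of the induced module as fibres of \<open>total\<close>\<close>

abbreviation Ind :: "('a :: field, ((nat \<Rightarrow> nat) \<Rightarrow> tabloid \<Rightarrow> 'a) set) module" where
  "Ind \<equiv> induced (sym_group n) (carrier (sym_group (n - 1))) (specht lam) perm_act"

abbreviation ind_act :: "(nat \<Rightarrow> nat) \<Rightarrow> ((nat \<Rightarrow> nat) \<Rightarrow> tabloid \<Rightarrow> 'a :: field) set \<Rightarrow> ((nat \<Rightarrow> nat) \<Rightarrow> tabloid \<Rightarrow> 'a) set" where
  "ind_act \<equiv> induced_act (sym_group n) (carrier (sym_group (n - 1))) (specht lam) perm_act"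

text \<open>By \<open>rel_eq\<close> the cosets that make up the induced module are exactly the
  fibres over \<open>D.ind_space\<close>.\<close>

definition fib :: "((nat \<Rightarrow> nat) \<Rightarrow> 'a :: field) \<Rightarrow> ((nat \<Rightarrow> nat) \<Rightarrow> tabloid \<Rightarrow> 'a) set" where
  "fib F = {f \<in> carrier TS. total f = F}"

text \<open>On a nonempty fibre every choice of representative gives the same function, so this
  inverts \<open>fib\<close>.\<close>

definition val :: "((nat \<Rightarrow> nat) \<Rightarrow> tabloid \<Rightarrow> 'a :: field) set \<Rightarrow> (nat \<Rightarrow> nat) \<Rightarrow> 'a" where
  "val Y = total (SOME f. f \<in> Y)"

lemma fib_nonempty: "F \<in> D.ind_space \<Longrightarrow> \<exists>f. f \<in> fib (F :: (nat \<Rightarrow> nat) \<Rightarrow> 'a :: field)"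
  using total_surj[of F] by (auto simp: fib_def)

lemma val_fib: "F \<in> D.ind_space \<Longrightarrow> val (fib (F :: (nat \<Rightarrow> nat) \<Rightarrow> 'a :: field)) = F"
  using someI_ex[OF fib_nonempty[of F]] by (simp add: val_def fib_def)

lemma rel_coset:
  assumes f: "f \<in> carrier TS" "total f = (F :: (nat \<Rightarrow> nat) \<Rightarrow> 'a :: field)"
  shows "rel +>\<^bsub>TS\<^esub> f = fib F"
proof -
  have "\<exists>k\<in>rel. x = k \<oplus>\<^bsub>TS\<^esub> f" if "x \<in> carrier TS" "total x = F" for x
  proof (rule bexI)
    show "x = (x \<ominus>\<^bsub>TS\<^esub> f) \<oplus>\<^bsub>TS\<^esub> f"
      by (rule TS_eqI[OF that(1) TS_closed(1)[OF minus_TS(2)[OF that(1) f(1)] f(1)]])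
        (simp add: minus_TS(1)[OF that(1) f(1)] TS_simps(2))
    show "x \<ominus>\<^bsub>TS\<^esub> f \<in> rel"
      unfolding rel_eq using total_minus[OF that(1) f(1)] minus_TS(2)[OF that(1) f(1)] that(2) f(2)
      by (simp add: fun_eq_iff)
  qed
  moreover have "k \<oplus>\<^bsub>TS\<^esub> f \<in> carrier TS \<and> total (k \<oplus>\<^bsub>TS\<^esub> f) = F" if "k \<in> rel" for k
    using that f TS_closed(1)[of k f] by (simp add: rel_eq fun_eq_iff total_add)
  ultimately show ?thesis unfolding a_r_coset_def' fib_def by blast
qed

lemma Ind_carrier: "carrier (Ind :: ('a :: field, _) module) = fib ` D.ind_space"
proof -
  have "carrier (Ind :: ('a, _) module) = (\<Union>f\<in>carrier TS. {rel +>\<^bsub>TS\<^esub> f})"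
    by (simp add: induced_def quotient_def ring.defs FactRing_def A_RCOSETS_def')
  also have "\<dots> = (\<Union>f\<in>carrier TS. {fib (total f)})" by (simp add: rel_coset)
  also have "\<dots> = fib ` D.ind_space"
    using total_ind_space[where 'a = 'a] total_surj[where 'a = 'a] by blast
  finally show ?thesis .
qed

lemma Ind_zero: "\<zero>\<^bsub>Ind\<^esub> = fib (\<lambda>\<tau>. 0 :: 'a :: field)"
  by (simp add: induced_def quotient_def ring.defs FactRing_def rel_eq fib_def)

lemma Ind_add:
  assumes F: "F \<in> D.ind_space" and G: "G \<in> D.ind_space"
  shows "fib F \<oplus>\<^bsub>Ind\<^esub> fib G = fib (\<lambda>\<tau>. F \<tau> + G \<tau> :: 'a :: field)"
proof -
  have "fib F \<oplus>\<^bsub>Ind\<^esub> fib G = (\<Union>x\<in>fib F. \<Union>y\<in>fib G. {x \<oplus>\<^bsub>TS\<^esub> y})"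
    by (simp add: induced_def quotient_def ring.defs FactRing_def set_add_def')
  also have "\<dots> = fib (\<lambda>\<tau>. F \<tau> + G \<tau>)"
  proof
    show "(\<Union>x\<in>fib F. \<Union>y\<in>fib G. {x \<oplus>\<^bsub>TS\<^esub> y}) \<subseteq> fib (\<lambda>\<tau>. F \<tau> + G \<tau>)"
      by (auto simp: fib_def TS_closed total_add)
    show "fib (\<lambda>\<tau>. F \<tau> + G \<tau>) \<subseteq> (\<Union>x\<in>fib F. \<Union>y\<in>fib G. {x \<oplus>\<^bsub>TS\<^esub> y})"
    proof
      fix z assume "z \<in> fib (\<lambda>\<tau>. F \<tau> + G \<tau>)"
      then have z: "z \<in> carrier TS" "total z = (\<lambda>\<tau>. F \<tau> + G \<tau>)" by (auto simp: fib_def)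
      obtain y where y: "y \<in> carrier TS" "total y = G" using fib_nonempty[OF G] by (auto simp: fib_def)
      have "z \<ominus>\<^bsub>TS\<^esub> y \<in> fib F"
        using total_minus[OF z(1) y(1)] minus_TS(2)[OF z(1) y(1)] z(2) y(2) by (simp add: fib_def fun_eq_iff)
      moreover have "y \<in> fib G" using y by (simp add: fib_def)
      moreover have "z = (z \<ominus>\<^bsub>TS\<^esub> y) \<oplus>\<^bsub>TS\<^esub> y"
        by (rule TS_eqI[OF z(1) TS_closed(1)[OF minus_TS(2)[OF z(1) y(1)] y(1)]])
          (simp add: minus_TS(1)[OF z(1) y(1)] TS_simps(2))
      ultimately show "z \<in> (\<Union>x\<in>fib F. \<Union>y\<in>fib G. {x \<oplus>\<^bsub>TS\<^esub> y})" by blast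
    qed
  qed
  finally show ?thesis .
qed

lemma Union_constant: "\<exists>x. x \<in> Y \<Longrightarrow> (\<And>x. x \<in> Y \<Longrightarrow> f x = Z) \<Longrightarrow> (\<Union>x\<in>Y. f x) = Z"
  by auto

lemma Ind_smult:
  assumes F: "F \<in> D.ind_space"
  shows "c \<odot>\<^bsub>Ind\<^esub> fib F = fib (\<lambda>\<tau>. c * F \<tau> :: 'a :: field)"
proof -
  have "c \<odot>\<^bsub>Ind\<^esub> fib F = (\<Union>x\<in>fib F. rel +>\<^bsub>TS\<^esub> (c \<odot>\<^bsub>TS\<^esub> x))"
    by (simp add: induced_def quotient_def ring.defs)
  also have "\<dots> = fib (\<lambda>\<tau>. c * F \<tau>)"
  proof (rule Union_constant[OF fib_nonempty[OF F]])
    fix x assume "x \<in> fib F"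
    then show "rel +>\<^bsub>TS\<^esub> (c \<odot>\<^bsub>TS\<^esub> x) = fib (\<lambda>\<tau>. c * F \<tau>)"
      by (intro rel_coset) (auto simp: fib_def TS_closed fun_eq_iff total_smult)
  qed
  finally show ?thesis .
qed

text \<open>The action shifts the group argument by the inverse of \<open>k\<close>; reindexing the
  sum in \<open>total\<close> by \<open>k\<close> turns this into composition of the assignment with
  \<open>k\<close>.\<close>

lemma ind_act_fib:
  assumes F: "F \<in> D.ind_space" and k: "k permutes {1..n}"
  shows "ind_act k (fib F) = fib (\<lambda>\<tau>. F (\<tau> \<circ> k) :: 'a :: field)"
proof -
  let ?i = "Hilbert_Choice.inv k"
  have ip: "?i permutes {1..n}" by (rule permutes_inv[OF k])
  have "ind_act k (fib F) = (\<Union>x\<in>fib F. rel +>\<^bsub>TS\<^esub> (\<lambda>g\<in>Perms. x (?i \<circ> g)))"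
    unfolding induced_act_def carrier_sym_group sym_group_mult using k by (simp add: sym_group_carrier)
  also have "\<dots> = fib (\<lambda>\<tau>. F (\<tau> \<circ> k))"
  proof (rule Union_constant[OF fib_nonempty[OF F]])
    fix x assume "x \<in> fib F"
    then have x: "x \<in> carrier TS" "total x = F" by (auto simp: fib_def)
    show "rel +>\<^bsub>TS\<^esub> (\<lambda>g\<in>Perms. x (?i \<circ> g)) = fib (\<lambda>\<tau>. F (\<tau> \<circ> k))"
    proof (rule rel_coset)
      show "(\<lambda>g\<in>Perms. x (?i \<circ> g)) \<in> carrier TS"
        unfolding TS_simps(1) restrict_PiE_iff by (intro ballI TS_D[OF x(1)] permutes_compose[OF _ ip]) simp
      show "total (\<lambda>g\<in>Perms. x (?i \<circ> g)) = (\<lambda>\<tau>. F (\<tau> \<circ> k))"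
      proof
        fix \<tau>
        have "total (\<lambda>g\<in>Perms. x (?i \<circ> g)) \<tau> = (\<Sum>g\<in>Perms. emb (x (?i \<circ> g)) (\<tau> \<circ> g))"
          unfolding total_def by (rule sum.cong) simp_all
        also have "\<dots> = (\<Sum>g\<in>Perms. emb (x g) (\<tau> \<circ> k \<circ> g))"
        proof (rule sum.reindex_bij_witness[where i = "\<lambda>g. k \<circ> g" and j = "\<lambda>g. ?i \<circ> g"])
          fix g assume "g \<in> Perms"
          then have g: "g permutes {1..n}" by simp
          show "k \<circ> (?i \<circ> g) = g" "?i \<circ> (k \<circ> g) = g"
            by (simp_all only: comp_assoc[symmetric] permutes_inv_o[OF k] id_comp)
          then show "emb (x (?i \<circ> g)) (\<tau> \<circ> k \<circ> (?i \<circ> g)) = emb (x (?i \<circ> g)) (\<tau> \<circ> g)" by (simp only: comp_assoc)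
          show "?i \<circ> g \<in> Perms" "k \<circ> g \<in> Perms"
            using permutes_compose[OF g ip] permutes_compose[OF g k] by blast+
        qed
        also have "\<dots> = F (\<tau> \<circ> k)" unfolding x(2)[symmetric] total_def ..
        finally show "total (\<lambda>g\<in>Perms. x (?i \<circ> g)) \<tau> = F (\<tau> \<circ> k)" .
      qed
    qed
  qed
  finally show ?thesis .
qed

section \<open>Endomorphisms as operators on functions\<close>

abbreviation EndA :: "('a :: field, ((nat \<Rightarrow> nat) \<Rightarrow> tabloid \<Rightarrow> 'a) set \<Rightarrow> ((nat \<Rightarrow> nat) \<Rightarrow> tabloid \<Rightarrow> 'a) set) module" where
  "EndA \<equiv> End_induced_specht n lam"

text \<open>The restriction to the carrier makes the map extensional, as \<open>End_algebra\<close>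
  requires of its elements.\<close>

definition lift :: "(((nat \<Rightarrow> nat) \<Rightarrow> 'a :: field) \<Rightarrow> (nat \<Rightarrow> nat) \<Rightarrow> 'a)
    \<Rightarrow> ((nat \<Rightarrow> nat) \<Rightarrow> tabloid \<Rightarrow> 'a) set \<Rightarrow> ((nat \<Rightarrow> nat) \<Rightarrow> tabloid \<Rightarrow> 'a) set" where
  "lift \<Phi> = (\<lambda>Y\<in>carrier Ind. fib (\<Phi> (val Y)))"

lemma fib_closed: "F \<in> D.ind_space \<Longrightarrow> fib F \<in> carrier (Ind :: ('a :: field, _) module)"
  unfolding Ind_carrier by (rule imageI)

lemma Ind_cases:
  assumes "Y \<in> carrier (Ind :: ('a :: field, _) module)"
  obtains F where "F \<in> D.ind_space" "Y = fib F"
  using assms unfolding Ind_carrier by blast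

lemma lift_fib: "F \<in> D.ind_space \<Longrightarrow> lift \<Phi> (fib F) = fib (\<Phi> F :: (nat \<Rightarrow> nat) \<Rightarrow> 'a :: field)"
  by (simp add: lift_def fib_closed val_fib)

lemma lift_eqI: "(\<And>F. F \<in> D.ind_space \<Longrightarrow> \<phi> (fib F) = fib (\<Phi> F :: (nat \<Rightarrow> nat) \<Rightarrow> 'a :: field)) \<Longrightarrow>
  \<phi> \<in> extensional (carrier Ind) \<Longrightarrow> \<phi> = lift \<Phi>"
proof (rule extensionalityI[of _ "carrier Ind"])
  assume eq: "\<And>F. F \<in> D.ind_space \<Longrightarrow> \<phi> (fib F) = fib (\<Phi> F)"
  fix Y :: "((nat \<Rightarrow> nat) \<Rightarrow> tabloid \<Rightarrow> 'a) set" assume "Y \<in> carrier Ind"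
  then obtain F where "F \<in> D.ind_space" "Y = fib F" by (rule Ind_cases)
  then show "\<phi> Y = lift \<Phi> Y" by (simp only: eq lift_fib)
qed (auto simp: lift_def)

lemma lift_eq_iff:
  assumes "D.equivariant \<Phi>" "D.equivariant (\<Psi> :: ((nat \<Rightarrow> nat) \<Rightarrow> 'a :: field) \<Rightarrow> (nat \<Rightarrow> nat) \<Rightarrow> 'a)"
  shows "lift \<Phi> = lift \<Psi> \<longleftrightarrow> \<Phi> D.e = \<Psi> D.e"
proof
  assume "lift \<Phi> = lift \<Psi>"
  then have "fib (\<Phi> D.e) = fib (\<Psi> D.e)" using lift_fib[OF D.e_in_ind_space, of \<Phi>] lift_fib[OF D.e_in_ind_space, of \<Psi>] by simp
  then have "val (fib (\<Phi> D.e)) = val (fib (\<Psi> D.e))" by (rule arg_cong)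
  then show "\<Phi> D.e = \<Psi> D.e"
    unfolding val_fib[OF D.equivariantD(1)[OF assms(1) D.e_in_ind_space]] val_fib[OF D.equivariantD(1)[OF assms(2) D.e_in_ind_space]] .
next
  assume eq: "\<Phi> D.e = \<Psi> D.e"
  show "lift \<Phi> = lift \<Psi>"
  proof (rule lift_eqI)
    show "lift \<Phi> (fib F) = fib (\<Psi> F)" if "F \<in> D.ind_space" for F
      unfolding lift_fib[OF that] D.equivariant_eqI[OF assms eq that] ..
  qed (simp add: lift_def)
qed

lemma EndA_carrier: "\<phi> \<in> carrier EndA \<longleftrightarrow> \<phi> \<in> extensional (carrier Ind) \<and>
    (\<forall>Y\<in>carrier Ind. \<phi> Y \<in> carrier Ind) \<and>
    (\<forall>Y\<in>carrier Ind. \<forall>Z\<in>carrier Ind. \<phi> (Y \<oplus>\<^bsub>Ind\<^esub> Z) = \<phi> Y \<oplus>\<^bsub>Ind\<^esub> \<phi> Z) \<and>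
    (\<forall>c. \<forall>Y\<in>carrier Ind. \<phi> (c \<odot>\<^bsub>Ind\<^esub> Y) = c \<odot>\<^bsub>Ind\<^esub> \<phi> Y) \<and>
    (\<forall>g. g permutes {1..n} \<longrightarrow> (\<forall>Y\<in>carrier Ind. \<phi> (ind_act g Y) = ind_act g (\<phi> Y)))"
  unfolding End_induced_specht_def End_algebra_def LinearCombinations.module_hom_def
  by (auto simp: sym_group_carrier class_ring_simps Pi_iff)

lemma EndA_simps:
  "\<phi> \<oplus>\<^bsub>EndA\<^esub> \<psi> = (\<lambda>Y\<in>carrier Ind. \<phi> Y \<oplus>\<^bsub>Ind\<^esub> \<psi> Y)"
  "\<phi> \<otimes>\<^bsub>EndA\<^esub> \<psi> = (\<lambda>Y\<in>carrier Ind. \<phi> (\<psi> Y))"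
  "\<zero>\<^bsub>EndA\<^esub> = (\<lambda>Y\<in>carrier Ind. \<zero>\<^bsub>Ind\<^esub>)" "\<one>\<^bsub>EndA\<^esub> = (\<lambda>Y\<in>carrier Ind. Y)"
  "c \<odot>\<^bsub>EndA\<^esub> \<phi> = (\<lambda>Y\<in>carrier Ind. c \<odot>\<^bsub>Ind\<^esub> \<phi> Y)"
  by (simp_all add: End_induced_specht_def End_algebra_def)

text \<open>The operator belonging to an endomorphism is its conjugate under the bijection between
  fibres and functions.\<close>

lemma EndA_eq: "carrier EndA = lift ` {\<Phi> :: ((nat \<Rightarrow> nat) \<Rightarrow> 'a :: field) \<Rightarrow> (nat \<Rightarrow> nat) \<Rightarrow> 'a. D.equivariant \<Phi>}"
proof (intro antisym subsetI)
  fix \<phi> :: "((nat \<Rightarrow> nat) \<Rightarrow> tabloid \<Rightarrow> 'a) set \<Rightarrow> _" assume "\<phi> \<in> carrier EndA"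
  then have \<phi>: "\<phi> \<in> extensional (carrier Ind)" "\<And>Y. Y \<in> carrier Ind \<Longrightarrow> \<phi> Y \<in> carrier Ind"
    "\<And>Y Z. Y \<in> carrier Ind \<Longrightarrow> Z \<in> carrier Ind \<Longrightarrow> \<phi> (Y \<oplus>\<^bsub>Ind\<^esub> Z) = \<phi> Y \<oplus>\<^bsub>Ind\<^esub> \<phi> Z"
    "\<And>c Y. Y \<in> carrier Ind \<Longrightarrow> \<phi> (c \<odot>\<^bsub>Ind\<^esub> Y) = c \<odot>\<^bsub>Ind\<^esub> \<phi> Y"
    "\<And>g Y. g permutes {1..n} \<Longrightarrow> Y \<in> carrier Ind \<Longrightarrow> \<phi> (ind_act g Y) = ind_act g (\<phi> Y)"
    unfolding EndA_carrier by blast+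
  define \<Phi> where "\<Phi> F = val (\<phi> (fib F))" for F
  have mem: "\<Phi> F \<in> D.ind_space \<and> \<phi> (fib F) = fib (\<Phi> F)" if "F \<in> D.ind_space" for F
    using Ind_cases[OF \<phi>(2)[OF fib_closed[OF that]]] val_fib unfolding \<Phi>_def by metis
  have "D.equivariant \<Phi>"
    unfolding D.equivariant_def
  proof (intro conjI ballI allI impI)
    fix F :: "(nat \<Rightarrow> nat) \<Rightarrow> 'a" and \<tau> c assume F: "F \<in> D.ind_space"
    show "\<Phi> F \<in> D.ind_space" using mem[OF F] by blast
    have "\<Phi> (\<lambda>\<tau>. c * F \<tau>) = val (fib (\<lambda>\<tau>. c * \<Phi> F \<tau>))"
      unfolding \<Phi>_def[of "\<lambda>\<tau>. c * F \<tau>"] using \<phi>(4)[OF fib_closed[OF F], of c] mem[OF F]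
      by (simp add: Ind_smult F)
    also have "\<dots> = (\<lambda>\<tau>. c * \<Phi> F \<tau>)" using mem[OF F] by (intro val_fib D.ind_space_scale) blast
    finally show "\<Phi> (\<lambda>\<tau>. c * F \<tau>) \<tau> = c * \<Phi> F \<tau>" by (rule fun_cong)
  next
    fix F G :: "(nat \<Rightarrow> nat) \<Rightarrow> 'a" and \<tau> assume F: "F \<in> D.ind_space" and G: "G \<in> D.ind_space"
    have "\<Phi> (\<lambda>\<tau>. F \<tau> + G \<tau>) = val (fib (\<lambda>\<tau>. \<Phi> F \<tau> + \<Phi> G \<tau>))"
      unfolding \<Phi>_def[of "\<lambda>\<tau>. F \<tau> + G \<tau>"] using \<phi>(3)[OF fib_closed[OF F] fib_closed[OF G]] mem[OF F] mem[OF G]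
      by (simp add: Ind_add F G)
    also have "\<dots> = (\<lambda>\<tau>. \<Phi> F \<tau> + \<Phi> G \<tau>)" using mem[OF F] mem[OF G] by (intro val_fib D.ind_space_add) blast+
    finally show "\<Phi> (\<lambda>\<tau>. F \<tau> + G \<tau>) \<tau> = \<Phi> F \<tau> + \<Phi> G \<tau>" by (rule fun_cong)
  next
    fix F :: "(nat \<Rightarrow> nat) \<Rightarrow> 'a" and g \<tau> assume F: "F \<in> D.ind_space" and g: "g permutes {1..n}"
    have "\<phi> (fib (\<lambda>\<tau>. F (\<tau> \<circ> g))) = fib (\<lambda>\<tau>. \<Phi> F (\<tau> \<circ> g))"
      using \<phi>(5)[OF g fib_closed[OF F]] mem[OF F] by (simp only: ind_act_fib[OF _ g] F)
    then have "\<Phi> (\<lambda>\<tau>. F (\<tau> \<circ> g)) = val (fib (\<lambda>\<tau>. \<Phi> F (\<tau> \<circ> g)))" unfolding \<Phi>_def[of "\<lambda>\<tau>. F (\<tau> \<circ> g)"] by (rule arg_cong)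
    also have "\<dots> = (\<lambda>\<tau>. \<Phi> F (\<tau> \<circ> g))" using mem[OF F] by (intro val_fib D.ind_space_act[OF _ g]) blast
    finally show "\<Phi> (\<lambda>\<tau>. F (\<tau> \<circ> g)) \<tau> = \<Phi> F (\<tau> \<circ> g)" by (rule fun_cong)
  qed
  moreover have "\<phi> = lift \<Phi>" using mem by (intro lift_eqI \<phi>(1)) blast
  ultimately show "\<phi> \<in> lift ` {\<Phi>. D.equivariant \<Phi>}" by blast
next
  fix \<phi> :: "((nat \<Rightarrow> nat) \<Rightarrow> tabloid \<Rightarrow> 'a) set \<Rightarrow> _" assume "\<phi> \<in> lift ` {\<Phi>. D.equivariant \<Phi>}"
  then obtain \<Phi> where \<Phi>: "D.equivariant \<Phi>" and \<phi>: "\<phi> = lift \<Phi>" by blast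
  note D = D.equivariantD[OF \<Phi>]
  show "\<phi> \<in> carrier EndA"
    unfolding EndA_carrier
  proof (intro conjI ballI allI impI)
    show "\<phi> \<in> extensional (carrier Ind)" unfolding \<phi> lift_def by (rule restrict_extensional)
  next
    fix Y :: "((nat \<Rightarrow> nat) \<Rightarrow> tabloid \<Rightarrow> 'a) set" and c assume "Y \<in> carrier Ind"
    then obtain F where F: "F \<in> D.ind_space" "Y = fib F" by (rule Ind_cases)
    show "\<phi> Y \<in> carrier Ind" unfolding \<phi> F(2) lift_fib[OF F(1)] by (rule fib_closed[OF D(1)[OF F(1)]])
    have "\<Phi> (\<lambda>\<tau>. c * F \<tau>) = (\<lambda>\<tau>. c * \<Phi> F \<tau>)" by (rule ext) (rule D(3)[OF F(1)])
    then show "\<phi> (c \<odot>\<^bsub>Ind\<^esub> Y) = c \<odot>\<^bsub>Ind\<^esub> \<phi> Y"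
      unfolding \<phi> F(2) by (simp only: Ind_smult[OF F(1)] lift_fib[OF F(1)] lift_fib[OF D.ind_space_scale[OF F(1)]] Ind_smult[OF D(1)[OF F(1)]])
  next
    fix Y Z :: "((nat \<Rightarrow> nat) \<Rightarrow> tabloid \<Rightarrow> 'a) set" assume "Y \<in> carrier Ind" "Z \<in> carrier Ind"
    then obtain F G where F: "F \<in> D.ind_space" "Y = fib F" and G: "G \<in> D.ind_space" "Z = fib G"
      by (metis Ind_cases)
    have "\<Phi> (\<lambda>\<tau>. F \<tau> + G \<tau>) = (\<lambda>\<tau>. \<Phi> F \<tau> + \<Phi> G \<tau>)" by (rule ext) (rule D(2)[OF F(1) G(1)])
    then show "\<phi> (Y \<oplus>\<^bsub>Ind\<^esub> Z) = \<phi> Y \<oplus>\<^bsub>Ind\<^esub> \<phi> Z"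
      unfolding \<phi> F(2) G(2)
      by (simp only: Ind_add[OF F(1) G(1)] lift_fib[OF F(1)] lift_fib[OF G(1)] lift_fib[OF D.ind_space_add[OF F(1) G(1)]]
        Ind_add[OF D(1)[OF F(1)] D(1)[OF G(1)]])
  next
    fix g and Y :: "((nat \<Rightarrow> nat) \<Rightarrow> tabloid \<Rightarrow> 'a) set" assume g: "g permutes {1..n}" and "Y \<in> carrier Ind"
    then obtain F where F: "F \<in> D.ind_space" "Y = fib F" by (metis Ind_cases)
    have "\<Phi> (\<lambda>\<tau>. F (\<tau> \<circ> g)) = (\<lambda>\<tau>. \<Phi> F (\<tau> \<circ> g))" by (rule ext) (rule D(4)[OF F(1) g])
    then show "\<phi> (ind_act g Y) = ind_act g (\<phi> Y)"
      unfolding \<phi> F(2) by (simp only: ind_act_fib[OF F(1) g] lift_fib[OF F(1)] lift_fib[OF D.ind_space_act[OF F(1) g]] ind_act_fib[OF D(1)[OF F(1)] g])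
  qed
qed

text \<open>Surjectivity is the elimination at the test assignments, and the kernel is generated by
  \<open>residue_poly\<close>; both hold because an equivariant operator is determined by its value
  at \<open>e\<close>.\<close>

lemma split_quotient_EndA:
  assumes two: "(2 :: 'a :: field) \<noteq> 0"
  shows "split_quotient (EndA :: ('a, _) module) (\<lambda>p. lift (D.jm_poly p)) (addable_residues lam) (addable_mult lam)"
proof
  note eq = D.equivariant_jm_poly
  have mem: "D.jm_poly p F \<in> D.ind_space" if "F \<in> D.ind_space" for p and F :: "(nat \<Rightarrow> nat) \<Rightarrow> 'a"
    by (rule D.equivariantD(1)[OF eq that])
  have iff: "lift (D.jm_poly p) = lift (D.jm_poly p') \<longleftrightarrow>
      (\<Prod>r\<in>addable_residues lam. lin_factor r ^ addable_mult lam r) dvd p - p'" for p p' :: "'a poly"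
    unfolding lift_eq_iff[OF eq eq] D.jm_poly_e_eq_iff[OF two] residue_poly_eq ..
  then show "lift (D.jm_poly p) = lift (D.jm_poly p') \<longleftrightarrow>
      (\<Prod>r\<in>addable_residues lam. lin_factor r ^ addable_mult lam r) dvd p - p'" for p p' :: "'a poly" .
  show "carrier EndA = range (\<lambda>p :: 'a poly. lift (D.jm_poly p))"
  proof (intro antisym subsetI)
    fix \<phi> assume "\<phi> \<in> carrier (EndA :: ('a, _) module)"
    then obtain \<Phi> where \<Phi>: "D.equivariant \<Phi>" "\<phi> = lift \<Phi>" unfolding EndA_eq by blast
    from D.equivariant_eq_jm_poly_on_e[OF two \<Phi>(1)] obtain p where "\<Phi> D.e = D.jm_poly p D.e" by blast
    then have "\<phi> = lift (D.jm_poly p)" using \<Phi> lift_eq_iff[OF \<Phi>(1) eq] by blast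
    then show "\<phi> \<in> range (\<lambda>p :: 'a poly. lift (D.jm_poly p))" by blast
  qed (use eq EndA_eq in blast)
  fix p p' :: "'a poly" and c :: 'a
  have ext: "(\<lambda>Y\<in>carrier Ind. t Y) = lift \<Phi>"
    if "\<And>F. F \<in> D.ind_space \<Longrightarrow> t (fib F) = fib (\<Phi> F :: (nat \<Rightarrow> nat) \<Rightarrow> 'a)" for t \<Phi>
    by (rule lift_eqI) (simp_all add: that fib_closed)
  show "lift (D.jm_poly p) \<oplus>\<^bsub>EndA\<^esub> lift (D.jm_poly p') = lift (D.jm_poly (p + p'))"
    unfolding EndA_simps by (rule ext) (simp add: lift_fib Ind_add mem D.jm_poly_add[abs_def])
  show "lift (D.jm_poly p) \<otimes>\<^bsub>EndA\<^esub> lift (D.jm_poly p') = lift (D.jm_poly (p * p'))"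
    unfolding EndA_simps by (rule ext) (simp add: lift_fib mem D.jm_poly_mult)
  show "\<zero>\<^bsub>EndA\<^esub> = lift (D.jm_poly (0 :: 'a poly))"
    unfolding EndA_simps Ind_zero by (rule ext) (simp add: D.jm_poly_0[abs_def])
  show "\<one>\<^bsub>EndA\<^esub> = lift (D.jm_poly (1 :: 'a poly))"
    unfolding EndA_simps by (rule ext) (simp add: D.jm_poly_1)
  show "c \<odot>\<^bsub>EndA\<^esub> lift (D.jm_poly p) = lift (D.jm_poly (Polynomial.smult c p))"
    unfolding EndA_simps by (rule ext) (simp add: lift_fib Ind_smult mem D.jm_poly_smult[abs_def])
next
  show "finite (addable_residues lam :: 'a set)" by (simp add: addable_residues_def finite_addable)
  show "1 \<le> addable_mult lam r" if "r \<in> addable_residues lam" for r :: 'a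
  proof -
    from that obtain x where "x \<in> {x \<in> addable lam. residue x = r}" by (auto simp: addable_residues_def)
    moreover have "finite {x \<in> addable lam. residue x = r}" using finite_addable by simp
    ultimately have "addable_mult lam r \<noteq> 0" unfolding addable_mult_def by (simp only: card_eq_0_iff) blast
    then show ?thesis by simp
  qed
qed

end

lemma two_neq_zero: "CHAR('a :: field) \<noteq> 2 \<Longrightarrow> (2 :: 'a) \<noteq> 0"
proof
  assume char: "CHAR('a) \<noteq> 2" and "(2 :: 'a) = 0"
  then have "of_nat 2 = (0 :: 'a)" by simp
  then have "CHAR('a) dvd 2" unfolding of_nat_eq_0_iff_char_dvd .
  moreover from this have "CHAR('a) \<le> 2" by (rule dvd_imp_le) simp
  moreover have "CHAR('a) \<noteq> 0" using \<open>CHAR('a) dvd 2\<close> by (metis dvd_0_left zero_neq_numeral)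
  moreover have "CHAR('a) \<noteq> 1" by simp
  ultimately show False using char by linarith
qed

theorem theorem1p4:
  fixes n :: nat and lam :: "nat list"
  assumes "CHAR('a :: field) \<noteq> 2"
    and "1 \<le> n" and "is_partition lam (n - 1)"
  shows "let A = (End_induced_specht n lam :: ('a, _) module);
             R = (addable_residues lam :: 'a set)
         in \<exists>E. bij_betw E R (blocks A) \<and>
              (\<lambda>x. \<Oplus>\<^bsub>A\<^esub> r\<in>R. x r) \<in> alg_iso (prod_algebra R (\<lambda>r. block_algebra A (E r))) A \<and>
              (\<forall>r\<in>R. alg_isomorphic (block_algebra A (E r)) (trunc_poly_algebra (addable_mult lam r)) \<and>
                 vectorspace class_ring (block_algebra A (E r)) \<and>
                 vectorspace.fin_dim class_ring (block_algebra A (E r)) \<and>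
                 vectorspace.dim class_ring (block_algebra A (E r)) = addable_mult lam r)"
proof -
  interpret P: partition lam n by unfold_locales (use assms in auto)
  interpret Q: split_quotient "End_induced_specht n lam :: ('a, _) module" "\<lambda>p. P.lift (P.D.jm_poly p)"
    "addable_residues lam" "addable_mult lam"
    by (rule P.split_quotient_EndA[OF two_neq_zero[OF assms(1)]])
  show ?thesis
    unfolding Let_def
    \<comment> \<open>The witness is the family of ideals \<open>Q.E\<close>.\<close>
    using Q.bij_E Q.product_iso Q.block_trunc_iso Q.vectorspace_block Q.dim_block by blast
qed

end
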